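(* Let $\mathbb F$ be a finite field with $q$ elements and let $G=\bigcup_{n\ge1}\mathrm{GL}_n(\mathbb F)$, with the topology induced from its action on $\mathbf V=\bigcup_{n\ge1}\mathbb F^n$. There exists a unique isomorphism of rings $$\phi\colon\mathcal R_q^{\gg0}\to\Theta(G),\qquad \phi(\omega_{m,d})=[\Omega_{m,d}]\quad(m,d\in\mathbb N).$$
   Context: Let $\mathbf V_n=\mathbb F^n\subset\mathbf V$ (standard inclusions), and let $U_n\subset G$ be the subgroup fixing every element of $\mathbf V_n$. The topology on $G$ is the one in which pointwise stabilizers of finite subsets of $\mathbf V$ (equivalently the $U_n$) form a neighborhood basis of the identity. $\Omega_{m,d}$ is the set of $(d+m)$-dimensional subspaces of $\mathbf V$ containing $\mathbf V_m$, a $\hat G$-set via the action of $U_m$. Put $[n]_q=1+q+\cdots+q^{n-1}$ and $[n]_q!=[1]_q[2]_q\cdots[n]_q$. $\mathcal R_q$ is the ring of $p\in\mathbb Q[x]$ with $p([n]_q)\in\mathbb Z[1/q]$ for all $n\in\mathbb N$, and $\mathcal R_q^{\gg0}\subset\mathcal R_q$ is the subring of those $p$ with $p([n]_q)\in\mathbb Z$ for all sufficiently large $n$. Put $$\omega_{0,d}(x)=\frac{x(x-[1]_q)\cdots(x-[d-1]_q)}{q^{\binom d2}[d]_q!}\ (d\ge1),\qquad \omega_{0,0}=1,$$ and $\omega_{m,d}=S^{-m}\omega_{0,d}$, where $S$ is the automorphism $p(x)\mapsto p(qx+1)$ of $\mathcal R_q$; these lie in $\mathcal R_q^{\gg0}$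 and satisfy $\omega_{m,d}([n]_q)=\frac{[n-m]_q!}{[d]_q![n-m-d]_q!}$ for $n\ge m+d$. A $G$-set is a set with a smooth action of $G$, i.e. every stabilizer is open (same for open subgroups). Finitary means finitely many orbits. A $\hat G$-set is a set $X$ with a smooth action of some open subgroup $U$ of $G$ (a group of definition), where shrinking $U$ does not change the $\hat G$-set; it is finitary if $U$ has finitely many orbits (independent of $U$). Maps of $\hat G$-sets are functions equivariant for some common open group of definition. For $g\in G$, $X^g$ is the same set with action $h\bullet x=(g^{-1}hg)\cdot x$. $\Theta(G)$ is the commutative ring generated by symbols $[X]$, one for each finitary $\hat G$-set $X$, subject to: (a) $[X]=[Y]$ if $X\cong Y$; (b) $[X]=1$ if $X$ is a singleton; (c) $[X\amalg Y]=[X]+[Y]$; (d) $[X]=[X^g]$ for $g\in G$; (e) if $U$ is an open subgroup and $X\to Y$ is a map of transitive $U$-sets with fiber $F$ over some point, then $[X]=[F]\cdot[Y]$. *)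

theory Defs
  imports
    "HOL-Algebra.QuotRing"
    "HOL-Algebra.Group_Action"
    "HOL-Analysis.Abstract_Topology"
    "HOL-Library.Poly_Mapping"
    "HOL-Computational_Algebra.Polynomial"
begin

section \<open>Rings\<close>

definition ring_on :: "'a::comm_ring_1 set \<Rightarrow> 'a ring" where
  "ring_on A = \<lparr>carrier = A, monoid.mult = (*), one = 1, zero = 0, add = (+)\<rparr>"

text \<open>The free commutative ring on a set \<open>I\<close> of symbols is the ring of integer polynomials
  in commuting variables from \<open>I\<close>: a monomial is a finitely supported exponent function, a
  polynomial is a finitely supported function from monomials to the integers.\<close>

type_synonym 'i int_mpoly = "('i \<Rightarrow>\<^sub>0 nat) \<Rightarrow>\<^sub>0 int"

definition free_cring :: "'i set \<Rightarrow> 'i int_mpoly ring" where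
  "free_cring I = ring_on {p. \<forall>m \<in> Poly_Mapping.keys p. Poly_Mapping.keys m \<subseteq> I}"

definition symb :: "'i \<Rightarrow> 'i int_mpoly" where
  "symb i = Poly_Mapping.single (Poly_Mapping.single i 1) 1"


section \<open>Sets with a germ of a smooth action\<close>

text \<open>Below, \<open>G\<close> is a group and \<open>T\<close> a topology on its carrier.  A \<open>gset\<close> consists of a group of
  definition, a set of points and an action on it.  Passing to a smaller group of definition
  changes the record, but only up to isomorphism in the sense of \<open>ghat_iso\<close> below.\<close>

record ('g, 'x) gset =
  defgrp :: "'g set"
  pts :: "'x set"
  act :: "'g \<Rightarrow> 'x \<Rightarrow> 'x"

definition open_subgroup :: "'g monoid \<Rightarrow> 'g topology \<Rightarrow> 'g set \<Rightarrow> bool" where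
  "open_subgroup G T U \<longleftrightarrow> subgroup U G \<and> openin T U"

definition ghat_set :: "'g monoid \<Rightarrow> 'g topology \<Rightarrow> ('g, 'x) gset \<Rightarrow> bool" where
  "ghat_set G T X \<longleftrightarrow>
     open_subgroup G T (defgrp X) \<and>
     group_action (G\<lparr>carrier := defgrp X\<rparr>) (pts X) (act X) \<and>
     (\<forall>x \<in> pts X. openin T (stabilizer (G\<lparr>carrier := defgrp X\<rparr>) (act X) x))"

definition finitary :: "'g monoid \<Rightarrow> ('g, 'x) gset \<Rightarrow> bool" where
  "finitary G X \<longleftrightarrow> finite (orbits (G\<lparr>carrier := defgrp X\<rparr>) (pts X) (act X))"

definition finitary_ghat_sets :: "'g monoid \<Rightarrow> 'g topology \<Rightarrow> ('g, 'x) gset set" where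
  "finitary_ghat_sets G T = {X. ghat_set G T X \<and> finitary G X}"

definition equivariant_map ::
  "'g set \<Rightarrow> ('g, 'x) gset \<Rightarrow> ('g, 'y) gset \<Rightarrow> ('x \<Rightarrow> 'y) \<Rightarrow> bool" where
  "equivariant_map U X Y f \<longleftrightarrow>
     f \<in> pts X \<rightarrow> pts Y \<and> (\<forall>g \<in> U. \<forall>x \<in> pts X. f (act X g x) = act Y g (f x))"

definition ghat_map ::
  "'g monoid \<Rightarrow> 'g topology \<Rightarrow> ('g, 'x) gset \<Rightarrow> ('g, 'y) gset \<Rightarrow> ('x \<Rightarrow> 'y) \<Rightarrow> bool" where
  "ghat_map G T X Y f \<longleftrightarrow>
     (\<exists>U. open_subgroup G T U \<and> U \<subseteq> defgrp X \<and> U \<subseteq> defgrp Y \<and> equivariant_map U X Y f)"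

definition ghat_iso ::
  "'g monoid \<Rightarrow> 'g topology \<Rightarrow> ('g, 'x) gset \<Rightarrow> ('g, 'y) gset \<Rightarrow> bool" where
  "ghat_iso G T X Y \<longleftrightarrow> (\<exists>f. ghat_map G T X Y f \<and> bij_betw f (pts X) (pts Y))"

definition gset_coprod ::
  "('g, 'x) gset \<Rightarrow> ('g, 'y) gset \<Rightarrow> ('g, 'x + 'y) gset" where
  "gset_coprod X Y =
     \<lparr>defgrp = defgrp X \<inter> defgrp Y,
      pts = pts X <+> pts Y,
      act = (\<lambda>g. \<lambda>z \<in> pts X <+> pts Y. map_sum (act X g) (act Y g) z)\<rparr>"

text \<open>The conjugate \<open>X\<^sup>g\<close>; the group of definition moves to \<open>g U g\<^sup>-\<^sup>1\<close>.\<close>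

definition gset_conj :: "'g monoid \<Rightarrow> ('g, 'x) gset \<Rightarrow> 'g \<Rightarrow> ('g, 'x) gset" where
  "gset_conj G X g =
     \<lparr>defgrp = (\<lambda>u. g \<otimes>\<^bsub>G\<^esub> u \<otimes>\<^bsub>G\<^esub> inv\<^bsub>G\<^esub> g) ` defgrp X,
      pts = pts X,
      act = (\<lambda>h. act X (inv\<^bsub>G\<^esub> g \<otimes>\<^bsub>G\<^esub> h \<otimes>\<^bsub>G\<^esub> g))\<rparr>"

definition transitive_gset :: "'g monoid \<Rightarrow> ('g, 'x) gset \<Rightarrow> bool" where
  "transitive_gset G X \<longleftrightarrow>
     pts X \<noteq> {} \<and> transitive_action (G\<lparr>carrier := defgrp X\<rparr>) (pts X) (act X)"

text \<open>The fiber of \<open>f\<close> over \<open>y\<close>, with its action of the stabilizer of \<open>y\<close>.\<close>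

definition gset_fiber ::
  "'g monoid \<Rightarrow> ('g, 'x) gset \<Rightarrow> ('g, 'y) gset \<Rightarrow> ('x \<Rightarrow> 'y) \<Rightarrow> 'y \<Rightarrow> ('g, 'x) gset" where
  "gset_fiber G X Y f y =
     \<lparr>defgrp = stabilizer (G\<lparr>carrier := defgrp Y\<rparr>) (act Y) y,
      pts = {x \<in> pts X. f x = y},
      act = (\<lambda>g. restrict (act X g) {x \<in> pts X. f x = y})\<rparr>"


section \<open>The ring \<open>\<Theta>(G)\<close>\<close>

text \<open>The symbols are the finitary \<open>gset\<close>s whose points lie in a type \<open>'x\<close>.  As long as every
  finitary set is in bijection with a subset of \<open>'x\<close> and \<open>'x\<close> is infinite, the ring does not
  depend on \<open>'x\<close>.  This holds for a countable group and any infinite \<open>'x\<close>, since then finitary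
  sets are countable.\<close>

definition theta_rels :: "'g monoid \<Rightarrow> 'g topology \<Rightarrow> ('g, 'x) gset int_mpoly set" where
  "theta_rels G T =
     (let S = finitary_ghat_sets G T in
       {symb X - symb Y | X Y. X \<in> S \<and> Y \<in> S \<and> ghat_iso G T X Y}
     \<union> {symb X - 1 | X. X \<in> S \<and> is_singleton (pts X)}
     \<union> {symb Z - (symb X + symb Y) | X Y Z.
          X \<in> S \<and> Y \<in> S \<and> Z \<in> S \<and> ghat_iso G T Z (gset_coprod X Y)}
     \<union> {symb X - symb (gset_conj G X g) | X g. X \<in> S \<and> g \<in> carrier G}
     \<union> {symb X - symb (gset_fiber G X Y f y) * symb Y | X Y f y.
          X \<in> S \<and> Y \<in> S \<and> defgrp X = defgrp Y \<and>
          transitive_gset G X \<and> transitive_gset G Y \<and>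
          equivariant_map (defgrp Y) X Y f \<and> y \<in> pts Y})"

definition theta_ideal :: "'g monoid \<Rightarrow> 'g topology \<Rightarrow> ('g, 'x) gset int_mpoly set" where
  "theta_ideal G T = Idl\<^bsub>free_cring (finitary_ghat_sets G T)\<^esub> (theta_rels G T)"

definition Theta :: "'g monoid \<Rightarrow> 'g topology \<Rightarrow> ('g, 'x) gset int_mpoly set ring" where
  "Theta G T = free_cring (finitary_ghat_sets G T) Quot theta_ideal G T"

definition theta_class ::
  "'g monoid \<Rightarrow> 'g topology \<Rightarrow> ('g, 'x) gset \<Rightarrow> ('g, 'x) gset int_mpoly set" where
  "theta_class G T X = theta_ideal G T +>\<^bsub>free_cring (finitary_ghat_sets G T)\<^esub> symb X"


section \<open>The infinite general linear group\<close>

text \<open>\<open>\<^bold>V\<close> is the space of finitely supported sequences.\<close>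

type_synonym 'f fsv = "nat \<Rightarrow>\<^sub>0 'f"

definition fscale :: "'f::field \<Rightarrow> 'f fsv \<Rightarrow> 'f fsv" where
  "fscale c v = Poly_Mapping.map ((*) c) v"

lemma lookup_fscale: "Poly_Mapping.lookup (fscale c v) i = c * Poly_Mapping.lookup v i"
  by (simp add: fscale_def map.rep_eq when_def)

lemma vector_space_fscale: "vector_space (fscale :: 'f::field \<Rightarrow> 'f fsv \<Rightarrow> 'f fsv)"
  by unfold_locales
    (auto intro!: poly_mapping_eqI simp: lookup_fscale lookup_add algebra_simps)

definition Vn :: "nat \<Rightarrow> ('f::field) fsv set" where
  "Vn n = {v. Poly_Mapping.keys v \<subseteq> {..<n}}"

text \<open>\<open>GL\<^sub>n(\<bbbF>)\<close> inside \<open>G\<close>: an invertible matrix acts on the first \<open>n\<close> coordinates and fixes the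
  remaining basis vectors.\<close>

definition GLn :: "nat \<Rightarrow> (('f::field) fsv \<Rightarrow> 'f fsv) set" where
  "GLn n = {g. Vector_Spaces.linear fscale fscale g \<and> bij g \<and> g ` Vn n = Vn n \<and>
               (\<forall>i \<ge> n. g (Poly_Mapping.single i 1) = Poly_Mapping.single i 1)}"

definition GL_inf :: "(('f::field) fsv \<Rightarrow> 'f fsv) monoid" where
  "GL_inf = \<lparr>carrier = (\<Union>n \<in> {1..}. GLn n), monoid.mult = (\<circ>), one = id\<rparr>"

definition pointwise_stab :: "('f::field) fsv set \<Rightarrow> ('f fsv \<Rightarrow> 'f fsv) set" where
  "pointwise_stab S = {g \<in> carrier GL_inf. \<forall>v \<in> S. g v = v}"

definition GL_inf_top :: "(('f::field) fsv \<Rightarrow> 'f fsv) topology" where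
  "GL_inf_top =
     topology_generated_by
       {g <#\<^bsub>GL_inf\<^esub> pointwise_stab S | g S. g \<in> carrier GL_inf \<and> finite S}"

text \<open>\<open>dim\<close> is \<open>0\<close> for infinite-dimensional spaces, hence the finiteness condition.\<close>

definition Omega_pts :: "nat \<Rightarrow> nat \<Rightarrow> ('f::field) fsv set set" where
  "Omega_pts m d =
     {W. module.subspace fscale W \<and> Vn m \<subseteq> W \<and>
         (\<exists>B. finite B \<and> W = module.span fscale B) \<and> vector_space.dim fscale W = d + m}"

definition Omega :: "nat \<Rightarrow> nat \<Rightarrow> (('f::field) fsv \<Rightarrow> 'f fsv, 'f fsv set) gset" where
  "Omega m d =
     \<lparr>defgrp = pointwise_stab (Vn m),
      pts = Omega_pts m d,
      act = (\<lambda>g. \<lambda>W \<in> Omega_pts m d. g ` W)\<rparr>"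


section \<open>Polynomials that are integral at \<open>q\<close>-integers\<close>

definition qint :: "nat \<Rightarrow> nat \<Rightarrow> rat" where
  "qint q n = (\<Sum>i<n. of_nat q ^ i)"

definition qfact :: "nat \<Rightarrow> nat \<Rightarrow> rat" where
  "qfact q n = (\<Prod>i=1..n. qint q i)"

definition Z_inv :: "nat \<Rightarrow> rat set" where
  "Z_inv q = {of_int a / of_nat q ^ k | a k. True}"

definition R_q :: "nat \<Rightarrow> rat poly set" where
  "R_q q = {p. \<forall>n. poly p (qint q n) \<in> Z_inv q}"

definition R_q_large :: "nat \<Rightarrow> rat poly ring" where
  "R_q_large q = ring_on {p \<in> R_q q. \<forall>\<^sub>F n in sequentially. poly p (qint q n) \<in> \<int>}"

definition shift_q :: "nat \<Rightarrow> rat poly \<Rightarrow> rat poly" where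
  "shift_q q p = p \<circ>\<^sub>p [:1, of_nat q:]"

definition omega0 :: "nat \<Rightarrow> nat \<Rightarrow> rat poly" where
  "omega0 q d =
     smult (1 / (of_nat q ^ (d choose 2) * qfact q d)) (\<Prod>i<d. [:- qint q i, 1:])"

text \<open>For \<open>q > 0\<close> the shift is bijective already on \<open>\<rat>[x]\<close>, so its inverse there restricts to the
  inverse on \<open>R_q\<close>.\<close>

definition omega :: "nat \<Rightarrow> nat \<Rightarrow> nat \<Rightarrow> rat poly" where
  "omega q m d = (inv_into UNIV (shift_q q) ^^ m) (omega0 q d)"

end

theory Submission
  imports Defs
begin

text \<open>Write \<open>G\<close> for the infinite general linear group and \<open>U\<^sub>n\<close> for the pointwise stabilizer of
\<open>V\<^sub>n\<close>.  The isomorphism comes from counting fixed points.  For a finitary set \<open>X\<close> the number of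
\<open>U\<^sub>n\<close>-fixed points of \<open>X\<close> makes sense for all large \<open>n\<close>, and the germ at infinity of this
sequence respects every relation that defines \<open>\<Theta>(G)\<close>.  So counting is a ring homomorphism from
\<open>\<Theta>(G)\<close> to germs of integer sequences.  It sends the class of \<open>\<Omega>\<^sub>m\<^sub>,\<^sub>d\<close> to the number of
subspaces between \<open>V\<^sub>m\<close> and \<open>V\<^sub>n\<close> of dimension \<open>m + d\<close>, which is the value of
\<open>\<omega>\<^sub>m\<^sub>,\<^sub>d\<close> at \<open>[n]\<^sub>q\<close>.  Polynomials embed in the same ring of germs by evaluation at the
\<open>q\<close>-integers.  Both maps are injective with the same image, and the isomorphism matches a
polynomial \<open>p\<close> with the elements of \<open>\<Theta>(G)\<close> whose fixed points are counted by \<open>p\<close>; at the level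
of the free ring these elements form a coset of the ideal of relations
(\<open>germ_class\<close>, \<open>germ_class_coset\<close>).

That the images agree and that counting is injective rests on two spanning statements.

First, the \<open>\<omega>\<^sub>m\<^sub>,\<^sub>d\<close> span the polynomial ring over the integers (\<open>R_q_large_spanned\<close>).  A
polynomial that is integral at all \<open>[n]\<^sub>q\<close> with \<open>n \<ge> m\<close> is interpolated at
\<open>[m]\<^sub>q, [m+1]\<^sub>q, \<dots>\<close> by the \<open>\<omega>\<^sub>m\<^sub>,\<^sub>d\<close> with this fixed \<open>m\<close>, and the system is unitriangular.
The same triangularity shows that they are linearly independent.

Secondly, for all large \<open>m\<close> an element of \<open>\<Theta>(G)\<close> is an integer combination of the classes of the
\<open>\<Omega>\<^sub>m\<^sub>,\<^sub>d\<close> with this same \<open>m\<close> (\<open>eventually_spanned\<close>).  The reason is that an open subgroup \<open>A\<close> has a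
least support: a smallest finite subspace \<open>W\<close> whose pointwise stabilizer lies in \<open>A\<close>
(\<open>least_support_exists\<close>).  Hence \<open>A\<close> lies between the pointwise and the setwise stabilizer of \<open>W\<close>,
a transitive \<open>U\<^sub>m\<close>-set with stabilizer \<open>A\<close> maps to some \<open>\<Omega>\<^sub>m\<^sub>,\<^sub>d\<close> with finite fibers, and
the fiber relation turns its class into an integer multiple of the class of \<open>\<Omega>\<^sub>m\<^sub>,\<^sub>d\<close>.  A product of
two such classes is the class of a product set, which decomposes into finitely many orbits.

Given a combination of the \<open>\<Omega>\<^sub>m\<^sub>,\<^sub>d\<close> for one \<open>m\<close> that counts to zero, linear independence of the
\<open>\<omega>\<^sub>m\<^sub>,\<^sub>d\<close> kills all coefficients; so the ideal of relations is exactly the set of elements with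
eventually vanishing count (\<open>fixval_theta_ideal\<close> and \<open>theta_ideal_eq\<close>).

Least supports are also what makes counting multiplicative along a map of transitive sets: the
elements of the acting group that lie in \<open>GL\<^sub>n\<close> normalize \<open>U\<^sub>n\<close> and act transitively on its fixed
points (\<open>fixedpts_transitive\<close>), so all fibers over fixed points contain equally many of them.

All group elements that these arguments need are supplied by one extension lemma for partial
linear maps (\<open>GLn_extend\<close>).\<close>

section \<open>Finite subspaces\<close>

type_synonym 'f vmap = "'f fsv \<Rightarrow> 'f fsv"

interpretation V: vector_space "fscale :: 'f::field \<Rightarrow> 'f vmap"
  by (rule vector_space_fscale)

interpretation VV: vector_space_pair "fscale :: 'f::field \<Rightarrow> 'f vmap" "fscale :: 'f \<Rightarrow> 'f vmap"
  by unfold_locales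

abbreviation linmap :: "('f::field vmap) \<Rightarrow> bool" where
  "linmap \<equiv> Vector_Spaces.linear fscale fscale"

lemma linmap_iff:
  "linmap f \<longleftrightarrow> (\<forall>x y. f (x + y) = f x + f y) \<and> (\<forall>c x. f (fscale c x) = fscale c (f x))"
  by (simp add: Vector_Spaces.linear_iff vector_space_fscale)

text \<open>The field is finite, so finite-dimensional subspaces are the same as finite subspaces, and their
dimension can be read off from their cardinality.\<close>

lemma card_span_insert:
  fixes v :: "('f::{field,finite}) fsv"
  assumes "v \<notin> V.span S" "finite (V.span S)"
  shows "finite (V.span (insert v S))"
    and "card (V.span (insert v S)) = card (UNIV :: 'f set) * card (V.span S)"
proof -
  let ?f = "\<lambda>(c, w). fscale c v + w"
  have inj: "inj_on ?f (UNIV \<times> V.span S)"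
  proof (rule inj_onI, clarify)
    fix c d :: 'f and w z
    assume wz: "w \<in> V.span S" "z \<in> V.span S" and eq: "fscale c v + w = fscale d v + z"
    have *: "fscale (c - d) v = z - w"
      using eq by (simp add: V.scale_left_diff_distrib algebra_simps)
    have "c = d"
    proof (rule ccontr)
      assume "c \<noteq> d"
      have "fscale (inverse (c - d)) (fscale (c - d) v) \<in> V.span S"
        unfolding * by (intro V.span_scale V.span_diff wz)
      with \<open>c \<noteq> d\<close> assms(1) show False by simp
    qed
    with eq show "c = d \<and> w = z" by simp
  qed
  have im: "?f ` (UNIV \<times> V.span S) = V.span (insert v S)"
  proof -
    have "x \<in> ?f ` (UNIV \<times> V.span S)" if "x - fscale k v \<in> V.span S" for x k
      by (rule image_eqI[where x = "(k, x - fscale k v)"]) (use that in auto)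
    moreover have "\<exists>k. ?f p - fscale k v \<in> V.span S" if "p \<in> UNIV \<times> V.span S" for p
      by (rule exI[of _ "fst p"]) (use that in \<open>auto simp: case_prod_unfold\<close>)
    ultimately show ?thesis unfolding V.span_insert by blast
  qed
  show "finite (V.span (insert v S))"
    unfolding im[symmetric] using assms(2) by (intro finite_imageI) auto
  show "card (V.span (insert v S)) = card (UNIV :: 'f set) * card (V.span S)"
    unfolding im[symmetric] by (simp add: card_image[OF inj] card_cartesian_product)
qed

lemma card_span_independent:
  fixes B :: "('f::{field,finite}) fsv set"
  assumes "finite B" "V.independent B"
  shows "finite (V.span B) \<and> card (V.span B) = card (UNIV :: 'f set) ^ card B"
  using assms
proof (induction B)
  case empty
  then show ?case by simp
next
  case (insert b B)
  then have "b \<notin> V.span B" "V.independent B" by (auto simp: V.independent_insert)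
  with insert card_span_insert[of b B] show ?case by simp
qed

lemma card_field_gt_1: "card (UNIV :: 'f::{field,finite} set) > 1"
proof -
  have "card {0, 1 :: 'f} \<le> card (UNIV :: 'f set)" by (intro card_mono) auto
  then show ?thesis by simp
qed

lemma finite_span:
  fixes B :: "('f::{field,finite}) fsv set"
  assumes "finite B" shows "finite (V.span B)"
proof -
  obtain C where "C \<subseteq> B" "V.independent C" "B \<subseteq> V.span C"
    using V.maximal_independent_subset by blast
  then have "V.span B = V.span C"
    by (meson V.span_mono V.span_span V.span_minimal V.subspace_span subset_antisym)
  then show ?thesis
    using \<open>C \<subseteq> B\<close> \<open>V.independent C\<close> assms card_span_independent finite_subset by metis
qed

lemma card_subspace:
  fixes W :: "('f::{field,finite}) fsv set"
  assumes "V.subspace W" "finite W"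
  shows "card W = card (UNIV :: 'f set) ^ V.dim W"
proof -
  obtain B where B: "B \<subseteq> W" "V.independent B" "W \<subseteq> V.span B" "card B = V.dim W"
    using V.basis_exists by blast
  then have "V.span B = W"
    using assms(1) V.span_minimal by blast
  with B assms(2) show ?thesis
    by (metis card_span_independent finite_subset)
qed

subsection \<open>The standard flag\<close>

abbreviation std :: "nat \<Rightarrow> 'f::field fsv" where "std i \<equiv> Poly_Mapping.single i 1"

lemma Vn_subspace [simp]: "V.subspace (Vn n)"
  unfolding V.subspace_def Vn_def
  by (auto simp: in_keys_iff lookup_add lookup_fscale subset_iff) (metis add_0)

lemma zero_in_Vn [simp]: "0 \<in> Vn n"
  by (simp add: Vn_def)

lemma Vn_mono: "m \<le> n \<Longrightarrow> Vn m \<subseteq> Vn n"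
  by (force simp: Vn_def)

lemma std_in_Vn_iff [simp]: "std i \<in> (Vn n :: 'f::field fsv set) \<longleftrightarrow> i < n"
  by (simp add: Vn_def)

lemma Vn_Suc: "Vn (Suc n) = {x. \<exists>k. x - fscale k (std n) \<in> Vn n}"
proof (intro equalityI subsetI)
  fix x :: "'a fsv" assume x: "x \<in> Vn (Suc n)"
  have "x - fscale (Poly_Mapping.lookup x n) (std n) \<in> Vn n"
    using x by (auto simp: Vn_def in_keys_iff lookup_minus lookup_fscale lookup_single subset_iff when_def
        less_Suc_eq split: if_splits)
  then show "x \<in> {x. \<exists>k. x - fscale k (std n) \<in> Vn n}" by blast
next
  fix x :: "'a fsv" assume "x \<in> {x. \<exists>k. x - fscale k (std n) \<in> Vn n}"
  then obtain k where k: "x - fscale k (std n) \<in> Vn n" by blast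
  have "fscale k (std n) \<in> Vn (Suc n)" by (intro V.subspace_scale) auto
  then have "x - fscale k (std n) + fscale k (std n) \<in> Vn (Suc n)"
    using k Vn_mono[of n "Suc n"] by (intro V.subspace_add) auto
  then show "x \<in> Vn (Suc n)" by simp
qed

lemma Vn_eq_span: "Vn n = V.span (std ` {..<n})"
proof (induction n)
  case 0
  then show ?case by (auto simp: Vn_def)
next
  case (Suc n)
  show ?case
    by (simp add: lessThan_Suc V.span_insert Vn_Suc Suc.IH)
qed

lemma finite_Vn [simp]: "finite (Vn n :: 'f::{field,finite} fsv set)"
  unfolding Vn_eq_span by (rule finite_span) simp

lemma card_Vn: "card (Vn n :: 'f::{field,finite} fsv set) = card (UNIV :: 'f set) ^ n"
proof (induction n)
  case 0
  then show ?case by (simp add: Vn_def)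
next
  case (Suc n)
  have "card (V.span (insert (std n) (std ` {..<n})) :: 'f fsv set)
        = card (UNIV :: 'f set) * card (V.span (std ` {..<n}) :: 'f fsv set)"
    by (rule card_span_insert) (simp_all flip: Vn_eq_span)
  with Suc show ?case by (simp add: Vn_eq_span lessThan_Suc)
qed

lemma finite_subset_Vn:
  assumes "finite S" shows "\<forall>\<^sub>F n in sequentially. S \<subseteq> Vn n"
proof -
  have "\<exists>N. v \<in> Vn N" for v :: "'a fsv"
    using finite_nat_bounded[of "Poly_Mapping.keys v"] by (auto simp: Vn_def lessThan_def)
  then have "\<forall>v\<in>S. \<forall>\<^sub>F n in sequentially. v \<in> Vn n"
    by (meson Vn_mono eventually_sequentially subsetD)
  then have "\<forall>\<^sub>F n in sequentially. \<forall>v\<in>S. v \<in> Vn n"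
    using assms by (intro eventually_ball_finite)
  then show ?thesis by (simp add: subset_iff Ball_def)
qed

text \<open>The projection of \<open>V\<close> onto \<open>V\<^sub>n\<close> along the span of the later basis vectors.\<close>

definition trunc :: "nat \<Rightarrow> 'f::field vmap" where
  "trunc n v = (\<Sum>i<n. fscale (Poly_Mapping.lookup v i) (std i))"

lemma lookup_trunc: "Poly_Mapping.lookup (trunc n v) i = (if i < n then Poly_Mapping.lookup v i else 0)"
  by (auto simp: trunc_def lookup_sum lookup_fscale lookup_single when_def if_distrib cong: if_cong)

lemma linear_trunc: "linmap (trunc n)"
  unfolding linmap_iff by (auto intro!: poly_mapping_eqI simp: lookup_trunc lookup_add lookup_fscale)

lemma trunc_in_Vn [simp]: "trunc n v \<in> Vn n"
  by (auto simp: Vn_def in_keys_iff lookup_trunc split: if_splits)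

lemma trunc_Vn: "v \<in> Vn n \<Longrightarrow> trunc n v = v"
  by (intro poly_mapping_eqI) (force simp: lookup_trunc Vn_def in_keys_iff subset_iff)

lemma trunc_std: "i \<ge> n \<Longrightarrow> trunc n (std i) = 0"
  by (intro poly_mapping_eqI) (auto simp: lookup_trunc lookup_single when_def)

subsection \<open>Extending partial isomorphisms\<close>

text \<open>Apply \<open>f\<close> to the projection of a vector to \<open>V\<^sub>n\<close> and keep the rest of the vector.\<close>

lemma GLn_of_Vn_iso:
  fixes f :: "'f::{field,finite} vmap"
  assumes f: "linmap f" "f ` Vn n = Vn n"
  shows "\<exists>g \<in> GLn n. \<forall>v \<in> Vn n. g v = f v"
proof -
  define g where "g = (\<lambda>v. f (trunc n v) + (v - trunc n v))"
  have inj: "inj_on f (Vn n)"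
    using f(2) by (intro eq_card_imp_inj_on) auto
  have lin: "linmap g"
    unfolding linmap_iff g_def
    by (simp add: VV.linear_add[OF f(1)] VV.linear_add[OF linear_trunc] VV.linear_scale[OF f(1)]
        VV.linear_scale[OF linear_trunc] V.scale_right_diff_distrib V.scale_right_distrib)
  have g: "g v = f v" if "v \<in> Vn n" for v using trunc_Vn[OF that] by (simp add: g_def)
  have tail: "g v - trunc n (g v) = v - trunc n v" for v
  proof -
    have "trunc n (v - trunc n v) = 0"
      by (simp add: VV.linear_diff[OF linear_trunc] trunc_Vn)
    moreover have "trunc n (f (trunc n v)) = f (trunc n v)"
      using f(2) by (intro trunc_Vn) auto
    ultimately show ?thesis by (simp add: g_def VV.linear_add[OF linear_trunc])
  qed
  have head: "trunc n (g v) = f (trunc n v)" for v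
    using tail[of v] by (simp add: g_def algebra_simps)
  have "inj g"
  proof (rule injI)
    fix x y assume eq: "g x = g y"
    then have "trunc n x = trunc n y" using head[of x] head[of y] inj by (auto dest!: inj_onD)
    moreover have "x - trunc n x = y - trunc n y" using eq tail by metis
    ultimately show "x = y" by simp
  qed
  moreover have "surj g"
  proof (unfold surj_def, intro allI)
    fix y
    obtain x where x: "x \<in> Vn n" "f x = trunc n y" using f(2) trunc_in_Vn by (metis imageE)
    have "trunc n (x + (y - trunc n y)) = x"
      by (simp add: VV.linear_diff[OF linear_trunc] VV.linear_add[OF linear_trunc] trunc_Vn x)
    then have "y = g (x + (y - trunc n y))" by (simp add: g_def x)
    then show "\<exists>x. y = g x" by blast
  qed
  moreover have "g ` Vn n = Vn n" using f(2) g by (metis image_cong)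
  moreover have "g (std i) = std i" if "i \<ge> n" for i
    using that by (simp add: g_def trunc_std VV.linear_0[OF f(1)])
  ultimately have "g \<in> GLn n" using lin by (simp add: GLn_def bij_def)
  with g show ?thesis by blast
qed

text \<open>The hypothesis on \<open>e\<close> says exactly that the identity of \<open>W\<close> and the map \<open>f\<close> on \<open>E\<close> glue to an
injective linear map on \<open>W + E\<close>.  The glued map extends to an automorphism of \<open>V\<^sub>n\<close>, because two
independent sets of the same size complete to bases of \<open>V\<^sub>n\<close> by equally many vectors.  With
\<open>W = V\<^sub>m\<close> this moves subspaces by elements of \<open>U\<^sub>m\<close>; with \<open>W = 0\<close> it replaces a group element by an
element of \<open>GL\<^sub>n\<close> without changing it on \<open>E\<close>.\<close>

lemma GLn_extend:
  fixes f :: "'f::{field,finite} vmap"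
  assumes f: "linmap f" "inj_on f E" and sub: "V.subspace W" "V.subspace E"
    and Vn: "W \<subseteq> Vn n" "E \<subseteq> Vn n" "f ` E \<subseteq> Vn n"
    and agree: "\<And>e. e \<in> E \<Longrightarrow> e \<in> W \<or> f e \<in> W \<Longrightarrow> f e = e"
  obtains g where "g \<in> GLn n" "\<forall>w \<in> W. g w = w" "\<forall>e \<in> E. g e = f e"
proof -
  obtain B2 where B2: "B2 \<subseteq> W" "V.independent B2" "W \<subseteq> V.span B2"
    using V.maximal_independent_subset by blast
  obtain B where B: "B2 \<subseteq> B" "B \<subseteq> B2 \<union> E" "V.independent B" "B2 \<union> E \<subseteq> V.span B"
    using V.maximal_independent_subset_extend[of B2 "B2 \<union> E"] B2 by blast
  have spB2: "V.span B2 = W" using B2 sub V.span_minimal by blast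
  define h0 where "h0 = (\<lambda>b. if b \<in> B2 then b else f b)"
  obtain h where h: "linmap h" "\<forall>b \<in> B. h b = h0 b"
    using VV.linear_independent_extend[OF B(3)] by blast
  have hW: "h w = w" if "w \<in> W" for w
  proof (rule VV.linear_eq_on[OF h(1) V.linear_id, of w B2, unfolded id_apply])
    show "w \<in> V.span B2" using that spB2 by simp
  qed (use h B in \<open>auto simp: h0_def\<close>)
  have hE1: "h e = f e" if "e \<in> V.span (B - B2)" for e
    by (rule VV.linear_eq_on[OF h(1) f(1) that]) (use h B in \<open>auto simp: h0_def\<close>)
  have spE1: "V.span (B - B2) \<subseteq> E" using B(2) sub by (intro V.span_minimal) auto
  have spB: "\<exists>w e. x = w + e \<and> w \<in> W \<and> e \<in> V.span (B - B2)" if "x \<in> V.span B" for x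
  proof -
    have "B = B2 \<union> (B - B2)" using B by blast
    then have "x \<in> V.span (B2 \<union> (B - B2))" using that by simp
    then show ?thesis unfolding V.span_Un spB2 by auto
  qed
  \<comment> \<open>Write \<open>e = w + e1\<close>.  The part \<open>w = e - e1\<close> lies in both \<open>W\<close> and \<open>E\<close>, where \<open>f\<close> is the identity.\<close>
  have hE: "h e = f e" if e: "e \<in> E" for e
  proof -
    obtain w e1 where we: "e = w + e1" "w \<in> W" "e1 \<in> V.span (B - B2)"
      using spB[of e] B(4) e by blast
    then have "w = e - e1" by simp
    then have "w \<in> E" using we spE1 e sub(2) V.subspace_diff by blast
    then have "f w = w" using agree we by blast
    then show ?thesis
      using we hW hE1 by (simp add: VV.linear_add[OF h(1)] VV.linear_add[OF f(1)])
  qed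
  have inj: "inj_on h (V.span B)"
    unfolding VV.linear_inj_on_iff_eq_0[OF h(1) V.subspace_span]
  proof (intro ballI impI)
    fix x assume x: "x \<in> V.span B" "h x = 0"
    obtain w e where we: "x = w + e" "w \<in> W" "e \<in> V.span (B - B2)" using spB[OF x(1)] by blast
    then have e: "e \<in> E" using spE1 by blast
    have "w + f e = 0" using x(2) we e hW hE by (simp add: VV.linear_add[OF h(1)])
    then have fe: "f e = - w" by (simp add: eq_neg_iff_add_eq_0 add.commute)
    then have "f e \<in> W" using we(2) sub(1) by (simp add: V.subspace_neg)
    then have "f e = e" using agree e by blast
    with fe we(1) show "x = 0" by simp
  qed
  have B_Vn: "B \<subseteq> Vn n" "h ` B \<subseteq> Vn n"
  proof -
    show "B \<subseteq> Vn n" using B(2) B2(1) Vn by blast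
    have "h b \<in> Vn n" if "b \<in> B" for b
    proof (cases "b \<in> B2")
      case True
      then have "b \<in> W" using B2(1) by blast
      then show ?thesis using hW[of b] Vn(1) by auto
    next
      case False
      then have "b \<in> E" using B(2) that by blast
      then show ?thesis using hE[of b] Vn(3) by auto
    qed
    then show "h ` B \<subseteq> Vn n" by blast
  qed
  have indB': "V.independent (h ` B)"
    using VV.linear_independent_injective_image[OF h(1) B(3) inj] .
  obtain C1 where C1: "B \<subseteq> C1" "C1 \<subseteq> Vn n" "V.independent C1" "Vn n \<subseteq> V.span C1"
    using V.maximal_independent_subset_extend[OF B_Vn(1) B(3)] by blast
  obtain C2 where C2: "h ` B \<subseteq> C2" "C2 \<subseteq> Vn n" "V.independent C2" "Vn n \<subseteq> V.span C2"
    using V.maximal_independent_subset_extend[OF B_Vn(2) indB'] by blast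
  have sp: "V.span C1 = Vn n" "V.span C2 = Vn n" using C1 C2 V.span_minimal Vn_subspace by blast+
  have fin: "finite C1" "finite C2" using C1(2) C2(2) finite_Vn finite_subset by blast+
  \<comment> \<open>Both bases of \<open>V\<^sub>n\<close> have the same size, since the cardinality of \<open>V\<^sub>n\<close> determines it.\<close>
  have "card (UNIV :: 'f set) ^ card C1 = card (UNIV :: 'f set) ^ card C2"
    using card_span_independent[OF fin(1) C1(3)] card_span_independent[OF fin(2) C2(3)] sp by simp
  then have "card C1 = card C2" using card_field_gt_1[where 'f = 'f] by simp
  moreover have "card (h ` B) = card B"
    using inj V.span_superset by (intro card_image) (rule inj_on_subset)
  ultimately have "card (C1 - B) = card (C2 - h ` B)"
    using C1(1) C2(1) fin by (simp add: card_Diff_subset finite_subset)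
  then obtain k where k: "bij_betw k (C1 - B) (C2 - h ` B)"
    using finite_same_card_bij fin by blast
  obtain F where F: "linmap F" "\<forall>c \<in> C1. F c = (if c \<in> B then h c else k c)"
    using VV.linear_independent_extend[OF C1(3), of "\<lambda>c. if c \<in> B then h c else k c"] by blast
  have "F ` C1 = F ` B \<union> F ` (C1 - B)" using C1(1) by blast
  also have "F ` B = h ` B" using F(2) C1(1) by (intro image_cong) auto
  also have "F ` (C1 - B) = k ` (C1 - B)" using F(2) by (intro image_cong) auto
  also have "k ` (C1 - B) = C2 - h ` B" using k by (simp add: bij_betw_def)
  finally have "F ` C1 = C2" using C2(1) by blast
  then have "F ` Vn n = Vn n" using sp VV.linear_span_image[OF F(1), of C1] by simp
  then obtain g where g: "g \<in> GLn n" "\<forall>v \<in> Vn n. g v = F v" using GLn_of_Vn_iso[OF F(1)] by blast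
  have "F x = h x" if "x \<in> V.span B" for x
    by (rule VV.linear_eq_on[OF F(1) h(1) that]) (use F C1 in auto)
  moreover have "W \<subseteq> V.span B" using B(1) spB2 V.span_mono by blast
  moreover have "E \<subseteq> V.span B" using B(4) by blast
  ultimately have "\<forall>w \<in> W. g w = w" "\<forall>e \<in> E. g e = f e"
    using g(2) Vn hW hE by (metis subsetD)+
  with g(1) show thesis using that by blast
qed

section \<open>The infinite general linear group and its open subgroups\<close>

lemma GL_inf_simps [simp]:
  "monoid.mult GL_inf = (\<circ>)" "one GL_inf = id"
  by (simp_all add: GL_inf_def)

lemma GLn_linear: "g \<in> GLn n \<Longrightarrow> linmap g" and GLn_bij: "g \<in> GLn n \<Longrightarrow> bij g"
  by (simp_all add: GLn_def)

lemma GLn_mono: "m \<le> n \<Longrightarrow> GLn m \<subseteq> (GLn n :: ('f::field vmap) set)"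
proof
  fix g :: "'f vmap" assume "m \<le> n" and g: "g \<in> GLn m"
  then have n: "{..<n} = {..<m} \<union> {m..<n}" by auto
  have Vn: "Vn n = V.span (Vn m \<union> std ` {m..<n} :: 'f fsv set)"
    by (simp add: n Vn_eq_span[of n] Vn_eq_span[of m] image_Un V.span_Un V.span_span)
  have "g ` (std ` {m..<n}) = std ` {m..<n}"
    using g unfolding image_image by (intro image_cong) (auto simp: GLn_def)
  then have "g ` Vn n = Vn n"
    unfolding Vn VV.linear_span_image[OF GLn_linear[OF g], symmetric] image_Un
    using g by (simp add: GLn_def)
  then show "g \<in> GLn n" using g \<open>m \<le> n\<close> by (simp add: GLn_def)
qed

lemma GL_inf_carrier: "g \<in> carrier GL_inf \<longleftrightarrow> (\<forall>\<^sub>F n in sequentially. g \<in> GLn n)"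
proof
  assume "g \<in> carrier GL_inf"
  then show "\<forall>\<^sub>F n in sequentially. g \<in> GLn n"
    unfolding GL_inf_def eventually_sequentially using GLn_mono by auto
next
  assume "\<forall>\<^sub>F n in sequentially. g \<in> GLn n"
  then have "\<forall>\<^sub>F n in sequentially. g \<in> GLn n \<and> n \<ge> 1"
    using eventually_ge_at_top by (rule eventually_conj)
  then show "g \<in> carrier GL_inf"
    by (auto simp: GL_inf_def dest!: eventually_happens)
qed

lemma GLn_carrier: "g \<in> GLn n \<Longrightarrow> g \<in> carrier GL_inf"
  unfolding GL_inf_carrier eventually_sequentially using GLn_mono by blast

lemma GLn_id: "id \<in> GLn n"
  by (simp add: GLn_def linmap_iff)

lemma GLn_comp: "g \<in> GLn n \<Longrightarrow> h \<in> GLn n \<Longrightarrow> g \<circ> h \<in> GLn n"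
  using image_comp[of g h "Vn n"] by (simp add: GLn_def linmap_iff bij_comp del: image_comp)

lemma GLn_inv: "g \<in> GLn n \<Longrightarrow> inv_into UNIV g \<in> GLn n"
proof -
  assume g: "g \<in> GLn n"
  then have b: "bij g" by (rule GLn_bij)
  have gi: "g (inv_into UNIV g x) = x" for x using b by (simp add: bij_is_surj surj_f_inv_f)
  have ig: "inv_into UNIV g (g x) = x" for x using b by (simp add: bij_is_inj)
  have "linmap (inv_into UNIV g)"
    unfolding linmap_iff
    by (metis gi ig VV.linear_add[OF GLn_linear[OF g]] VV.linear_scale[OF GLn_linear[OF g]])
  moreover have "inv_into UNIV g ` Vn n = Vn n"
  proof -
    have "inv_into UNIV g ` (g ` Vn n) = Vn n" by (simp add: image_image ig)
    then show ?thesis using g by (simp add: GLn_def)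
  qed
  moreover have "inv_into UNIV g (std i) = std i" if "i \<ge> n" for i
    using g that ig[of "std i"] by (simp add: GLn_def)
  ultimately show ?thesis using b by (simp add: GLn_def bij_imp_bij_inv)
qed

lemma group_GL_inf: "group (GL_inf :: ('f::field vmap) monoid)"
proof (rule groupI, simp_all)
  fix x y :: "'f vmap"
  assume xy: "x \<in> carrier GL_inf" "y \<in> carrier GL_inf"
  show "x \<circ> y \<in> carrier GL_inf"
    using xy unfolding GL_inf_carrier by eventually_elim (rule GLn_comp)
next
  show "id \<in> carrier GL_inf" by (rule GLn_carrier[OF GLn_id])
next
  fix x :: "'f vmap" assume "x \<in> carrier GL_inf"
  then obtain n where n: "x \<in> GLn n" by (auto simp: GL_inf_def)
  show "\<exists>y\<in>carrier GL_inf. y \<circ> x = id"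
    by (rule bexI[OF _ GLn_carrier[OF GLn_inv[OF n]]]) (use GLn_bij[OF n] in \<open>simp add: bij_is_inj\<close>)
qed (simp_all add: comp_assoc)

interpretation GL: group "GL_inf :: ('f::field vmap) monoid"
  by (rule group_GL_inf)

abbreviation ginv :: "'f::field vmap \<Rightarrow> 'f vmap" where
  "ginv \<equiv> m_inv GL_inf"

lemma GL_linear: "g \<in> carrier GL_inf \<Longrightarrow> linmap g" and GL_bij: "g \<in> carrier GL_inf \<Longrightarrow> bij g"
  by (auto simp: GL_inf_def GLn_def)

lemma GL_inv_apply [simp]:
  assumes "g \<in> carrier GL_inf"
  shows "g (ginv g x) = x" "ginv g (g x) = x"
  using GL.r_inv[OF assms] GL.l_inv[OF assms] by (simp_all add: pointfree_idE)

lemma finite_GLn: "finite (GLn n :: ('f::{field,finite} vmap) set)"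
proof (rule finite_imageD)
  have "(\<lambda>g. restrict g (Vn n)) ` GLn n \<subseteq> Vn n \<rightarrow>\<^sub>E (Vn n :: 'f fsv set)"
    by (auto simp: GLn_def)
  then show "finite ((\<lambda>g. restrict g (Vn n)) ` (GLn n :: ('f vmap) set))"
    by (rule finite_subset) (simp add: finite_PiE)
next
  show "inj_on (\<lambda>g. restrict g (Vn n)) (GLn n :: ('f vmap) set)"
  proof (rule inj_onI, rule ext)
    fix g h :: "'f vmap" and v :: "'f fsv"
    assume gh: "g \<in> GLn n" "h \<in> GLn n" and eq: "restrict g (Vn n) = restrict h (Vn n)"
    obtain N where "{v} \<subseteq> Vn N"
      using finite_subset_Vn[of "{v}"] by (auto dest: eventually_happens)
    then have v: "v \<in> V.span (std ` {..<N})" by (simp add: Vn_eq_span)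
    have "g (std i) = h (std i)" for i
    proof (cases "i < n")
      case True then show ?thesis using fun_cong[OF eq, of "std i"] by simp
    next
      case False then show ?thesis using gh by (simp add: GLn_def)
    qed
    then show "g v = h v"
      using VV.linear_eq_on[OF GLn_linear[OF gh(1)] GLn_linear[OF gh(2)] v] by blast
  qed
qed

abbreviation Ufix :: "nat \<Rightarrow> ('f::field vmap) set" where
  "Ufix n \<equiv> pointwise_stab (Vn n)"

lemma pointwise_stab_iff:
  "g \<in> pointwise_stab S \<longleftrightarrow> g \<in> carrier GL_inf \<and> (\<forall>v \<in> S. g v = v)"
  by (simp add: pointwise_stab_def)

lemma pointwise_stab_mono: "S \<subseteq> S' \<Longrightarrow> pointwise_stab S' \<subseteq> pointwise_stab S"
  by (auto simp: pointwise_stab_def)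

lemma pointwise_stab_subgroup: "subgroup (pointwise_stab S) GL_inf"
proof (rule GL.subgroupI)
  show "pointwise_stab S \<noteq> {}" using GL.one_closed by (auto simp: pointwise_stab_def)
  fix a assume "a \<in> pointwise_stab S"
  then show "ginv a \<in> pointwise_stab S"
    by (auto simp: pointwise_stab_def) (metis GL_inv_apply(2))
qed (use GL.m_closed in \<open>auto simp: pointwise_stab_def\<close>)

lemma pointwise_stab_conj:
  assumes "g \<in> carrier GL_inf" "u \<in> pointwise_stab S"
  shows "g \<circ> u \<circ> ginv g \<in> pointwise_stab (g ` S)"
proof -
  have "g \<circ> u \<circ> ginv g \<in> carrier GL_inf"
    using assms GL.m_closed[of "g \<circ> u" "ginv g"] GL.m_closed[of g u] GL.inv_closed[of g]
    by (simp add: pointwise_stab_iff)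
  then show ?thesis using assms by (simp add: pointwise_stab_iff)
qed

text \<open>Every finite set of vectors lies in some \<open>V\<^sub>n\<close>, so the cosets of the \<open>U\<^sub>n\<close> alone form a basis of
the topology.\<close>

lemma GL_inf_top_openin:
  fixes U :: "('f::{field,finite} vmap) set"
  shows "openin GL_inf_top U \<longleftrightarrow>
    U \<subseteq> carrier GL_inf \<and> (\<forall>x \<in> U. \<exists>n. \<forall>u \<in> Ufix n. x \<circ> u \<in> U)"
    (is "_ \<longleftrightarrow> ?P U")
proof
  assume "openin GL_inf_top U"
  then have "generate_topology_on {g <#\<^bsub>GL_inf\<^esub> pointwise_stab S | g S. g \<in> carrier GL_inf \<and> finite S} U"
    by (simp add: GL_inf_top_def openin_topology_generated_by_iff)
  then show "?P U"
  proof (induction rule: generate_topology_on.induct)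
    case (Int a b)
    show ?case
    proof (intro conjI ballI)
      fix x assume "x \<in> a \<inter> b"
      then obtain m n where "\<forall>u \<in> Ufix m. x \<circ> u \<in> a" "\<forall>u \<in> Ufix n. x \<circ> u \<in> b"
        using Int.IH by blast
      then have "\<forall>u \<in> Ufix (max m n). x \<circ> u \<in> a \<inter> b"
        using pointwise_stab_mono[OF Vn_mono[of m "max m n"]] pointwise_stab_mono[OF Vn_mono[of n "max m n"]]
        by auto
      then show "\<exists>n. \<forall>u\<in>Ufix n. x \<circ> u \<in> a \<inter> b" by blast
    qed (use Int.IH in blast)
  next
    case (UN K)
    then show ?case by (meson Union_iff Union_least)
  next
    case (Basis s)
    then obtain g S where s: "s = g <#\<^bsub>GL_inf\<^esub> pointwise_stab S" "g \<in> carrier GL_inf" "finite S" by blast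
    obtain n where n: "S \<subseteq> Vn n" using finite_subset_Vn[OF s(3)] by (auto dest: eventually_happens)
    show ?case
    proof (intro conjI ballI)
      show "s \<subseteq> carrier GL_inf"
        using s GL.l_coset_subset_G subgroup.subset[OF pointwise_stab_subgroup] by metis
      fix x assume "x \<in> s"
      then obtain h where h: "h \<in> pointwise_stab S" "x = g \<circ> h" by (auto simp: s l_coset_def)
      show "\<exists>n. \<forall>u\<in>Ufix n. x \<circ> u \<in> s"
      proof (intro exI ballI)
        fix u :: "'f vmap" assume "u \<in> Ufix n"
        then have "h \<circ> u \<in> pointwise_stab S"
          using subgroup.m_closed[OF pointwise_stab_subgroup h(1), of u] pointwise_stab_mono[OF n] by auto
        then show "x \<circ> u \<in> s" by (auto simp: s h l_coset_def comp_assoc)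
      qed
    qed
  qed simp
next
  assume P: "?P U"
  show "openin GL_inf_top U"
  proof (subst openin_subopen, intro ballI)
    fix x assume x: "x \<in> U"
    then obtain n where n: "\<forall>u \<in> Ufix n. x \<circ> u \<in> U" using P by blast
    have "openin GL_inf_top (x <#\<^bsub>GL_inf\<^esub> Ufix n)"
      unfolding GL_inf_top_def
    proof (rule topology_generated_by_Basis, intro CollectI exI conjI)
      show "x \<in> carrier GL_inf" using P x by blast
    qed (rule refl, rule finite_Vn)
    moreover have "x \<in> x <#\<^bsub>GL_inf\<^esub> Ufix n"
      using subgroup.one_closed[OF pointwise_stab_subgroup] by (auto simp: l_coset_def intro!: bexI[of _ id])
    ultimately show "\<exists>T. openin GL_inf_top T \<and> x \<in> T \<and> T \<subseteq> U"
      using n by (intro exI[of _ "x <#\<^bsub>GL_inf\<^esub> Ufix n"]) (auto simp: l_coset_def)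
  qed
qed

lemma open_subgroup_iff:
  fixes U :: "('f::{field,finite} vmap) set"
  shows "open_subgroup GL_inf GL_inf_top U \<longleftrightarrow> subgroup U GL_inf \<and> (\<exists>n. Ufix n \<subseteq> U)"
proof (cases "subgroup U GL_inf")
  case True
  have "id \<in> U" using subgroup.one_closed[OF True] by simp
  then have "(\<forall>x \<in> U. \<exists>n. \<forall>u \<in> Ufix n. x \<circ> u \<in> U) \<longleftrightarrow> (\<exists>n. Ufix n \<subseteq> U)"
    using subgroup.m_closed[OF True] by fastforce
  then show ?thesis
    using True subgroup.subset[OF True] by (simp add: open_subgroup_def GL_inf_top_openin)
qed (simp add: open_subgroup_def)

subsection \<open>The least support of an open subgroup\<close>

abbreviation finsub :: "'f::{field,finite} fsv set \<Rightarrow> bool" where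
  "finsub W \<equiv> V.subspace W \<and> finite W"

text \<open>An element that fixes \<open>W\<close> can move any finite set as far away from any other as \<open>W\<close> permits.  Take
\<open>V\<^sub>n\<close> that contains everything, split it as \<open>W\<close> plus a complement by a projection \<open>\<pi>\<close> onto \<open>W\<close>,
fix \<open>W\<close> and shift the complement beyond the first \<open>n\<close> coordinates.\<close>

lemma generic_translate:
  fixes W D :: "'f::{field,finite} fsv set"
  assumes "finsub W" "finite D" "finite Z"
  shows "\<exists>k \<in> pointwise_stab W. k ` D \<inter> Z \<subseteq> W"
proof -
  have "\<forall>\<^sub>F n in sequentially. W \<union> D \<union> Z \<subseteq> Vn n"
    using assms by (intro finite_subset_Vn) auto
  then obtain n where n: "W \<subseteq> Vn n" "D \<subseteq> Vn n" "Z \<subseteq> Vn n"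
    by (auto dest: eventually_happens)
  obtain \<pi> :: "'f vmap" where \<pi>: "range \<pi> \<subseteq> W" "linmap \<pi>" "\<forall>w \<in> W. \<pi> w = w"
    using VV.linear_exists_left_inverse_on[OF V.linear_id, of W] assms by auto
  define s :: "'f vmap" where
    "s v = (\<Sum>i<n. fscale (Poly_Mapping.lookup v i) (std (n + i)))" for v
  have lookup_s: "Poly_Mapping.lookup (s v) j = (if n \<le> j \<and> j < n + n then Poly_Mapping.lookup v (j - n) else 0)" for v j
  proof -
    have "Poly_Mapping.lookup (s v) j = (\<Sum>i<n. if i = j - n \<and> n \<le> j then Poly_Mapping.lookup v i else 0)"
      unfolding s_def lookup_sum by (intro sum.cong) (auto simp: lookup_fscale lookup_single when_def)
    also have "\<dots> = (\<Sum>i<n. if i = j - n then (if n \<le> j then Poly_Mapping.lookup v i else 0) else 0)"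
      by (intro sum.cong) auto
    finally show ?thesis by auto
  qed
  have lin_s: "linmap s"
    unfolding linmap_iff by (auto intro!: poly_mapping_eqI simp: lookup_s lookup_add lookup_fscale)
  have s0: "v = 0" if "v \<in> Vn n" "s v \<in> Vn n" for v
  proof (rule poly_mapping_eqI)
    fix i
    show "Poly_Mapping.lookup v i = Poly_Mapping.lookup 0 i"
    proof (cases "i < n")
      case True
      have "Poly_Mapping.lookup (s v) (n + i) = 0"
        using that(2) by (force simp: Vn_def in_keys_iff)
      then show ?thesis using True by (simp add: lookup_s)
    next
      case False
      then show ?thesis using that(1) by (force simp: Vn_def in_keys_iff)
    qed
  qed
  define f where "f v = \<pi> v + s (v - \<pi> v)" for v
  have lin_f: "linmap f"
    unfolding linmap_iff f_def
    by (simp add: VV.linear_add[OF \<pi>(2)] VV.linear_add[OF lin_s] VV.linear_scale[OF \<pi>(2)]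
        VV.linear_diff[OF lin_s] VV.linear_scale[OF lin_s] V.scale_right_diff_distrib V.scale_right_distrib)
  have \<pi>_Vn: "\<pi> v \<in> Vn n" for v using \<pi>(1) n(1) by blast
  have f_Vn: "v = \<pi> v" if v: "v \<in> Vn n" "f v \<in> Vn n" for v
  proof -
    have "f v - \<pi> v \<in> Vn n" using v \<pi>_Vn by (intro V.subspace_diff) auto
    then have "v - \<pi> v = 0" using v \<pi>_Vn by (intro s0 V.subspace_diff) (auto simp: f_def)
    then show ?thesis by simp
  qed
  have f_W: "f w = w" if "w \<in> W" for w
    using \<pi>(3) that by (simp add: f_def VV.linear_0[OF lin_s])
  have inj: "inj_on f (Vn n)"
    unfolding VV.linear_inj_on_iff_eq_0[OF lin_f Vn_subspace]
  proof (intro ballI impI)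
    fix v assume v: "v \<in> Vn n" "f v = 0"
    then have "v = \<pi> v" by (intro f_Vn) auto
    then have "v \<in> W" using \<pi>(1) by (metis rangeI subsetD)
    then show "v = 0" using f_W v(2) by auto
  qed
  have "\<forall>\<^sub>F N in sequentially. Vn n \<union> f ` Vn n \<subseteq> Vn N"
    by (intro finite_subset_Vn) auto
  then obtain N where N: "Vn n \<subseteq> (Vn N :: 'f fsv set)" "f ` Vn n \<subseteq> Vn N"
    by (auto dest: eventually_happens)
  obtain k where k: "k \<in> GLn N" "\<forall>w \<in> W. k w = w" "\<forall>v \<in> Vn n. k v = f v"
  proof (rule GLn_extend[OF lin_f inj, of W N])
    fix e assume e: "e \<in> Vn n" "e \<in> W \<or> f e \<in> W"
    then have "e \<in> W" using f_Vn[of e] n(1) \<pi>(1) by (metis rangeI subsetD)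
    then show "f e = e" by (rule f_W)
  qed (use assms N n in auto)
  have "k ` D \<inter> Z \<subseteq> W"
  proof clarify
    fix d assume d: "d \<in> D" "k d \<in> Z"
    then have "d \<in> Vn n" "f d \<in> Vn n" using n k by force+
    then have "d = \<pi> d" by (rule f_Vn)
    then have "d \<in> W" using \<pi>(1) by (metis rangeI subsetD)
    then show "k d \<in> W" using k(2) by simp
  qed
  then show ?thesis
    using k GLn_carrier by (intro bexI[of _ k]) (auto simp: pointwise_stab_iff)
qed

lemma pointwise_stab_fixed:
  assumes "finsub W" "pointwise_stab W \<subseteq> pointwise_stab S"
  shows "S \<subseteq> W"
proof
  fix v assume v: "v \<in> S"
  obtain k where k: "k \<in> pointwise_stab W" "k ` {v} \<inter> {v} \<subseteq> W"
    using generic_translate[OF assms(1), of "{v}" "{v}"] by auto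
  then have "k \<in> pointwise_stab S" using assms(2) by blast
  then have "k v = v" using v by (simp add: pointwise_stab_iff)
  then show "v \<in> W" using k(2) by auto
qed

lemma pointwise_stab_extend:
  assumes f: "linmap f" "inj_on f E" and "finsub W" "finsub E"
    and agree: "\<And>e. e \<in> E \<Longrightarrow> e \<in> W \<or> f e \<in> W \<Longrightarrow> f e = e"
  obtains u where "u \<in> pointwise_stab W" "\<forall>e \<in> E. u e = f e"
proof -
  have "\<forall>\<^sub>F n in sequentially. W \<union> E \<union> f ` E \<subseteq> Vn n"
    using assms by (intro finite_subset_Vn) auto
  then obtain n where n: "W \<subseteq> Vn n" "E \<subseteq> Vn n" "f ` E \<subseteq> Vn n"
    by (auto dest: eventually_happens)
  show thesis
    using GLn_extend[OF f _ _ n agree] assms that GLn_carrier by (metis pointwise_stab_iff)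
qed

text \<open>For \<open>W\<^sub>0 = W1 \<inter> W2\<close> the pointwise stabilizers satisfy
\<open>G(W\<^sub>0) = G(W1) G(W2) G(W1)\<close>.  Given \<open>g\<close> fixing \<open>W\<^sub>0\<close>, a generic element \<open>k\<close> of \<open>G(W1)\<close> moves
\<open>g W1\<close> so that it meets \<open>W2\<close> only in \<open>W\<^sub>0\<close>.  Then the restriction of \<open>k g\<close> to \<open>W1\<close> glues with the
identity of \<open>W2\<close>, so some \<open>u\<close> in \<open>G(W2)\<close> agrees with \<open>k g\<close> on \<open>W1\<close>, and \<open>u\<^sup>-\<^sup>1 k g\<close> lies in \<open>G(W1)\<close>.\<close>

lemma pointwise_stab_Int:
  fixes W1 W2 :: "'f::{field,finite} fsv set"
  assumes A: "subgroup A GL_inf" and W: "finsub W1" "finsub W2"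
    and sub: "pointwise_stab W1 \<subseteq> A" "pointwise_stab W2 \<subseteq> A"
  shows "pointwise_stab (W1 \<inter> W2) \<subseteq> A"
proof
  fix g assume g: "g \<in> pointwise_stab (W1 \<inter> W2)"
  then have gG: "g \<in> carrier GL_inf" by (simp add: pointwise_stab_iff)
  obtain k where k: "k \<in> pointwise_stab W1" "k ` (g ` W1) \<inter> W2 \<subseteq> W1"
    using generic_translate[of W1 "g ` W1" W2] W by auto
  then have kG: "k \<in> carrier GL_inf" by (simp add: pointwise_stab_iff)
  have kgG: "k \<circ> g \<in> carrier GL_inf" using GL.m_closed[OF kG gG] by simp
  have fix0: "(k \<circ> g) e = e" if "e \<in> W1" "e \<in> W2" for e
    using that g k by (simp add: pointwise_stab_iff)
  obtain u where u: "u \<in> pointwise_stab W2" "\<forall>e \<in> W1. u e = (k \<circ> g) e"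
  proof (rule pointwise_stab_extend[of "k \<circ> g" W1 W2])
    show "linmap (k \<circ> g)" using kgG by (rule GL_linear)
    have inj: "inj (k \<circ> g)" using GL_bij[OF kgG] by (rule bij_is_inj)
    then show "inj_on (k \<circ> g) W1" using inj_on_subset by blast
    fix e assume e: "e \<in> W1" "e \<in> W2 \<or> (k \<circ> g) e \<in> W2"
    show "(k \<circ> g) e = e"
    proof (cases "e \<in> W2")
      case True
      with e fix0 show ?thesis by blast
    next
      case False
      with e have "(k \<circ> g) e \<in> W2" by simp
      moreover from this have "(k \<circ> g) e \<in> W1" using k(2) e(1) by auto
      ultimately have "(k \<circ> g) ((k \<circ> g) e) = (k \<circ> g) e" using fix0 by blast
      then show ?thesis using inj by (meson injD)
    qed
  qed (use W in auto)
  have uG: "u \<in> carrier GL_inf" using u by (simp add: pointwise_stab_iff)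
  let ?r = "ginv u \<circ> (k \<circ> g)"
  have "?r \<in> carrier GL_inf" using GL.m_closed[OF GL.inv_closed[OF uG] kgG] by simp
  moreover have "?r e = e" if "e \<in> W1" for e using u(2) that uG by (metis comp_apply GL_inv_apply(2))
  ultimately have r: "?r \<in> A" using sub by (auto simp: pointwise_stab_iff)
  have "k \<in> A" "u \<in> A" using k u sub by auto
  have "ginv k \<circ> (u \<circ> ?r) = g"
    using kG uG by (simp add: fun_eq_iff)
  moreover have "ginv k \<circ> (u \<circ> ?r) \<in> A"
    using subgroup.m_closed[OF A subgroup.m_inv_closed[OF A \<open>k \<in> A\<close>] subgroup.m_closed[OF A \<open>u \<in> A\<close> r]] by simp
  ultimately show "g \<in> A" by simp
qed

definition supports :: "'f::{field,finite} fsv set \<Rightarrow> ('f vmap) set \<Rightarrow> bool" where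
  "supports W A \<longleftrightarrow> finsub W \<and> pointwise_stab W \<subseteq> A \<and>
     (\<forall>E. finsub E \<longrightarrow> pointwise_stab E \<subseteq> A \<longrightarrow> W \<subseteq> E)"

text \<open>A supporting subspace of least cardinality is contained in every other one, because supporting
subspaces are closed under intersection.\<close>

lemma least_support_exists:
  fixes A :: "('f::{field,finite} vmap) set"
  assumes A: "subgroup A GL_inf" and n: "Ufix n \<subseteq> A"
  obtains W where "supports W A"
proof -
  let ?P = "\<lambda>W. finsub W \<and> pointwise_stab W \<subseteq> A"
  have "?P (Vn n)" using n by simp
  then obtain W where W: "?P W" "\<And>E. ?P E \<Longrightarrow> card W \<le> card E"
    using ex_has_least_nat[of ?P "Vn n" card] by blast
  have "W \<subseteq> E" if E: "?P E" for E
  proof -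
    have "?P (W \<inter> E)" using pointwise_stab_Int[OF A, of W E] W(1) E by (auto intro: V.subspace_inter)
    then have "card W \<le> card (W \<inter> E)" by (rule W(2))
    then have "W \<inter> E = W" using W(1) by (intro card_seteq) auto
    then show ?thesis by blast
  qed
  with W(1) that show thesis unfolding supports_def by blast
qed

lemma subspace_image_GL:
  assumes "g \<in> carrier GL_inf" shows "finsub W \<Longrightarrow> finsub (g ` W)"
  using VV.linear_subspace_image[OF GL_linear[OF assms]] by blast

text \<open>The hypothesis says that the pointwise stabilizer of \<open>g\<^sup>-\<^sup>1 E\<close> lies in \<open>A\<close>.  In the applications
\<open>A\<close> is the stabilizer of a point and the translate of this point by \<open>g\<close> is fixed by all elements
that fix \<open>E\<close>.\<close>

lemma supports_translate:
  assumes W: "supports W A" and g: "g \<in> carrier GL_inf" and E: "finsub E"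
    and conj: "\<And>u. u \<in> pointwise_stab E \<Longrightarrow> ginv g \<circ> u \<circ> g \<in> A"
  shows "g ` W \<subseteq> E"
proof -
  have gi: "ginv g \<in> carrier GL_inf" using g by simp
  have "pointwise_stab (ginv g ` E) \<subseteq> A"
  proof
    fix u assume "u \<in> pointwise_stab (ginv g ` E)"
    from pointwise_stab_conj[OF g this]
    have "g \<circ> u \<circ> ginv g \<in> pointwise_stab E" using g by (simp add: image_image)
    from conj[OF this] have "ginv g \<circ> (g \<circ> u \<circ> ginv g) \<circ> g \<in> A" .
    moreover have "ginv g \<circ> (g \<circ> u \<circ> ginv g) \<circ> g = u"
      using g by (simp add: fun_eq_iff)
    ultimately show "u \<in> A" by simp
  qed
  then have "W \<subseteq> ginv g ` E"
    using W subspace_image_GL[OF gi E] by (simp add: supports_def)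
  then show ?thesis using g by force
qed

text \<open>So an open subgroup lies between the pointwise and the setwise stabilizer of its least support.\<close>

lemma supports_invariant:
  assumes A: "subgroup A GL_inf" and W: "supports W A" and a: "a \<in> A"
  shows "a ` W = W"
proof -
  have aG: "a \<in> carrier GL_inf" using subgroup.subset[OF A] a by blast
  have "a ` W \<subseteq> W"
  proof (rule supports_translate[OF W aG])
    show "finsub W" using W by (simp add: supports_def)
    fix u assume "u \<in> pointwise_stab W"
    then have "u \<in> A" using W by (auto simp: supports_def)
    then show "ginv a \<circ> u \<circ> a \<in> A"
      using subgroup.m_closed[OF A subgroup.m_closed[OF A subgroup.m_inv_closed[OF A a]] a] by simp
  qed
  moreover have "card (a ` W) = card W"
    using GL_bij[OF aG] by (intro card_image inj_on_subset[OF bij_is_inj]) auto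
  ultimately show ?thesis using W by (intro card_subset_eq) (auto simp: supports_def)
qed

text \<open>The double coset of \<open>g\<close> is determined by its partial graph, the set of all \<open>(v, g v)\<close> with \<open>v\<close> in
\<open>V\<^sub>k\<close> and \<open>g v\<close> in \<open>V\<^sub>m\<close>: if \<open>g\<close> and \<open>r\<close> have the same partial graph, then \<open>g r\<^sup>-\<^sup>1\<close> on \<open>r V\<^sub>k\<close>
glues with the identity of \<open>V\<^sub>m\<close>.  There are finitely many partial graphs.\<close>

lemma finite_double_cosets:
  fixes U :: "('f::{field,finite} vmap) set"
  assumes U: "U \<subseteq> carrier GL_inf"
  obtains R where "finite R" "R \<subseteq> U"
    "\<And>g. g \<in> U \<Longrightarrow> \<exists>r \<in> R. \<exists>u \<in> Ufix m. \<exists>a \<in> Ufix k. g = u \<circ> r \<circ> a"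
proof -
  define I where "I g = {p \<in> Vn k \<times> Vn m. g (fst p) = snd p}" for g :: "'f vmap"
  have same: "\<exists>u \<in> Ufix m. \<exists>a \<in> Ufix k. g = u \<circ> r \<circ> a"
    if g: "g \<in> U" and r: "r \<in> U" and I: "I g = I r" for g r
  proof -
    have gG: "g \<in> carrier GL_inf" and rG: "r \<in> carrier GL_inf" using g r U by auto
    let ?t = "g \<circ> ginv r"
    have tG: "?t \<in> carrier GL_inf" using GL.m_closed[OF gG GL.inv_closed[OF rG]] by simp
    obtain u where u: "u \<in> Ufix m" "\<forall>e \<in> r ` Vn k. u e = ?t e"
    proof (rule pointwise_stab_extend[of ?t "r ` Vn k" "Vn m"])
      show "linmap ?t" using tG by (rule GL_linear)
      show "inj_on ?t (r ` Vn k)" using GL_bij[OF tG] by (intro inj_on_subset[OF bij_is_inj]) auto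
      show "finsub (r ` Vn k)" by (rule subspace_image_GL[OF rG]) auto
      fix e assume e: "e \<in> r ` Vn k" "e \<in> Vn m \<or> ?t e \<in> Vn m"
      then obtain v where v: "v \<in> Vn k" "e = r v" by blast
      have t: "?t e = g v" using rG v by simp
      have "(v, r v) \<in> I r \<or> (v, g v) \<in> I g" using e v t by (auto simp: I_def)
      then have "(v, r v) \<in> I g \<or> (v, g v) \<in> I r" using I by simp
      then have "g v = r v" by (auto simp: I_def)
      then show "?t e = e" using t v by simp
    qed auto
    have uG: "u \<in> carrier GL_inf" using u by (simp add: pointwise_stab_iff)
    let ?a = "ginv (u \<circ> r) \<circ> g"
    have urG: "u \<circ> r \<in> carrier GL_inf" using GL.m_closed[OF uG rG] by simp
    have aG: "?a \<in> carrier GL_inf" using GL.m_closed[OF GL.inv_closed[OF urG] gG] by simp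
    have "?a v = v" if "v \<in> Vn k" for v
    proof -
      have "g v = (u \<circ> r) v" using u(2) that rG by simp
      then show ?thesis using GL_inv_apply(2)[OF urG, of v] by simp
    qed
    then have "?a \<in> Ufix k" using aG by (simp add: pointwise_stab_iff)
    moreover have "g = u \<circ> r \<circ> ?a" using GL_inv_apply(1)[OF urG] by (simp add: fun_eq_iff)
    ultimately show ?thesis using u(1) by blast
  qed
  define R where "R = (\<lambda>i. SOME r. r \<in> U \<and> I r = i) ` (I ` U)"
  have rep: "(SOME r. r \<in> U \<and> I r = I g) \<in> U \<and> I (SOME r. r \<in> U \<and> I r = I g) = I g" if "g \<in> U" for g
    by (rule someI[of "\<lambda>r. r \<in> U \<and> I r = I g" g]) (use that in auto)
  have "I ` U \<subseteq> Pow (Vn k \<times> Vn m)" by (auto simp: I_def)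
  then have "finite (I ` U)" by (rule finite_subset) auto
  then have "finite R" by (simp add: R_def)
  moreover have "R \<subseteq> U" using rep by (auto simp: R_def)
  moreover have "\<exists>r \<in> R. \<exists>u \<in> Ufix m. \<exists>a \<in> Ufix k. g = u \<circ> r \<circ> a"
    if "g \<in> U" for g
  proof (rule bexI)
    show "\<exists>u \<in> Ufix m. \<exists>a \<in> Ufix k. g = u \<circ> (SOME r. r \<in> U \<and> I r = I g) \<circ> a"
      by (rule same) (use that rep[OF that] in auto)
    show "(SOME r. r \<in> U \<and> I r = I g) \<in> R" using that by (simp add: R_def)
  qed
  ultimately show thesis by (rule that)
qed

section \<open>Smooth sets\<close>

type_synonym ('f, 'x) glset = "('f vmap, 'x) gset"

abbreviation opsub :: "('f::{field,finite} vmap) set \<Rightarrow> bool" where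
  "opsub \<equiv> open_subgroup GL_inf GL_inf_top"

abbreviation smooth :: "('f::{field,finite}, 'x) glset \<Rightarrow> bool" where
  "smooth \<equiv> ghat_set GL_inf GL_inf_top"

abbreviation FinSets :: "('f::{field,finite}, 'x) glset set" where
  "FinSets \<equiv> finitary_ghat_sets GL_inf GL_inf_top"

lemma Ufix_mono: "m \<le> n \<Longrightarrow> Ufix n \<subseteq> Ufix m"
  by (intro pointwise_stab_mono Vn_mono)

lemma opsubD:
  assumes "opsub U"
  shows "subgroup U GL_inf" "U \<subseteq> carrier GL_inf" "id \<in> U" "\<And>g h. g \<in> U \<Longrightarrow> h \<in> U \<Longrightarrow> g \<circ> h \<in> U"
    "\<And>g. g \<in> U \<Longrightarrow> ginv g \<in> U" "\<forall>\<^sub>F n in sequentially. Ufix n \<subseteq> U"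
proof -
  show s: "subgroup U GL_inf" using assms by (simp add: open_subgroup_iff)
  show "U \<subseteq> carrier GL_inf" "id \<in> U" "\<And>g h. g \<in> U \<Longrightarrow> h \<in> U \<Longrightarrow> g \<circ> h \<in> U"
    "\<And>g. g \<in> U \<Longrightarrow> ginv g \<in> U"
    using subgroup.subset[OF s] subgroup.one_closed[OF s] subgroup.m_closed[OF s] subgroup.m_inv_closed[OF s]
    by auto
  show "\<forall>\<^sub>F n in sequentially. Ufix n \<subseteq> U"
    using assms Ufix_mono unfolding open_subgroup_iff eventually_sequentially by (meson order_trans)
qed

lemma opsub_Ufix [simp]: "opsub (Ufix n)"
  by (auto simp: open_subgroup_iff pointwise_stab_subgroup)

text \<open>The conditions on a set with a smooth action in elementary form.  The last one, that small groups
\<open>U\<^sub>n\<close> fix a given point, replaces openness of its stabilizer.\<close>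

lemma smooth_iff:
  fixes X :: "('f::{field,finite}, 'x) glset"
  shows "smooth X \<longleftrightarrow> opsub (defgrp X) \<and>
    (\<forall>g \<in> defgrp X. act X g \<in> extensional (pts X)) \<and>
    (\<forall>g \<in> defgrp X. \<forall>x \<in> pts X. act X g x \<in> pts X) \<and>
    (\<forall>x \<in> pts X. act X id x = x) \<and>
    (\<forall>g \<in> defgrp X. \<forall>h \<in> defgrp X. \<forall>x \<in> pts X. act X (g \<circ> h) x = act X g (act X h x)) \<and>
    (\<forall>x \<in> pts X. \<forall>\<^sub>F n in sequentially. \<forall>u \<in> Ufix n. act X u x = x)" (is "_ \<longleftrightarrow> ?R")
proof
  assume X: "smooth X"
  let ?H = "GL_inf\<lparr>carrier := defgrp X\<rparr>"
  have op: "opsub (defgrp X)" and ga: "group_action ?H (pts X) (act X)"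
    using X by (auto simp: ghat_set_def)
  interpret group_action ?H "pts X" "act X" by (rule ga)
  have ext: "act X g \<in> extensional (pts X)" if "g \<in> defgrp X" for g
    using bij_prop0[of g] that by (simp add: Bij_def)
  have "act X g x \<in> pts X" if "g \<in> defgrp X" "x \<in> pts X" for g x
    using element_image[of g x "act X g x"] that by simp
  moreover have idx: "act X id x = x" if "x \<in> pts X" for x
    using fun_cong[OF id_eq_one, of x] that by simp
  moreover have "act X (g \<circ> h) x = act X g (act X h x)"
    if "g \<in> defgrp X" "h \<in> defgrp X" "x \<in> pts X" for g h x
    using composition_rule[of x g h] that by simp
  moreover have "\<forall>\<^sub>F n in sequentially. \<forall>u \<in> Ufix n. act X u x = x" if x: "x \<in> pts X" for x
  proof -
    have "openin GL_inf_top {g \<in> defgrp X. act X g x = x}"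
      using X x by (auto simp: ghat_set_def stabilizer_def)
    moreover have "id \<in> {g \<in> defgrp X. act X g x = x}"
      using opsubD(3)[OF op] idx x by simp
    ultimately obtain n where "\<forall>u \<in> Ufix n. id \<circ> u \<in> {g \<in> defgrp X. act X g x = x}"
      unfolding GL_inf_top_openin by blast
    then have "\<forall>u \<in> Ufix n. act X u x = x" by simp
    then show ?thesis using Ufix_mono unfolding eventually_sequentially by blast
  qed
  ultimately show ?R using op ext by blast
next
  assume R: ?R
  have op: "opsub (defgrp X)"
    and R1: "\<And>g. g \<in> defgrp X \<Longrightarrow> act X g \<in> extensional (pts X)"
    and R2: "\<And>g x. g \<in> defgrp X \<Longrightarrow> x \<in> pts X \<Longrightarrow> act X g x \<in> pts X"
    and R3: "\<And>x. x \<in> pts X \<Longrightarrow> act X id x = x"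
    and R4: "\<And>g h x. g \<in> defgrp X \<Longrightarrow> h \<in> defgrp X \<Longrightarrow> x \<in> pts X \<Longrightarrow> act X (g \<circ> h) x = act X g (act X h x)"
    and R5: "\<And>x. x \<in> pts X \<Longrightarrow> \<forall>\<^sub>F n in sequentially. \<forall>u \<in> Ufix n. act X u x = x"
    using R by blast+
  note D = opsubD[OF op]
  let ?H = "GL_inf\<lparr>carrier := defgrp X\<rparr>"
  have inv1: "act X (ginv g) (act X g x) = x" "act X g (act X (ginv g) x) = x"
    if g: "g \<in> defgrp X" and x: "x \<in> pts X" for g x
  proof -
    have gG: "g \<in> carrier GL_inf" using g D by blast
    have "ginv g \<circ> g = id" "g \<circ> ginv g = id" using GL.l_inv[OF gG] GL.r_inv[OF gG] by simp_all
    then show "act X (ginv g) (act X g x) = x" "act X g (act X (ginv g) x) = x"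
      using R4[OF D(5)[OF g] g x] R4[OF g D(5)[OF g] x] R3[OF x] by simp_all
  qed
  have bij: "act X g \<in> Bij (pts X)" if g: "g \<in> defgrp X" for g
  proof -
    have "bij_betw (act X g) (pts X) (pts X)"
      by (rule bij_betw_byWitness[where f' = "act X (ginv g)"])
         (use inv1[OF g] R2 g D(5)[OF g] in auto)
    then show ?thesis using R1[OF g] by (simp add: Bij_def)
  qed
  have "group_action ?H (pts X) (act X)"
  proof (rule group_action.intro, rule group_hom.intro)
    show "group ?H" by (rule GL.subgroup_imp_group[OF D(1)])
    show "group (BijGroup (pts X))" by (rule group_BijGroup)
    show "group_hom_axioms ?H (BijGroup (pts X)) (act X)"
    proof (rule group_hom_axioms.intro, rule homI)
      fix g h assume gh: "g \<in> carrier ?H" "h \<in> carrier ?H"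
      then have gh': "g \<in> defgrp X" "h \<in> defgrp X" by auto
      then have "act X (g \<circ> h) x = compose (pts X) (act X g) (act X h) x" for x
        using R1[OF D(4)[OF gh']] R4[OF gh'] by (auto simp: compose_def extensional_def)
      then show "act X (g \<otimes>\<^bsub>?H\<^esub> h) = act X g \<otimes>\<^bsub>BijGroup (pts X)\<^esub> act X h"
        using bij gh' by (auto simp: BijGroup_def)
    qed (use bij in \<open>simp add: BijGroup_def\<close>)
  qed
  moreover have "openin GL_inf_top (stabilizer ?H (act X) x)" if x: "x \<in> pts X" for x
    unfolding GL_inf_top_openin
  proof (intro conjI ballI)
    show "stabilizer ?H (act X) x \<subseteq> carrier GL_inf" using D(2) by (auto simp: stabilizer_def)
    fix g assume g: "g \<in> stabilizer ?H (act X) x"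
    have "\<forall>\<^sub>F n in sequentially. \<forall>u \<in> Ufix n. act X u x = x" by (rule R5[OF x])
    with D(6) have "\<forall>\<^sub>F n in sequentially. Ufix n \<subseteq> defgrp X \<and> (\<forall>u \<in> Ufix n. act X u x = x)"
      by eventually_elim blast
    then obtain n where n: "Ufix n \<subseteq> defgrp X" "\<forall>u \<in> Ufix n. act X u x = x" by (auto dest: eventually_happens)
    have "\<forall>u \<in> Ufix n. g \<circ> u \<in> stabilizer ?H (act X) x"
    proof
      fix u :: "'f vmap" assume u: "u \<in> Ufix n"
      then have "u \<in> defgrp X" using n by blast
      moreover have "g \<in> defgrp X" "act X g x = x" using g by (auto simp: stabilizer_def)
      ultimately show "g \<circ> u \<in> stabilizer ?H (act X) x"
        using R4[of g u x] D(4)[of g u] n(2) u x by (simp add: stabilizer_def)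
    qed
    then show "\<exists>n. \<forall>u \<in> Ufix n. g \<circ> u \<in> stabilizer ?H (act X) x" by blast
  qed
  ultimately show "smooth X" using op by (simp add: ghat_set_def)
qed

lemma smoothD:
  assumes "smooth X"
  shows "opsub (defgrp X)"
    "\<And>g x. g \<in> defgrp X \<Longrightarrow> x \<in> pts X \<Longrightarrow> act X g x \<in> pts X"
    "\<And>x. x \<in> pts X \<Longrightarrow> act X id x = x"
    "\<And>g h x. g \<in> defgrp X \<Longrightarrow> h \<in> defgrp X \<Longrightarrow> x \<in> pts X \<Longrightarrow> act X (g \<circ> h) x = act X g (act X h x)"
    "\<And>x. x \<in> pts X \<Longrightarrow> \<forall>\<^sub>F n in sequentially. \<forall>u \<in> Ufix n. act X u x = x"
  using assms by (auto simp: smooth_iff)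

lemma act_inv:
  assumes X: "smooth X" and g: "g \<in> defgrp X" and x: "x \<in> pts X"
  shows "act X (ginv g) (act X g x) = x" "act X g (act X (ginv g) x) = x"
proof -
  note D = opsubD[OF smoothD(1)[OF X]]
  have gG: "g \<in> carrier GL_inf" using g D by blast
  have "ginv g \<circ> g = id" "g \<circ> ginv g = id" using GL.l_inv[OF gG] GL.r_inv[OF gG] by simp_all
  then show "act X (ginv g) (act X g x) = x" "act X g (act X (ginv g) x) = x"
    using smoothD(4)[OF X D(5)[OF g] g x] smoothD(4)[OF X g D(5)[OF g] x] smoothD(3)[OF X x] by simp_all
qed

lemma transitive_gset_iff:
  assumes X: "smooth X"
  shows "transitive_gset GL_inf X \<longleftrightarrow>
    pts X \<noteq> {} \<and> (\<forall>x \<in> pts X. \<forall>y \<in> pts X. \<exists>g \<in> defgrp X. act X g x = y)"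
  using X by (auto simp: transitive_gset_def transitive_action_def transitive_action_axioms_def ghat_set_def)

definition orb :: "('g \<Rightarrow> 'x \<Rightarrow> 'x) \<Rightarrow> 'g set \<Rightarrow> 'x \<Rightarrow> 'x set" where
  "orb a U x = (\<lambda>g. a g x) ` U"

lemma finitary_iff: "finitary G X \<longleftrightarrow> finite (orb (act X) (defgrp X) ` pts X)"
proof -
  have "orbits (G\<lparr>carrier := defgrp X\<rparr>) (pts X) (act X) = orb (act X) (defgrp X) ` pts X"
    by (auto simp: orbits_def orbit_def orb_def image_def)
  then show ?thesis by (simp add: finitary_def)
qed

lemma FinSetsD: "X \<in> FinSets \<Longrightarrow> smooth X"
  by (simp add: finitary_ghat_sets_def)

lemma orb_self: "smooth X \<Longrightarrow> opsub U \<Longrightarrow> x \<in> pts X \<Longrightarrow> x \<in> orb (act X) U x"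
  using smoothD(3) opsubD(3) by (force simp: orb_def)

lemma orb_eq:
  assumes X: "smooth X" and U: "opsub U" "U \<subseteq> defgrp X" and x: "x \<in> pts X" and y: "y \<in> orb (act X) U x"
  shows "orb (act X) U y = orb (act X) U x"
proof -
  obtain g where g: "g \<in> U" "y = act X g x" using y by (auto simp: orb_def)
  have "orb (act X) U (act X h z) \<subseteq> orb (act X) U z" if "h \<in> U" "z \<in> pts X" for h z
  proof
    fix w assume "w \<in> orb (act X) U (act X h z)"
    then obtain k where k: "k \<in> U" "w = act X k (act X h z)" by (auto simp: orb_def)
    moreover have "k \<in> defgrp X" "h \<in> defgrp X" using k that U(2) by auto
    ultimately have "w = act X (k \<circ> h) z" using smoothD(4)[OF X, of k h z] that by simp
    then show "w \<in> orb (act X) U z" using opsubD(4)[OF U(1) k(1) that(1)] by (auto simp: orb_def)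
  qed
  from this[OF g(1) x] this[OF opsubD(5)[OF U(1) g(1)], of "act X g x"]
  show ?thesis
    using g U x smoothD(2)[OF X, of g x] act_inv(1)[OF X, of g x] by auto
qed

lemma orb_subset: "smooth X \<Longrightarrow> U \<subseteq> defgrp X \<Longrightarrow> x \<in> pts X \<Longrightarrow> orb (act X) U x \<subseteq> pts X"
  using smoothD(2) by (fastforce simp: orb_def)

lemma orb_disjoint:
  assumes "smooth X" "opsub U" "U \<subseteq> defgrp X"
  shows "pairwise disjnt (orb (act X) U ` pts X)"
proof (rule pairwiseI, clarify)
  fix x y assume xy: "x \<in> pts X" "y \<in> pts X" "orb (act X) U x \<noteq> orb (act X) U y"
  then show "disjnt (orb (act X) U x) (orb (act X) U y)"
    unfolding disjnt_def using orb_eq[OF assms xy(1)] orb_eq[OF assms xy(2)] by blast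
qed

text \<open>Finitarity is independent of the group of definition.  A single orbit of the large group is the
image of \<open>g \<mapsto> g x\<close>, and this map is constant on cosets of some \<open>U\<^sub>k\<close>, so the orbits of
\<open>U \<supseteq> U\<^sub>m\<close> in it are images of the double cosets of \<open>U\<^sub>m\<close> and \<open>U\<^sub>k\<close>.\<close>

lemma finite_orbits:
  fixes X :: "('f::{field,finite}, 'x) glset"
  assumes X: "X \<in> FinSets" and U: "opsub U" "U \<subseteq> defgrp X"
  shows "finite (orb (act X) U ` pts X)"
proof -
  note sX = FinSetsD[OF X]
  let ?D = "defgrp X"
  note oD = smoothD(1)[OF sX]
  have one: "finite (orb (act X) U ` orb (act X) ?D x)" if x: "x \<in> pts X" for x
  proof -
    obtain m where m: "Ufix m \<subseteq> U" using opsubD(6)[OF U(1)] by (auto dest: eventually_happens)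
    have "\<forall>\<^sub>F k in sequentially. Ufix k \<subseteq> ?D \<and> (\<forall>u \<in> Ufix k. act X u x = x)"
      using opsubD(6)[OF oD] smoothD(5)[OF sX x] by eventually_elim blast
    then obtain k where k: "Ufix k \<subseteq> ?D" "\<forall>u \<in> Ufix k. act X u x = x" by (auto dest: eventually_happens)
    obtain R where R: "finite R" "R \<subseteq> ?D"
      "\<And>g. g \<in> ?D \<Longrightarrow> \<exists>r \<in> R. \<exists>u \<in> Ufix m. \<exists>a \<in> Ufix k. g = u \<circ> r \<circ> a"
      using finite_double_cosets[OF opsubD(2)[OF oD], of m k] by metis
    have "orb (act X) U (act X g x) \<in> (\<lambda>r. orb (act X) U (act X r x)) ` R" if g: "g \<in> ?D" for g
    proof -
      obtain r u a where rua: "r \<in> R" "u \<in> Ufix m" "a \<in> Ufix k" "g = u \<circ> r \<circ> a" using R(3)[OF g] by blast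
      then have D: "r \<in> ?D" "u \<in> ?D" "u \<in> U" "a \<in> ?D" using R(2) m U(2) k(1) by auto
      then have "act X g x = act X u (act X r x)"
        using rua k(2) x smoothD(4)[OF sX, of "u \<circ> r" a x] smoothD(4)[OF sX, of u r x] opsubD(4)[OF oD, of u r] by simp
      then have "act X g x \<in> orb (act X) U (act X r x)" using D by (auto simp: orb_def)
      then have "orb (act X) U (act X g x) = orb (act X) U (act X r x)"
        by (rule orb_eq[OF sX U smoothD(2)[OF sX D(1) x]])
      then show ?thesis using rua(1) by blast
    qed
    then have "orb (act X) U ` orb (act X) ?D x \<subseteq> (\<lambda>r. orb (act X) U (act X r x)) ` R"
      by (auto simp: orb_def[of _ ?D])
    then show ?thesis using R(1) finite_surj by blast
  qed
  have "finite (orb (act X) ?D ` pts X)" using X by (simp add: finitary_ghat_sets_def finitary_iff)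
  then have "finite (\<Union>Q \<in> orb (act X) ?D ` pts X. orb (act X) U ` Q)" using one by blast
  moreover have "orb (act X) U ` pts X \<subseteq> (\<Union>Q \<in> orb (act X) ?D ` pts X. orb (act X) U ` Q)"
    using orb_self[OF sX oD] by blast
  ultimately show ?thesis by (rule rev_finite_subset)
qed

subsection \<open>Restriction to invariant subsets\<close>

text \<open>Restricts the points and the group of definition at the same time: orbits of a smaller group and
fibers with the action of a stabilizer are both of this form.\<close>

definition restr :: "'g set \<Rightarrow> 'x set \<Rightarrow> ('g, 'x) gset \<Rightarrow> ('g, 'x) gset" where
  "restr U P X = \<lparr>defgrp = U, pts = P, act = (\<lambda>g. restrict (act X g) P)\<rparr>"

lemma restr_simps [simp]:
  "defgrp (restr U P X) = U" "pts (restr U P X) = P" "act (restr U P X) g = restrict (act X g) P"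
  by (simp_all add: restr_def)

lemma FinSets_restr:
  assumes X: "X \<in> FinSets" and U: "opsub U" "U \<subseteq> defgrp X"
    and P: "P \<subseteq> pts X" "\<And>g x. g \<in> U \<Longrightarrow> x \<in> P \<Longrightarrow> act X g x \<in> P"
  shows "restr U P X \<in> FinSets"
proof -
  note sX = FinSetsD[OF X]
  have "smooth (restr U P X)"
    unfolding smooth_iff restr_simps
  proof (intro conjI ballI)
    fix g h x assume g: "g \<in> U" "h \<in> U" "x \<in> P"
    with smoothD(4)[OF sX, of g h x] U P show "restrict (act X (g \<circ> h)) P x = restrict (act X g) P (restrict (act X h) P x)"
      by auto
  next
    fix x assume "x \<in> P"
    then show "restrict (act X id) P x = x" "\<forall>\<^sub>F n in sequentially. \<forall>u \<in> Ufix n. restrict (act X u) P x = x"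
      using smoothD(3,5)[OF sX, of x] P(1) by auto
  qed (use P U in auto)
  moreover have "finitary GL_inf (restr U P X)"
  proof -
    have "orb (act (restr U P X)) U ` P = orb (act X) U ` P"
      by (intro image_cong refl) (simp add: orb_def)
    also have "\<dots> \<subseteq> orb (act X) U ` pts X" using P(1) by blast
    finally show ?thesis using finite_orbits[OF X U] by (simp add: finitary_iff finite_subset)
  qed
  ultimately show ?thesis by (simp add: finitary_ghat_sets_def)
qed

lemma opsub_stabilizer:
  assumes "smooth Y" "y \<in> pts Y"
  shows "opsub (stabilizer (GL_inf\<lparr>carrier := defgrp Y\<rparr>) (act Y) y)"
proof -
  let ?A = "stabilizer (GL_inf\<lparr>carrier := defgrp Y\<rparr>) (act Y) y"
  interpret group_action "GL_inf\<lparr>carrier := defgrp Y\<rparr>" "pts Y" "act Y"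
    using assms by (simp add: ghat_set_def)
  have "subgroup ?A (GL_inf\<lparr>carrier := defgrp Y\<rparr>)" by (rule stabilizer_subgroup[OF assms(2)])
  then have "subgroup ?A GL_inf"
    using GL.incl_subgroup[OF opsubD(1)[OF smoothD(1)[OF assms(1)]]] by blast
  moreover have "openin GL_inf_top ?A" using assms by (simp add: ghat_set_def)
  ultimately show ?thesis by (simp add: open_subgroup_def)
qed

lemma stabilizer_iff:
  "g \<in> stabilizer (GL_inf\<lparr>carrier := U\<rparr>) a y \<longleftrightarrow> g \<in> U \<and> a g y = y"
  by (simp add: stabilizer_def)

lemma gset_fiber_restr:
  "gset_fiber GL_inf X Y f y =
    restr (stabilizer (GL_inf\<lparr>carrier := defgrp Y\<rparr>) (act Y) y) {x \<in> pts X. f x = y} X"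
  by (simp add: gset_fiber_def restr_def)

lemma FinSets_fiber:
  fixes X :: "('f::{field,finite}, 'x) glset"
  assumes X: "X \<in> FinSets" and Y: "Y \<in> FinSets" and "defgrp X = defgrp Y"
    and f: "equivariant_map (defgrp Y) X Y f" and y: "y \<in> pts Y"
  shows "gset_fiber GL_inf X Y f y \<in> FinSets"
  unfolding gset_fiber_restr
proof (rule FinSets_restr[OF X opsub_stabilizer[OF FinSetsD[OF Y] y]])
  fix g x assume "g \<in> stabilizer (GL_inf\<lparr>carrier := defgrp Y\<rparr>) (act Y) y" "x \<in> {x \<in> pts X. f x = y}"
  then show "act X g x \<in> {x \<in> pts X. f x = y}"
    using f smoothD(2)[OF FinSetsD[OF X], of g x] assms(3) by (auto simp: stabilizer_iff equivariant_map_def)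
next
  show "stabilizer (GL_inf\<lparr>carrier := defgrp Y\<rparr>) (act Y) y \<subseteq> defgrp X"
    unfolding assms(3) by (rule subsetI) (simp add: stabilizer_iff)
qed blast

lemma conj_Ufix:
  assumes g: "g \<in> GLn k" "k \<le> n"
  shows "u \<in> Ufix n \<Longrightarrow> g \<circ> u \<circ> ginv g \<in> Ufix n" "u \<in> Ufix n \<Longrightarrow> ginv g \<circ> u \<circ> g \<in> Ufix n"
proof -
  have gG: "g \<in> carrier GL_inf" using g GLn_carrier by blast
  have "g \<in> GLn n" using g GLn_mono by blast
  then have gn: "g ` Vn n = Vn n" by (simp add: GLn_def)
  show "u \<in> Ufix n \<Longrightarrow> g \<circ> u \<circ> ginv g \<in> Ufix n" using pointwise_stab_conj[OF gG, of u "Vn n"] gn by simp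
  have "ginv g ` (g ` Vn n) = Vn n" using gG by (simp add: image_image)
  then have "ginv g ` Vn n = Vn n" using gn by simp
  then show "u \<in> Ufix n \<Longrightarrow> ginv g \<circ> u \<circ> g \<in> Ufix n"
    using pointwise_stab_conj[OF GL.inv_closed[OF gG], of u "Vn n"] gG by simp
qed

lemma FinSets_conj:
  fixes X :: "('f::{field,finite}, 'x) glset"
  assumes X: "X \<in> FinSets" and g: "g \<in> carrier GL_inf"
  shows "gset_conj GL_inf X g \<in> FinSets"
proof -
  note sX = FinSetsD[OF X]
  note oX = opsubD[OF smoothD(1)[OF sX]]
  let ?i = "ginv g"
  let ?c = "\<lambda>u. g \<circ> u \<circ> ?i"
  let ?d = "\<lambda>u. ?i \<circ> u \<circ> g"
  obtain k where k: "g \<in> GLn k" using g by (auto simp: GL_inf_def)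
  have dc: "?d (?c u) = u" "?c (?d u) = u" for u using g by (auto simp: fun_eq_iff)
  have dcomp: "?d (u \<circ> v) = ?d u \<circ> ?d v" for u v using g by (auto simp: fun_eq_iff)
  have di: "?d id = id" using g by (auto simp: fun_eq_iff)
  \<comment> \<open>Membership in the conjugated group is tested by conjugating back, which is how the action of the
conjugate set is defined.\<close>
  have U: "u \<in> ?c ` defgrp X \<longleftrightarrow> ?d u \<in> defgrp X" for u
  proof
    assume "?d u \<in> defgrp X"
    then show "u \<in> ?c ` defgrp X" by (rule rev_image_eqI) (rule dc(2)[symmetric])
  next
    assume "u \<in> ?c ` defgrp X"
    then show "?d u \<in> defgrp X" by (rule imageE) (simp only: dc(1))
  qed
  have sub: "subgroup (?c ` defgrp X) GL_inf"
  proof (rule GL.subgroupI)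
    have cG: "?c u \<in> carrier GL_inf" if "u \<in> carrier GL_inf" for u
      using GL.m_closed[OF GL.m_closed[OF g that] GL.inv_closed[OF g]] by simp
    then show "?c ` defgrp X \<subseteq> carrier GL_inf" using oX(2) by blast
    show "?c ` defgrp X \<noteq> {}" using oX(3) by blast
    fix a assume a: "a \<in> ?c ` defgrp X"
    then obtain u where u: "u \<in> defgrp X" "a = ?c u" by blast
    have uG: "u \<in> carrier GL_inf" using u oX by blast
    have "ginv a = ?c (ginv u)"
    proof (rule GL.inv_equality)
      show "a \<in> carrier GL_inf" "?c (ginv u) \<in> carrier GL_inf"
        using cG[OF uG] cG[OF GL.inv_closed[OF uG]] u(2) by simp_all
    qed (use uG g u(2) in \<open>simp add: fun_eq_iff\<close>)
    then show "ginv a \<in> ?c ` defgrp X" using oX(5)[OF u(1)] by blast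
    fix b assume b: "b \<in> ?c ` defgrp X"
    show "a \<otimes>\<^bsub>GL_inf\<^esub> b \<in> ?c ` defgrp X"
      using a b oX(4) unfolding U GL_inf_simps dcomp by blast
  qed
  obtain N where "\<And>n. n \<ge> N \<Longrightarrow> Ufix n \<subseteq> defgrp X" using oX(6) by (auto simp: eventually_sequentially)
  then have "Ufix (max N k) \<subseteq> ?c ` defgrp X"
    using conj_Ufix(2)[OF k max.cobounded2[of k N]] max.cobounded1[of N k] unfolding subset_iff U by blast
  then have op: "opsub (?c ` defgrp X)" using sub by (auto simp: open_subgroup_iff)
  have cs: "defgrp (gset_conj GL_inf X g) = ?c ` defgrp X" "pts (gset_conj GL_inf X g) = pts X"
    "act (gset_conj GL_inf X g) u = act X (?d u)" for u
    by (simp_all add: gset_conj_def)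
  have "smooth (gset_conj GL_inf X g)"
    unfolding smooth_iff cs
  proof (intro conjI ballI op)
    fix u assume "u \<in> ?c ` defgrp X"
    then have u: "?d u \<in> defgrp X" by (simp only: U)
    then show "act X (?d u) \<in> extensional (pts X)" using sX unfolding smooth_iff by blast
    fix x assume x: "x \<in> pts X"
    show "act X (?d u) x \<in> pts X" by (rule smoothD(2)[OF sX u x])
    fix v assume "v \<in> ?c ` defgrp X"
    then have v: "?d v \<in> defgrp X" by (simp only: U)
    show "act X (?d (u \<circ> v)) x = act X (?d u) (act X (?d v) x)"
      unfolding dcomp by (rule smoothD(4)[OF sX u v x])
  next
    fix x assume x: "x \<in> pts X"
    show "act X (?d id) x = x" unfolding di by (rule smoothD(3)[OF sX x])
    show "\<forall>\<^sub>F n in sequentially. \<forall>u \<in> Ufix n. act X (?d u) x = x"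
      using smoothD(5)[OF sX x] eventually_ge_at_top[of k]
      by eventually_elim (use conj_Ufix(2)[OF k] in blast)
  qed
  moreover have "finitary GL_inf (gset_conj GL_inf X g)"
  proof -
    have "orb (act (gset_conj GL_inf X g)) (?c ` defgrp X) = orb (act X) (defgrp X)"
      unfolding orb_def cs image_image dc(1) by (rule refl)
    then show ?thesis using X by (simp add: finitary_ghat_sets_def finitary_iff cs)
  qed
  ultimately show ?thesis by (simp add: finitary_ghat_sets_def)
qed

section \<open>Free commutative rings\<close>

lemma ring_on_simps [simp]:
  "carrier (ring_on A) = A" "monoid.mult (ring_on A) = (*)" "one (ring_on A) = 1"
  "zero (ring_on A) = 0" "add (ring_on A) = (+)"
  by (simp_all add: ring_on_def)

lemma cring_ring_on:
  assumes one: "1 \<in> A" and diff: "\<And>x y. x \<in> A \<Longrightarrow> y \<in> A \<Longrightarrow> x - y \<in> A"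
    and mult: "\<And>x y. x \<in> A \<Longrightarrow> y \<in> A \<Longrightarrow> x * y \<in> A"
  shows "cring (ring_on A)"
proof -
  have zero: "0 \<in> A" using diff[OF one one] by simp
  have neg: "- x \<in> A" if "x \<in> A" for x using diff[OF zero that] by simp
  have add: "x + y \<in> A" if "x \<in> A" "y \<in> A" for x y using diff[OF that(1) neg[OF that(2)]] by simp
  show ?thesis
  proof (rule cringI)
    show "abelian_group (ring_on A)"
      by (rule abelian_groupI) (use add zero neg in \<open>auto simp: algebra_simps intro!: bexI[of _ "- _"]\<close>)
    show "comm_monoid (ring_on A)"
      by (rule comm_monoidI) (use mult one in \<open>auto simp: algebra_simps\<close>)
  qed (simp add: algebra_simps)
qed

lemma free_cring_carrier: "p \<in> carrier (free_cring I) \<longleftrightarrow> (\<forall>m \<in> Poly_Mapping.keys p. Poly_Mapping.keys m \<subseteq> I)"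
  by (simp add: free_cring_def)

lemma free_cring_simps [simp]:
  "monoid.mult (free_cring I) = (*)" "one (free_cring I) = 1"
  "zero (free_cring I) = 0" "add (free_cring I) = (+)"
  by (simp_all add: free_cring_def)

lemma free_cring_one [intro]: "1 \<in> carrier (free_cring I)"
  by (simp add: free_cring_carrier)

lemma free_cring_diff: "p \<in> carrier (free_cring I) \<Longrightarrow> r \<in> carrier (free_cring I) \<Longrightarrow> p - r \<in> carrier (free_cring I)"
  unfolding free_cring_carrier using keys_diff[of p r] by blast

lemma free_cring_mult: "p \<in> carrier (free_cring I) \<Longrightarrow> r \<in> carrier (free_cring I) \<Longrightarrow> p * r \<in> carrier (free_cring I)"
  unfolding free_cring_carrier
proof
  fix m assume p: "\<forall>m \<in> Poly_Mapping.keys p. Poly_Mapping.keys m \<subseteq> I" and r: "\<forall>m \<in> Poly_Mapping.keys r. Poly_Mapping.keys m \<subseteq> I"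
    and "m \<in> Poly_Mapping.keys (p * r)"
  then obtain a b where "m = a + b" "a \<in> Poly_Mapping.keys p" "b \<in> Poly_Mapping.keys r"
    using keys_mult[of p r] by blast
  then show "Poly_Mapping.keys m \<subseteq> I" using p r Poly_Mapping.keys_add[of a b] by blast
qed

lemma cring_free_cring: "cring (free_cring I)"
proof -
  have "free_cring I = ring_on (carrier (free_cring I))" by (simp add: free_cring_def)
  moreover have "cring (ring_on (carrier (free_cring I)))"
    by (rule cring_ring_on[OF free_cring_one free_cring_diff free_cring_mult])
  ultimately show ?thesis by (rule ssubst)
qed

lemma free_cring_zero: "0 \<in> carrier (free_cring I)"
  by (simp add: free_cring_carrier)

lemma free_cring_uminus: "p \<in> carrier (free_cring I) \<Longrightarrow> - p \<in> carrier (free_cring I)"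
  using free_cring_diff[OF free_cring_zero] by simp

lemma free_cring_add: "p \<in> carrier (free_cring I) \<Longrightarrow> r \<in> carrier (free_cring I) \<Longrightarrow> p + r \<in> carrier (free_cring I)"
  using free_cring_diff[of p I "- r"] free_cring_uminus[of r I] by simp

lemma single_0_int: "Poly_Mapping.single 0 (c :: int) = (of_int c :: 'a::monoid_add \<Rightarrow>\<^sub>0 int)"
proof -
  have "Poly_Mapping.single 0 (of_int c :: int) = (of_int c :: 'a \<Rightarrow>\<^sub>0 int)" by (rule single_of_int)
  then show ?thesis by simp
qed

lemma free_cring_of_int: "of_int c \<in> carrier (free_cring I)"
proof -
  have "Poly_Mapping.single 0 c \<in> carrier (free_cring I)" by (simp add: free_cring_carrier)
  then show ?thesis by (simp add: single_0_int)
qed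

lemma free_cring_of_nat: "of_nat c \<in> carrier (free_cring I)"
  using free_cring_of_int[of "int c"] by simp

lemma free_cring_symb: "i \<in> I \<Longrightarrow> symb i \<in> carrier (free_cring I)"
  by (simp add: free_cring_carrier symb_def)

lemma free_cring_sum: "(\<And>i. i \<in> A \<Longrightarrow> f i \<in> carrier (free_cring I)) \<Longrightarrow> sum f A \<in> carrier (free_cring I)"
  by (induction A rule: infinite_finite_induct) (auto simp: free_cring_zero free_cring_add)

lemmas free_cring_closed = free_cring_zero free_cring_one free_cring_diff free_cring_mult free_cring_uminus
  free_cring_add free_cring_of_int free_cring_of_nat free_cring_symb free_cring_sum

lemma single_sum_monom:
  "finite A \<Longrightarrow> Poly_Mapping.single (\<Sum>i\<in>A. Poly_Mapping.single i (f i)) (1::int) = (\<Prod>i\<in>A. symb i ^ f i)"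
proof (induction A rule: finite_induct)
  case (insert a A)
  have "Poly_Mapping.single (Poly_Mapping.single a n) (1::int) = symb a ^ n" for n
  proof (induction n)
    case (Suc n)
    have "symb a ^ Suc n = symb a * Poly_Mapping.single (Poly_Mapping.single a n) 1"
      by (simp add: Suc.IH)
    also have "\<dots> = Poly_Mapping.single (Poly_Mapping.single a 1 + Poly_Mapping.single a n) 1"
      by (simp add: symb_def mult_single)
    also have "Poly_Mapping.single a 1 + Poly_Mapping.single a n = Poly_Mapping.single a (Suc n)"
      by (simp add: single_add[symmetric])
    finally show ?case by simp
  qed simp
  moreover have "Poly_Mapping.single (Poly_Mapping.single a (f a) + (\<Sum>i\<in>A. Poly_Mapping.single i (f i))) (1::int)
    = Poly_Mapping.single (Poly_Mapping.single a (f a)) 1 * Poly_Mapping.single (\<Sum>i\<in>A. Poly_Mapping.single i (f i)) 1"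
    by (simp add: mult_single)
  ultimately show ?case using insert by simp
qed simp

lemma poly_mapping_sum_single:
  "p = (\<Sum>m\<in>Poly_Mapping.keys p. Poly_Mapping.single m (Poly_Mapping.lookup p m))"
  by (rule poly_mapping_eqI)
     (auto simp: lookup_sum lookup_single when_def in_keys_iff sum.delta if_distrib cong: if_cong)

text \<open>Reduces statements about the free ring to its constants and symbols, see \<open>free_cring_induct\<close>.\<close>

lemma int_mpoly_expansion:
  "(p :: 'i int_mpoly) = (\<Sum>m\<in>Poly_Mapping.keys p. of_int (Poly_Mapping.lookup p m) *
      (\<Prod>i\<in>Poly_Mapping.keys m. symb i ^ Poly_Mapping.lookup m i))"
proof -
  have "Poly_Mapping.single m c = of_int c * (\<Prod>i\<in>Poly_Mapping.keys m. symb i ^ Poly_Mapping.lookup m i)"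
    for m :: "'i \<Rightarrow>\<^sub>0 nat" and c :: int
  proof -
    have "Poly_Mapping.single m c = Poly_Mapping.single 0 c * Poly_Mapping.single m 1"
      by (simp add: mult_single)
    also have "Poly_Mapping.single 0 c = of_int c" by (rule single_0_int)
    also have "Poly_Mapping.single m (1::int) = (\<Prod>i\<in>Poly_Mapping.keys m. symb i ^ Poly_Mapping.lookup m i)"
      using poly_mapping_sum_single[of m] single_sum_monom[of "Poly_Mapping.keys m" "Poly_Mapping.lookup m"]
      by simp
    finally show ?thesis .
  qed
  then show ?thesis using poly_mapping_sum_single[of p] by simp
qed

lemma free_cring_induct [consumes 1, case_names const symb add mult]:
  assumes "p \<in> carrier (free_cring I)"
    and const: "\<And>c. P (of_int c)" and symb: "\<And>i. i \<in> I \<Longrightarrow> P (symb i)"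
    and add: "\<And>x y. P x \<Longrightarrow> P y \<Longrightarrow> P (x + y)" and mult: "\<And>x y. P x \<Longrightarrow> P y \<Longrightarrow> P (x * y)"
  shows "P p"
proof -
  have P0: "P 0" and P1: "P 1" using const[of 0] const[of 1] by simp_all
  have sum: "P (sum f A)" if "\<And>i. i \<in> A \<Longrightarrow> P (f i)" for f :: "'b \<Rightarrow> _" and A
    using that by (induction A rule: infinite_finite_induct) (auto simp: P0 add)
  have prod: "P (prod f A)" if "\<And>i. i \<in> A \<Longrightarrow> P (f i)" for f :: "'b \<Rightarrow> _" and A
    using that by (induction A rule: infinite_finite_induct) (auto simp: P1 mult)
  have pow: "P (x ^ n)" if "P x" for x n using that by (induction n) (auto simp: P1 mult)
  have "P (\<Sum>m\<in>Poly_Mapping.keys p. of_int (Poly_Mapping.lookup p m) *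
      (\<Prod>i\<in>Poly_Mapping.keys m. symb i ^ Poly_Mapping.lookup m i))"
    using assms(1) by (intro sum mult const prod pow symb) (auto simp: free_cring_carrier)
  then show ?thesis using int_mpoly_expansion[of p] by simp
qed

section \<open>Relations in \<open>\<Theta>(G)\<close>\<close>

abbreviation FC :: "('f::{field,finite}, 'x) glset int_mpoly set" where
  "FC \<equiv> carrier (free_cring FinSets)"

abbreviation ThetaR :: "('f::{field,finite}, 'x) glset int_mpoly set" where
  "ThetaR \<equiv> theta_rels GL_inf GL_inf_top"

abbreviation ThetaI :: "('f::{field,finite}, 'x) glset int_mpoly set" where
  "ThetaI \<equiv> theta_ideal GL_inf GL_inf_top"

lemma theta_rels_FC: "ThetaR \<subseteq> (FC :: ('f::{field,finite}, 'x) glset int_mpoly set)"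
  unfolding theta_rels_def Let_def
  by (auto intro!: free_cring_closed FinSets_conj FinSets_fiber)

lemma theta_ideal_ideal:
  "ideal (ThetaI) (free_cring (FinSets :: ('f::{field,finite}, 'x) glset set))"
  unfolding theta_ideal_def
  by (intro ring.genideal_ideal cring.axioms(1) cring_free_cring theta_rels_FC)

lemma theta_rels_ideal: "ThetaR \<subseteq>
    (ThetaI :: ('f::{field,finite}, 'x) glset int_mpoly set)"
  unfolding theta_ideal_def
  by (intro ring.genideal_self cring.axioms(1) cring_free_cring theta_rels_FC)

text \<open>Congruence modulo the relations.  Membership in the free ring is part of the definition, which
makes the congruence closed under products.\<close>

definition theta_eq :: "('f::{field,finite}, 'x) glset int_mpoly \<Rightarrow>
    ('f, 'x) glset int_mpoly \<Rightarrow> bool" (infix "\<approx>" 50) where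
  "x \<approx> y \<longleftrightarrow> x \<in> FC \<and> y \<in> FC \<and> x - y \<in> ThetaI"

lemma theta_ideal_closed:
  fixes x y :: "('f::{field,finite}, 'x) glset int_mpoly"
  shows "0 \<in> (ThetaI :: ('f, 'x) glset int_mpoly set)"
    and "x \<in> ThetaI \<Longrightarrow> y \<in> ThetaI \<Longrightarrow> x + y \<in> ThetaI"
    and "x \<in> ThetaI \<Longrightarrow> y \<in> FC \<Longrightarrow> y * x \<in> ThetaI"
    and "x \<in> ThetaI \<Longrightarrow> - x \<in> ThetaI"
proof -
  interpret ideal "ThetaI" "free_cring (FinSets :: ('f, 'x) glset set)"
    by (rule theta_ideal_ideal)
  show "0 \<in> (ThetaI :: ('f, 'x) glset int_mpoly set)"
    using additive_subgroup.zero_closed[OF additive_subgroup_axioms] by simp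
  show "x + y \<in> ThetaI" if "x \<in> ThetaI" "y \<in> ThetaI"
    using additive_subgroup.a_closed[OF additive_subgroup_axioms that] by simp
  show *: "y * x \<in> ThetaI" if "x \<in> ThetaI" "y \<in> FC" for y
    using I_l_closed[OF that] by simp
  show "- x \<in> ThetaI" if "x \<in> ThetaI"
    using *[OF that free_cring_of_int[of "-1"]] by simp
qed

lemma theta_eq_refl: "x \<in> FC \<Longrightarrow> x \<approx> x"
  by (simp add: theta_eq_def theta_ideal_closed)

lemma theta_eq_sym: "x \<approx> y \<Longrightarrow> y \<approx> x"
  using theta_ideal_closed(4)[of "x - y"] by (simp add: theta_eq_def)

lemma theta_eq_trans [trans]: "x \<approx> y \<Longrightarrow> y \<approx> z \<Longrightarrow> x \<approx> z"
  using theta_ideal_closed(2)[of "x - y" "y - z"] by (simp add: theta_eq_def)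

lemma theta_eq_add: "x \<approx> y \<Longrightarrow> z \<approx> w \<Longrightarrow> x + z \<approx> y + w"
  using theta_ideal_closed(2)[of "x - y" "z - w"] by (simp add: theta_eq_def free_cring_add algebra_simps)

lemma theta_eq_mult:
  assumes "x \<approx> y" "z \<approx> w" shows "x * z \<approx> y * w"
proof -
  have "x * z - y * w = z * (x - y) + y * (z - w)" by (simp add: algebra_simps)
  then show ?thesis
    using assms by (simp add: theta_eq_def free_cring_mult theta_ideal_closed)
qed

lemma theta_eq_sum: "(\<And>i. i \<in> A \<Longrightarrow> f i \<approx> g i) \<Longrightarrow> sum f A \<approx> sum g A"
  by (induction A rule: infinite_finite_induct) (auto intro!: theta_eq_refl theta_eq_add free_cring_zero)

lemma theta_eq_rel: "x - y \<in> ThetaR \<Longrightarrow> x \<in> FC \<Longrightarrow> y \<in> FC \<Longrightarrow> x \<approx> y"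
  using theta_rels_ideal by (auto simp: theta_eq_def)

lemma theta_eq_iso:
  assumes "X \<in> FinSets" "Y \<in> FinSets" "ghat_iso GL_inf GL_inf_top X Y"
  shows "symb X \<approx> symb Y"
  by (rule theta_eq_rel) (use assms in \<open>auto simp: theta_rels_def Let_def intro: free_cring_symb\<close>)

lemma theta_eq_singleton:
  assumes "X \<in> FinSets" "is_singleton (pts X)"
  shows "symb X \<approx> 1"
  by (rule theta_eq_rel) (use assms in \<open>auto simp: theta_rels_def Let_def intro: free_cring_symb\<close>)

lemma theta_eq_coprod:
  assumes "X \<in> FinSets" "Y \<in> FinSets" "Z \<in> FinSets" "ghat_iso GL_inf GL_inf_top Z (gset_coprod X Y)"
  shows "symb Z \<approx> symb X + symb Y"
  by (rule theta_eq_rel) (use assms in \<open>auto simp: theta_rels_def Let_def intro!: free_cring_symb free_cring_add\<close>)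

lemma theta_eq_fiber:
  assumes "X \<in> FinSets" "Y \<in> FinSets" "defgrp X = defgrp Y"
    "transitive_gset GL_inf X" "transitive_gset GL_inf Y" "equivariant_map (defgrp Y) X Y f" "y \<in> pts Y"
  shows "symb X \<approx> symb (gset_fiber GL_inf X Y f y) * symb Y"
proof (rule theta_eq_rel)
  show "symb X - symb (gset_fiber GL_inf X Y f y) * symb Y \<in> ThetaR"
    unfolding theta_rels_def Let_def using assms by blast
qed (use assms in \<open>auto intro!: free_cring_symb free_cring_mult FinSets_fiber\<close>)

subsection \<open>Decomposition into orbits\<close>

lemma theta_eq_restr_Un:
  assumes X: "X \<in> FinSets" and U: "opsub U" "U \<subseteq> defgrp X"
    and P: "P \<subseteq> pts X" "\<And>g x. g \<in> U \<Longrightarrow> x \<in> P \<Longrightarrow> act X g x \<in> P"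
    and Q: "Q \<subseteq> pts X" "\<And>g x. g \<in> U \<Longrightarrow> x \<in> Q \<Longrightarrow> act X g x \<in> Q" and disj: "P \<inter> Q = {}"
  shows "symb (restr U (P \<union> Q) X) \<approx> symb (restr U P X) + symb (restr U Q X)"
proof (rule theta_eq_coprod)
  show "restr U P X \<in> FinSets" by (rule FinSets_restr[OF X U P])
  show "restr U Q X \<in> FinSets" by (rule FinSets_restr[OF X U Q])
  show "restr U (P \<union> Q) X \<in> FinSets" by (rule FinSets_restr[OF X U]) (use P Q in auto)
  let ?f = "\<lambda>x. if x \<in> P then Inl x else Inr x"
  have "act X g x \<notin> P" if "g \<in> U" "x \<in> Q" for g x
    using Q(2)[OF that] disj by blast
  then have "equivariant_map U (restr U (P \<union> Q) X) (gset_coprod (restr U P X) (restr U Q X)) ?f"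
    using P Q disj by (auto simp: equivariant_map_def gset_coprod_def)
  then have "ghat_map GL_inf GL_inf_top (restr U (P \<union> Q) X) (gset_coprod (restr U P X) (restr U Q X)) ?f"
    unfolding ghat_map_def using U by (intro exI[of _ U]) (auto simp: gset_coprod_def)
  moreover have "bij_betw ?f (P \<union> Q) (P <+> Q)"
    by (rule bij_betwI[where g = "case_sum id id"]) (use disj in auto)
  ultimately show "ghat_iso GL_inf GL_inf_top (restr U (P \<union> Q) X) (gset_coprod (restr U P X) (restr U Q X))"
    unfolding ghat_iso_def by (intro exI[of _ ?f]) (simp add: gset_coprod_def)
qed

text \<open>The empty set is the coproduct of two copies of itself.\<close>

lemma theta_eq_restr_empty:
  assumes X: "X \<in> FinSets" and U: "opsub U" "U \<subseteq> defgrp X"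
  shows "symb (restr U {} X) \<approx> 0"
proof -
  let ?s = "symb (restr U {} X)"
  have "?s \<in> FC" by (intro free_cring_symb FinSets_restr[OF X U]) auto
  moreover have "?s \<approx> ?s + ?s" using theta_eq_restr_Un[OF X U, of "{}" "{}"] by simp
  then have "?s - (?s + ?s) \<in> ThetaI" by (simp add: theta_eq_def)
  then have "- ?s \<in> ThetaI" by simp
  from theta_ideal_closed(4)[OF this] have "?s \<in> ThetaI" by simp
  ultimately show ?thesis by (simp add: theta_eq_def free_cring_zero)
qed

lemma theta_eq_restr_Union:
  assumes X: "X \<in> FinSets" and U: "opsub U" "U \<subseteq> defgrp X"
    and "finite \<P>" and "\<And>P. P \<in> \<P> \<Longrightarrow> P \<subseteq> pts X"
    and "\<And>P g x. P \<in> \<P> \<Longrightarrow> g \<in> U \<Longrightarrow> x \<in> P \<Longrightarrow> act X g x \<in> P" and "pairwise disjnt \<P>"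
  shows "symb (restr U (\<Union>\<P>) X) \<approx> (\<Sum>P\<in>\<P>. symb (restr U P X))"
  using assms(4-)
proof (induction \<P> rule: finite_induct)
  case empty
  then show ?case using theta_eq_restr_empty[OF X U] by simp
next
  case (insert P \<P>)
  have disj: "P \<inter> \<Union>\<P> = {}"
    using insert.prems(3) insert.hyps(2) by (auto simp: pairwise_insert disjnt_def)
  have "symb (restr U (P \<union> \<Union>\<P>) X) \<approx> symb (restr U P X) + symb (restr U (\<Union>\<P>) X)"
  proof (rule theta_eq_restr_Un[OF X U _ _ _ _ disj])
    show "P \<subseteq> pts X" "\<Union>\<P> \<subseteq> pts X" using insert.prems(1) by blast+
    show "act X g x \<in> P" if "g \<in> U" "x \<in> P" for g x using insert.prems(2) that by blast
    show "act X g x \<in> \<Union>\<P>" if "g \<in> U" "x \<in> \<Union>\<P>" for g x using insert.prems(2) that by blast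
  qed
  also have "\<dots> \<approx> symb (restr U P X) + (\<Sum>P\<in>\<P>. symb (restr U P X))"
  proof (rule theta_eq_add[OF theta_eq_refl insert.IH])
    show "symb (restr U P X) \<in> FC" by (intro free_cring_symb FinSets_restr[OF X U]) (use insert.prems(1,2) in blast)+
    show "pairwise disjnt \<P>" using insert.prems(3) by (simp add: pairwise_insert)
  qed (use insert.prems(1,2) in blast)+
  finally show ?case using insert.hyps by simp
qed

lemma theta_eq_restrict_group:
  assumes X: "X \<in> FinSets" and U: "opsub U" "U \<subseteq> defgrp X"
  shows "symb X \<approx> symb (restr U (pts X) X)"
proof (rule theta_eq_iso[OF X])
  note sX = FinSetsD[OF X]
  show "restr U (pts X) X \<in> FinSets"
    by (rule FinSets_restr[OF X U]) (use smoothD(2)[OF sX] U in auto)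
  have "equivariant_map U X (restr U (pts X) X) id" by (auto simp: equivariant_map_def)
  then have "ghat_map GL_inf GL_inf_top X (restr U (pts X) X) id"
    unfolding ghat_map_def using U by (intro exI[of _ U]) auto
  then show "ghat_iso GL_inf GL_inf_top X (restr U (pts X) X)"
    unfolding ghat_iso_def by (intro exI[of _ id]) simp
qed

text \<open>The group \<open>U\<close> may be any open subgroup of the group of definition; it still has finitely many orbits.\<close>

lemma theta_eq_orbits:
  assumes X: "X \<in> FinSets" and U: "opsub U" "U \<subseteq> defgrp X"
  shows "symb X \<approx> (\<Sum>P \<in> orb (act X) U ` pts X. symb (restr U P X))"
proof -
  note sX = FinSetsD[OF X]
  have "\<Union>(orb (act X) U ` pts X) = pts X"
    using orb_subset[OF sX U(2)] orb_self[OF sX U(1)] by blast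
  moreover have "act X g x \<in> P" if P: "P \<in> orb (act X) U ` pts X" and g: "g \<in> U" and x: "x \<in> P" for P g x
  proof -
    obtain y where y: "y \<in> pts X" "P = orb (act X) U y" using P by blast
    have "orb (act X) U x = P" using orb_eq[OF sX U y(1)] x y by simp
    then show ?thesis using g by (auto simp: orb_def)
  qed
  ultimately have "symb (restr U (pts X) X) \<approx> (\<Sum>P \<in> orb (act X) U ` pts X. symb (restr U P X))"
    using theta_eq_restr_Union[OF X U finite_orbits[OF X U] _ _ orb_disjoint[OF sX U]] orb_subset[OF sX U(2)]
    by fastforce
  with theta_eq_restrict_group[OF X U] show ?thesis by (rule theta_eq_trans)
qed

lemma FinSets_orbit:
  assumes X: "X \<in> FinSets" and U: "opsub U" "U \<subseteq> defgrp X" and P: "P \<in> orb (act X) U ` pts X"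
  shows "restr U P X \<in> FinSets" "transitive_gset GL_inf (restr U P X)"
proof -
  note sX = FinSetsD[OF X]
  obtain y where y: "y \<in> pts X" "P = orb (act X) U y" using P by blast
  have P': "P \<subseteq> pts X" using orb_subset[OF sX U(2) y(1)] y by simp
  have PP: "orb (act X) U x = P" if "x \<in> P" for x using orb_eq[OF sX U y(1)] that y by simp
  show F: "restr U P X \<in> FinSets"
    by (rule FinSets_restr[OF X U P']) (use PP in \<open>auto simp: orb_def\<close>)
  have "P \<noteq> {}" using orb_self[OF sX U(1) y(1)] y by blast
  moreover have "\<exists>g \<in> U. act X g x = z" if "x \<in> P" "z \<in> P" for x z
    using PP[OF that(1)] that(2) by (auto simp: orb_def)
  ultimately show "transitive_gset GL_inf (restr U P X)"
    using transitive_gset_iff[OF FinSetsD[OF F]] by auto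
qed

text \<open>A small enough group acts trivially on a finite set, and then the orbits are singletons.\<close>

lemma theta_eq_card:
  fixes X :: "('f::{field,finite}, 'x) glset"
  assumes X: "X \<in> FinSets" and fin: "finite (pts X)"
  shows "symb X \<approx> of_nat (card (pts X))"
proof -
  note sX = FinSetsD[OF X]
  have "\<forall>\<^sub>F n in sequentially. \<forall>x \<in> pts X. \<forall>u \<in> Ufix n. act X u x = x"
    using fin smoothD(5)[OF sX] by (intro eventually_ball_finite) auto
  with opsubD(6)[OF smoothD(1)[OF sX]]
  have "\<forall>\<^sub>F n in sequentially. Ufix n \<subseteq> defgrp X \<and> (\<forall>x \<in> pts X. \<forall>u \<in> Ufix n. act X u x = x)"
    by (rule eventually_conj)
  then obtain n where n: "Ufix n \<subseteq> defgrp X" "\<And>x u. x \<in> pts X \<Longrightarrow> u \<in> Ufix n \<Longrightarrow> act X u x = x"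
    by (auto dest: eventually_happens)
  have orb: "orb (act X) (Ufix n) x = {x}" if "x \<in> pts X" for x
    using n(2)[OF that] opsubD(3)[OF opsub_Ufix[of n]] by (auto simp: orb_def)
  have "symb X \<approx> (\<Sum>P \<in> orb (act X) (Ufix n) ` pts X. symb (restr (Ufix n) P X))"
    by (rule theta_eq_orbits[OF X opsub_Ufix n(1)])
  also have "\<dots> \<approx> (\<Sum>P \<in> orb (act X) (Ufix n) ` pts X. 1)"
  proof (rule theta_eq_sum, rule theta_eq_singleton)
    fix P assume P: "P \<in> orb (act X) (Ufix n) ` pts X"
    show "restr (Ufix n) P X \<in> FinSets" by (rule FinSets_orbit[OF X opsub_Ufix n(1) P])
    show "is_singleton (pts (restr (Ufix n) P X))" using P orb by (auto simp: is_singleton_def)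
  qed
  also have "orb (act X) (Ufix n) ` pts X = (\<lambda>x. {x}) ` pts X" using orb by (intro image_cong) auto
  also have "(\<Sum>P \<in> (\<lambda>x. {x}) ` pts X. 1) = of_nat (card (pts X))" by (simp add: card_image)
  finally show ?thesis .
qed

text \<open>Let \<open>A\<close> be the stabilizer of a point \<open>y\<close> of \<open>Y\<close>.  For an \<open>A\<close>-orbit \<open>P\<close> of \<open>X\<close> and \<open>x\<close> in \<open>P\<close>, let
\<open>Z P\<close> be the \<open>U\<close>-orbit of \<open>(x, y)\<close> in the product.  Its projection to \<open>Y\<close> has fiber \<open>P\<close> over \<open>y\<close>, so
its class is the class of \<open>P\<close> times the class of \<open>Y\<close>.  Summing over \<open>P\<close> gives the product of the
classes of \<open>X\<close> and \<open>Y\<close>, because \<open>X\<close> is the union of the \<open>P\<close> as an \<open>A\<close>-set.  The points of \<open>Z P\<close> must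
again have the type of the points of \<open>X\<close>, so pairs are encoded by an injection \<open>enc\<close>.\<close>

lemma theta_eq_times:
  fixes X Y :: "('f::{field,finite}, 'x) glset" and enc :: "'x \<times> 'x \<Rightarrow> 'x"
  assumes enc: "inj enc"
    and X: "X \<in> FinSets" "defgrp X = U" and Y: "Y \<in> FinSets" "defgrp Y = U" and trY: "transitive_gset GL_inf Y"
  shows "\<exists>\<P> Z. finite \<P> \<and> (\<forall>P \<in> \<P>. Z P \<in> FinSets \<and> defgrp (Z P) = U) \<and>
           symb X * symb Y \<approx> (\<Sum>P \<in> (\<P> :: 'x set set). symb (Z P))"
proof -
  note sX = FinSetsD[OF X(1)] and sY = FinSetsD[OF Y(1)]
  have U: "opsub U" using smoothD(1)[OF sX] X by simp
  note oU = opsubD[OF U]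
  obtain y where y: "y \<in> pts Y" using trY by (auto simp: transitive_gset_def)
  define A where "A = stabilizer (GL_inf\<lparr>carrier := defgrp Y\<rparr>) (act Y) y"
  have A_iff: "g \<in> A \<longleftrightarrow> g \<in> U \<and> act Y g y = y" for g by (simp add: A_def stabilizer_iff Y)
  have A: "opsub A" unfolding A_def by (rule opsub_stabilizer[OF sY y])
  have AU: "A \<subseteq> U" by (auto simp: A_iff)
  note oA = opsubD[OF A]
  define \<P> where "\<P> = orb (act X) A ` pts X"
  define dec where "dec = inv_into UNIV enc"
  have dec [simp]: "dec (enc p) = p" for p using enc by (simp add: dec_def)
  define pr where "pr P = (SOME x. x \<in> P)" for P :: "'x set"
  define Q where "Q P = (\<lambda>g. enc (act X g (pr P), act Y g y)) ` U" for P
  define Z :: "'x set \<Rightarrow> ('f, 'x) glset" where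
    "Z P = \<lparr>defgrp = U, pts = Q P,
            act = (\<lambda>g. \<lambda>z \<in> Q P. enc (act X g (fst (dec z)), act Y g (snd (dec z))))\<rparr>" for P
  have Zs: "defgrp (Z P) = U" "pts (Z P) = Q P"
    "\<And>g. act (Z P) g = (\<lambda>z \<in> Q P. enc (act X g (fst (dec z)), act Y g (snd (dec z))))" for P
    by (simp_all add: Z_def)
  have P: "Z P \<in> FinSets \<and> symb (restr A P X) * symb Y \<approx> symb (Z P)" if P: "P \<in> \<P>" for P
  proof -
    define x where "x = pr P"
    obtain x0 where x0: "x0 \<in> pts X" "P = orb (act X) A x0" using P by (auto simp: \<P>_def)
    have "x0 \<in> P" using orb_self[OF sX A x0(1)] x0 by simp
    then have xP: "x \<in> P" unfolding x_def pr_def by (metis someI)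
    have AX: "A \<subseteq> defgrp X" using AU X by simp
    have Px: "P = orb (act X) A x" using orb_eq[OF sX A AX x0(1)] xP x0 by simp
    have x: "x \<in> pts X" using xP orb_subset[OF sX AX x0(1)] x0 by blast
    have xU: "act X g x \<in> pts X" "act Y g y \<in> pts Y" if "g \<in> U" for g
      using smoothD(2)[OF sX, of g x] smoothD(2)[OF sY, of g y] that x y X Y by auto
    have QP: "Q P = (\<lambda>g. enc (act X g x, act Y g y)) ` U" by (simp add: Q_def x_def)
    have comp: "act X g (act X h x) = act X (g \<circ> h) x" "act Y g (act Y h y) = act Y (g \<circ> h) y"
      if "g \<in> U" "h \<in> U" for g h
      using smoothD(4)[OF sX, of g h x] smoothD(4)[OF sY, of g h y] that x y X Y by auto
    have actZ: "act (Z P) g (enc (act X h x, act Y h y)) = enc (act X (g \<circ> h) x, act Y (g \<circ> h) y)"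
      if "g \<in> U" "h \<in> U" for g h
      unfolding Zs using that by (simp add: QP comp)
    have base: "enc (x, y) \<in> Q P"
      unfolding QP by (rule image_eqI[of _ _ id]) (use smoothD(3)[OF sX x] smoothD(3)[OF sY y] oU in auto)
    have smZ: "smooth (Z P)"
      unfolding smooth_iff Zs(1,2)
    proof (intro conjI ballI U)
      fix g assume g: "g \<in> U"
      show "act (Z P) g \<in> extensional (Q P)" by (simp add: Zs)
      fix z assume "z \<in> Q P"
      then obtain h where h: "h \<in> U" "z = enc (act X h x, act Y h y)" by (auto simp: QP)
      show "act (Z P) g z \<in> Q P" using actZ[OF g h(1)] h oU(4)[OF g h(1)] by (auto simp: QP)
      fix g' assume g': "g' \<in> U"
      show "act (Z P) (g \<circ> g') z = act (Z P) g (act (Z P) g' z)"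
        using actZ[OF g' h(1)] actZ[OF g oU(4)[OF g' h(1)]] actZ[OF oU(4)[OF g g'] h(1)] h(2)
        by (simp add: comp_assoc)
    next
      fix z assume "z \<in> Q P"
      then obtain h where h: "h \<in> U" "z = enc (act X h x, act Y h y)" by (auto simp: QP)
      show "act (Z P) id z = z" using actZ[OF oU(3) h(1)] h(2) by simp
      show "\<forall>\<^sub>F n in sequentially. \<forall>u \<in> Ufix n. act (Z P) u z = z"
        using smoothD(5)[OF sX xU(1)[OF h(1)]] smoothD(5)[OF sY xU(2)[OF h(1)]]
        by eventually_elim (use h in \<open>simp add: Zs QP\<close>)
    qed
    have tr: "\<exists>g \<in> U. act (Z P) g z = w" if zw: "z \<in> Q P" "w \<in> Q P" for z w
    proof -
      obtain h k where h: "h \<in> U" "z = enc (act X h x, act Y h y)" and k: "k \<in> U" "w = enc (act X k x, act Y k y)"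
        using zw unfolding QP by blast
      have gU: "k \<circ> ginv h \<in> U" using oU(4)[OF k(1) oU(5)[OF h(1)]] .
      have hG: "h \<in> carrier GL_inf" using h oU by blast
      have "k \<circ> ginv h \<circ> h = k" using hG by (simp add: fun_eq_iff)
      then show ?thesis using actZ[OF gU h(1)] gU h(2) k(2) by auto
    qed
    have trZ: "transitive_gset GL_inf (Z P)"
      unfolding transitive_gset_iff[OF smZ] Zs(1,2) using tr base by blast
    have finZ: "Z P \<in> FinSets"
    proof -
      have "orb (act (Z P)) U z = Q P" if "z \<in> Q P" for z
      proof (rule equalityI)
        show "orb (act (Z P)) U z \<subseteq> Q P" using orb_subset[OF smZ, of U z] that by (simp add: Zs(1,2))
        show "Q P \<subseteq> orb (act (Z P)) U z"
        proof
          fix w assume "w \<in> Q P"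
          from tr[OF that this] show "w \<in> orb (act (Z P)) U z" unfolding orb_def by blast
        qed
      qed
      then have "orb (act (Z P)) U ` Q P \<subseteq> {Q P}" by blast
      then show ?thesis using smZ finite_subset by (auto simp: finitary_ghat_sets_def finitary_iff Zs(1,2))
    qed
    define f where "f = (\<lambda>z. snd (dec z))"
    have eqf: "equivariant_map (defgrp Y) (Z P) Y f"
      unfolding equivariant_map_def Zs(1,2) Y(2) f_def
    proof (intro conjI ballI funcsetI)
      fix z assume "z \<in> Q P"
      then obtain h where h: "h \<in> U" "z = enc (act X h x, act Y h y)" by (auto simp: QP)
      show "snd (dec z) \<in> pts Y" using h xU by simp
      fix g assume g: "g \<in> U"
      show "snd (dec (act (Z P) g z)) = act Y g (snd (dec z))"
        using actZ[OF g h(1)] h comp[OF g h(1)] by simp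
    qed
    have fib: "symb (Z P) \<approx> symb (gset_fiber GL_inf (Z P) Y f y) * symb Y"
      by (rule theta_eq_fiber) (use finZ Y trZ trY eqf y Zs in auto)
    let ?F = "{z \<in> Q P. f z = y}"
    have F: "?F = (\<lambda>x'. enc (x', y)) ` P"
    proof -
      have "?F = (\<lambda>g. enc (act X g x, y)) ` A" (is "_ = ?R")
      proof (intro equalityI subsetI)
        fix z assume "z \<in> ?F"
        then obtain g where g: "g \<in> U" "z = enc (act X g x, act Y g y)" "f z = y" by (auto simp: QP)
        then have "act Y g y = y" by (simp add: f_def)
        then show "z \<in> ?R" using g A_iff by (intro image_eqI[of _ _ g]) auto
      next
        fix z assume "z \<in> ?R"
        then obtain g where g: "g \<in> U" "act Y g y = y" "z = enc (act X g x, y)" by (auto simp: A_iff)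
        then have "z \<in> Q P" unfolding QP by (intro image_eqI[of _ _ g]) auto
        then show "z \<in> ?F" using g by (simp add: f_def)
      qed
      also have "\<dots> = (\<lambda>x'. enc (x', y)) ` orb (act X) A x" by (simp add: orb_def image_image)
      finally show ?thesis by (simp only: Px[symmetric])
    qed
    have gf: "gset_fiber GL_inf (Z P) Y f y = restr A ?F (Z P)"
      by (simp add: gset_fiber_restr A_def Zs)
    have finF: "restr A ?F (Z P) \<in> FinSets"
      using FinSets_fiber[OF finZ Y(1) _ eqf y] gf Zs(1) Y(2) by simp
    have finP: "restr A P X \<in> FinSets"
      by (rule FinSets_orbit[OF X(1) A AX]) (use P \<P>_def in simp)
    have closP: "act X g x' \<in> P" if "g \<in> A" "x' \<in> P" for g x'
    proof -
      have "orb (act X) A x' = P" using orb_eq[OF sX A AX x0(1)] that x0 by simp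
      then show ?thesis using that by (auto simp: orb_def)
    qed
    have "symb (restr A P X) \<approx> symb (restr A ?F (Z P))"
    proof (rule theta_eq_iso[OF finP finF])
      let ?e = "\<lambda>x'. enc (x', y)"
      have eF: "?e x' \<in> ?F" "?e x' \<in> Q P" if "x' \<in> P" for x' using F that by auto
      have "equivariant_map A (restr A P X) (restr A ?F (Z P)) ?e"
        unfolding equivariant_map_def
      proof (intro conjI ballI funcsetI)
        fix x' assume "x' \<in> pts (restr A P X)"
        then have x': "x' \<in> P" by simp
        then show "?e x' \<in> pts (restr A ?F (Z P))" using eF by simp
        fix g assume g: "g \<in> A"
        show "?e (act (restr A P X) g x') = act (restr A ?F (Z P)) g (?e x')"
          using x' eF[OF x'] g by (simp add: Zs A_iff)
      qed
      then have "ghat_map GL_inf GL_inf_top (restr A P X) (restr A ?F (Z P)) ?e"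
        unfolding ghat_map_def using A by (intro exI[of _ A]) auto
      moreover have "bij_betw ?e P ?F"
        unfolding F bij_betw_def by (intro conjI inj_onI refl) (drule injD[OF enc], simp)
      ultimately show "ghat_iso GL_inf GL_inf_top (restr A P X) (restr A ?F (Z P))"
        unfolding ghat_iso_def by (intro exI[of _ ?e]) simp
    qed
    then have "symb (restr A P X) * symb Y \<approx> symb (restr A ?F (Z P)) * symb Y"
      by (rule theta_eq_mult[OF _ theta_eq_refl[OF free_cring_symb[OF Y(1)]]])
    also have "\<dots> \<approx> symb (Z P)"
      by (rule theta_eq_sym) (use fib in \<open>simp only: gf\<close>)
    finally have "symb (restr A P X) * symb Y \<approx> symb (Z P)" .
    with finZ show ?thesis by simp
  qed
  have "finite \<P>" unfolding \<P>_def by (rule finite_orbits[OF X(1) A]) (use AU X in simp)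
  moreover have "symb X * symb Y \<approx> (\<Sum>P \<in> \<P>. symb (Z P))"
  proof -
    have "symb X \<approx> (\<Sum>P \<in> \<P>. symb (restr A P X))"
      unfolding \<P>_def by (rule theta_eq_orbits[OF X(1) A]) (use AU X in simp)
    from theta_eq_mult[OF this theta_eq_refl[OF free_cring_symb[OF Y(1)]]]
    have "symb X * symb Y \<approx> (\<Sum>P \<in> \<P>. symb (restr A P X) * symb Y)" by (simp add: sum_distrib_right)
    also have "\<dots> \<approx> (\<Sum>P \<in> \<P>. symb (Z P))" using P by (intro theta_eq_sum) blast
    finally show ?thesis .
  qed
  ultimately show ?thesis using P Zs(1) by (intro exI[of _ \<P>] exI[of _ Z]) auto
qed

section \<open>The sets \<open>\<Omega>\<^sub>m\<^sub>,\<^sub>d\<close> span \<open>\<Theta>(G)\<close>\<close>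

lemma Omega_pts_iff:
  fixes W :: "'f::{field,finite} fsv set"
  shows "W \<in> Omega_pts m d \<longleftrightarrow> finsub W \<and> Vn m \<subseteq> W \<and> card W = card (UNIV :: 'f set) ^ (d + m)"
proof
  assume W: "W \<in> Omega_pts m d"
  then have "finite W" using finite_span by (auto simp: Omega_pts_def)
  then show "finsub W \<and> Vn m \<subseteq> W \<and> card W = card (UNIV :: 'f set) ^ (d + m)"
    using W card_subspace[of W] by (auto simp: Omega_pts_def)
next
  assume W: "finsub W \<and> Vn m \<subseteq> W \<and> card W = card (UNIV :: 'f set) ^ (d + m)"
  then have "card (UNIV :: 'f set) ^ V.dim W = card (UNIV :: 'f set) ^ (d + m)"
    using card_subspace[of W] by simp
  then have "V.dim W = d + m" using card_field_gt_1[where 'f = 'f] by simp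
  moreover have "W = V.span W" using W by (simp only: V.span_eq_iff[of W, THEN iffD2])
  then have "\<exists>B. finite B \<and> W = V.span B" using W by blast
  ultimately show "W \<in> Omega_pts m d" using W by (simp add: Omega_pts_def)
qed

lemma Omega_simps [simp]:
  "defgrp (Omega m d) = Ufix m" "pts (Omega m d) = Omega_pts m d"
  "act (Omega m d) g = (\<lambda>W \<in> Omega_pts m d. g ` W)"
  by (simp_all add: Omega_def)

lemma image_Omega_pts:
  fixes W :: "'f::{field,finite} fsv set"
  assumes "g \<in> Ufix m" "W \<in> Omega_pts m d" shows "g ` W \<in> Omega_pts m d"
proof -
  have gG: "g \<in> carrier GL_inf" and fixed: "\<forall>v \<in> Vn m. g v = v" using assms(1) by (auto simp: pointwise_stab_iff)
  have "finsub (g ` W)" using subspace_image_GL[OF gG] assms(2) by (simp add: Omega_pts_iff)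
  moreover have "Vn m \<subseteq> g ` W" using fixed assms(2) by (force simp: Omega_pts_iff)
  moreover have "card (g ` W) = card W"
    using GL_bij[OF gG] by (intro card_image inj_on_subset[OF bij_is_inj]) auto
  ultimately show ?thesis using assms(2) by (simp add: Omega_pts_iff)
qed

lemma smooth_Omega: "smooth (Omega m d)"
  unfolding smooth_iff Omega_simps
proof (intro conjI ballI opsub_Ufix)
  fix g h :: "'a vmap" and W :: "'a fsv set"
  assume "g \<in> Ufix m" "h \<in> Ufix m" "W \<in> Omega_pts m d"
  then show "restrict ((`) (g \<circ> h)) (Omega_pts m d) W =
      restrict ((`) g) (Omega_pts m d) (restrict ((`) h) (Omega_pts m d) W)"
    by (simp add: image_Omega_pts image_comp)
next
  fix W :: "'a fsv set" assume W: "W \<in> Omega_pts m d"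
  then have "\<forall>\<^sub>F n in sequentially. W \<subseteq> Vn n" by (intro finite_subset_Vn) (simp add: Omega_pts_iff)
  then show "\<forall>\<^sub>F n in sequentially. \<forall>u\<in>Ufix n. restrict ((`) u) (Omega_pts m d) W = W"
  proof eventually_elim
    case (elim n)
    have "u ` W = W" if "u \<in> Ufix n" for u
    proof -
      have "u ` W = id ` W" using that elim by (intro image_cong) (auto simp: pointwise_stab_iff)
      then show ?thesis by simp
    qed
    then show ?case using W by simp
  qed
qed (auto simp: image_Omega_pts)

text \<open>Extend a basis of \<open>V\<^sub>m\<close> to bases of \<open>W\<close> and \<open>W'\<close> and match the new vectors.\<close>

lemma Ufix_transitive_Omega:
  fixes W W' :: "'f::{field,finite} fsv set"
  assumes "W \<in> Omega_pts m d" "W' \<in> Omega_pts m d"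
  obtains g where "g \<in> Ufix m" "g ` W = W'"
proof -
  have W: "finsub W" "Vn m \<subseteq> W" and W': "finsub W'" "Vn m \<subseteq> W'" and card: "card W = card W'"
    using assms by (auto simp: Omega_pts_iff)
  obtain B0 :: "'f fsv set" where B0: "B0 \<subseteq> Vn m" "V.independent B0" "Vn m \<subseteq> V.span B0"
    using V.maximal_independent_subset by blast
  obtain B where B: "B0 \<subseteq> B" "B \<subseteq> W" "V.independent B" "W \<subseteq> V.span B"
    using V.maximal_independent_subset_extend[OF _ B0(2), of W] B0(1) W(2) by blast
  obtain B' where B': "B0 \<subseteq> B'" "B' \<subseteq> W'" "V.independent B'" "W' \<subseteq> V.span B'"
    using V.maximal_independent_subset_extend[OF _ B0(2), of W'] B0(1) W'(2) by blast
  have sp: "V.span B = W" "V.span B' = W'" "V.span B0 = Vn m"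
    using B B' B0 W W' V.span_minimal Vn_subspace by (metis subset_antisym)+
  have fin: "finite B" "finite B'" using B(2) B'(2) W W' finite_subset by blast+
  have "card (UNIV :: 'f set) ^ card B = card (UNIV :: 'f set) ^ card B'"
    using card_span_independent[OF fin(1) B(3)] card_span_independent[OF fin(2) B'(3)] sp card by simp
  then have "card B = card B'" using card_field_gt_1[where 'f = 'f] by simp
  then have "card (B - B0) = card (B' - B0)"
    using B(1) B'(1) fin by (simp add: card_Diff_subset finite_subset)
  then obtain k where k: "bij_betw k (B - B0) (B' - B0)"
    using finite_same_card_bij fin by blast
  obtain F where F: "linmap F" "\<forall>c \<in> B. F c = (if c \<in> B0 then c else k c)"
    using VV.linear_independent_extend[OF B(3), of "\<lambda>c. if c \<in> B0 then c else k c"] by blast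
  have "F ` B = F ` B0 \<union> F ` (B - B0)" using B(1) by blast
  also have "F ` B0 = id ` B0" using F(2) B(1) by (intro image_cong) auto
  also have "F ` (B - B0) = k ` (B - B0)" using F(2) by (intro image_cong) auto
  also have "k ` (B - B0) = B' - B0" using k by (simp add: bij_betw_def)
  finally have "F ` B = B'" using B'(1) by auto
  then have FW: "F ` W = W'" using sp VV.linear_span_image[OF F(1), of B] by simp
  then have inj: "inj_on F W" using W(1) card by (intro eq_card_imp_inj_on) auto
  have fixed: "F v = v" if "v \<in> Vn m" for v
  proof (rule VV.linear_eq_on[OF F(1) V.linear_id, of v B0, unfolded id_apply])
    show "v \<in> V.span B0" using that sp by simp
  qed (use F B in auto)
  obtain u where u: "u \<in> Ufix m" "\<forall>e \<in> W. u e = F e"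
  proof (rule pointwise_stab_extend[OF F(1) inj, of "Vn m"])
    fix e assume e: "e \<in> W" "e \<in> Vn m \<or> F e \<in> Vn m"
    show "F e = e"
    proof (cases "e \<in> Vn m")
      case False
      then have "F e \<in> Vn m" using e by blast
      then have "F (F e) = F e" "F e \<in> W" using fixed W(2) by auto
      then show ?thesis using inj e(1) by (auto dest: inj_onD)
    qed (rule fixed)
  qed (use W in auto)
  have "u ` W = F ` W" using u(2) by (intro image_cong) auto
  with FW show thesis by (intro that[OF u(1)]) simp
qed

lemma transitive_Omega: "transitive_gset GL_inf (Omega m d :: ('f::{field,finite}, 'f fsv set) glset)"
  unfolding transitive_gset_iff[OF smooth_Omega] Omega_simps
proof (intro conjI ballI)
  have "(Vn (d + m) :: 'f fsv set) \<in> Omega_pts m d"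
    by (simp add: Omega_pts_iff card_Vn Vn_mono)
  then show "Omega_pts m d \<noteq> ({} :: 'f fsv set set)" by blast
  fix W W' :: "'f fsv set" assume WW: "W \<in> Omega_pts m d" "W' \<in> Omega_pts m d"
  obtain g where "g \<in> Ufix m" "g ` W = W'" by (rule Ufix_transitive_Omega[OF WW])
  then show "\<exists>g \<in> Ufix m. restrict ((`) g) (Omega_pts m d) W = W'" using WW by auto
qed

lemma transitive_finitary:
  assumes "smooth X" "transitive_gset GL_inf X" shows "X \<in> FinSets"
proof -
  have tr: "\<forall>x \<in> pts X. \<forall>y \<in> pts X. \<exists>g \<in> defgrp X. act X g x = y"
    using assms(2) unfolding transitive_gset_iff[OF assms(1)] by (rule conjunct2)
  have "orb (act X) (defgrp X) x = pts X" if "x \<in> pts X" for x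
  proof (rule equalityI)
    show "orb (act X) (defgrp X) x \<subseteq> pts X" using orb_subset[OF assms(1) order_refl that] .
    show "pts X \<subseteq> orb (act X) (defgrp X) x"
    proof
      fix y assume "y \<in> pts X"
      from tr[rule_format, OF that this] obtain g where "g \<in> defgrp X" "act X g x = y" ..
      then show "y \<in> orb (act X) (defgrp X) x" by (auto simp: orb_def)
    qed
  qed
  then have "orb (act X) (defgrp X) ` pts X \<subseteq> {pts X}" by blast
  then show ?thesis using assms(1) finite_subset by (auto simp: finitary_ghat_sets_def finitary_iff)
qed

lemma FinSets_Omega: "Omega m d \<in> FinSets"
  by (rule transitive_finitary[OF smooth_Omega transitive_Omega])

text \<open>Let \<open>A\<close> be the stabilizer of a point \<open>x\<close> and \<open>W\<close> its least support.  Since \<open>A\<close> preserves \<open>W\<close>, the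
map \<open>g x \<mapsto> g W\<close> is well defined.  It goes to \<open>\<Omega>\<^sub>m\<^sub>,\<^sub>d\<close> with \<open>d = dim W - m\<close>.  Its fiber over
\<open>W\<close> is finite because \<open>g x\<close> depends only on the restriction of \<open>g\<close> to \<open>W\<close>: elements that agree on
\<open>W\<close> differ by an element of \<open>A\<close>.\<close>

lemma theta_eq_transitive:
  fixes X :: "('f::{field,finite}, 'f fsv set) glset"
  assumes X: "X \<in> FinSets" "defgrp X = Ufix m" and tr: "transitive_gset GL_inf X"
  shows "\<exists>k d. symb X \<approx> of_nat k * symb (Omega m d)"
proof -
  note sX = FinSetsD[OF X(1)]
  obtain x where x: "x \<in> pts X" using tr by (auto simp: transitive_gset_def)
  define A where "A = stabilizer (GL_inf\<lparr>carrier := defgrp X\<rparr>) (act X) x"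
  have A: "opsub A" unfolding A_def by (rule opsub_stabilizer[OF sX x])
  have A_iff: "g \<in> A \<longleftrightarrow> g \<in> Ufix m \<and> act X g x = x" for g by (simp add: A_def stabilizer_iff X)
  have subA: "subgroup A GL_inf" using opsubD[OF A] by blast
  obtain n where "Ufix n \<subseteq> A" using opsubD(6)[OF A] by (auto dest: eventually_happens)
  then obtain W where W: "supports W A" by (rule least_support_exists[OF subA])
  have finW: "finsub W" and WA: "pointwise_stab W \<subseteq> A" using W by (auto simp: supports_def)
  \<comment> \<open>\<open>A\<close> is a subgroup of \<open>U\<^sub>m\<close>, and a subspace contains all vectors fixed by its pointwise stabilizer.\<close>
  have "pointwise_stab W \<subseteq> Ufix m" using WA by (auto simp: A_iff)
  then have mW: "Vn m \<subseteq> W" by (rule pointwise_stab_fixed[OF finW])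
  have dim: "card W = card (UNIV :: 'f set) ^ V.dim W" using card_subspace finW by blast
  have "card (UNIV :: 'f set) ^ m \<le> card (UNIV :: 'f set) ^ V.dim W"
    using card_mono[OF conjunct2[OF finW] mW] by (simp add: dim card_Vn)
  then have "m \<le> V.dim W" using card_field_gt_1[where 'f = 'f] by simp
  define d where "d = V.dim W - m"
  have WO: "W \<in> Omega_pts m d" using finW mW dim \<open>m \<le> V.dim W\<close> by (simp add: Omega_pts_iff d_def)
  have actX: "\<exists>g \<in> Ufix m. y = act X g x" if "y \<in> pts X" for y
    using tr x that unfolding transitive_gset_iff[OF sX] X(2) by metis
  have well: "g ` W = h ` W" if g: "g \<in> Ufix m" and h: "h \<in> Ufix m" and eq: "act X g x = act X h x" for g h
  proof -
    have hG: "h \<in> carrier GL_inf" using h by (simp add: pointwise_stab_iff)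
    have hi: "ginv h \<in> Ufix m" using opsubD(5)[OF opsub_Ufix h] .
    have "act X (ginv h \<circ> g) x = x"
      using smoothD(4)[OF sX, of "ginv h" g x] act_inv(1)[OF sX, of h x] g h hi x X eq by simp
    then have "ginv h \<circ> g \<in> A" using opsubD(4)[OF opsub_Ufix hi g] by (simp add: A_iff)
    then have "(ginv h \<circ> g) ` W = W" by (rule supports_invariant[OF subA W])
    then have "h ` ((ginv h \<circ> g) ` W) = h ` W" by simp
    then show ?thesis using hG by (simp add: image_image)
  qed
  define f where "f y = (SOME g. g \<in> Ufix m \<and> y = act X g x) ` W" for y
  have f: "f (act X g x) = g ` W" if g: "g \<in> Ufix m" for g
  proof -
    have "(SOME h. h \<in> Ufix m \<and> act X g x = act X h x) \<in> Ufix m \<and>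
        act X g x = act X (SOME h. h \<in> Ufix m \<and> act X g x = act X h x) x"
      by (rule someI[of "\<lambda>h. h \<in> Ufix m \<and> act X g x = act X h x" g]) (use g in simp)
    from well[OF g conjunct1[OF this] conjunct2[OF this]] show ?thesis unfolding f_def by (rule sym)
  qed
  have eqf: "equivariant_map (defgrp (Omega m d)) X (Omega m d) f"
    unfolding equivariant_map_def Omega_simps
  proof (intro conjI ballI funcsetI)
    fix y assume "y \<in> pts X"
    then obtain g where g: "g \<in> Ufix m" "y = act X g x" using actX by blast
    show fy: "f y \<in> Omega_pts m d" using f[OF g(1)] g image_Omega_pts[OF g(1) WO] by simp
    fix h :: "'f vmap" assume h: "h \<in> Ufix m"
    have "act X h y = act X (h \<circ> g) x" using smoothD(4)[OF sX, of h g x] h g x X by simp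
    then show "f (act X h y) = restrict ((`) h) (Omega_pts m d) (f y)"
      using f[OF opsubD(4)[OF opsub_Ufix h g(1)]] f[OF g(1)] g(2) fy by (simp add: image_comp)
  qed
  let ?F = "gset_fiber GL_inf X (Omega m d) f W"
  have "symb X \<approx> symb ?F * symb (Omega m d)"
    by (rule theta_eq_fiber[OF X(1) FinSets_Omega _ tr transitive_Omega eqf]) (use X WO in auto)
  also have "\<dots> \<approx> of_nat (card (pts ?F)) * symb (Omega m d)"
  proof (rule theta_eq_mult[OF theta_eq_card theta_eq_refl])
    show "?F \<in> FinSets" by (rule FinSets_fiber[OF X(1) FinSets_Omega _ eqf]) (use X WO in auto)
    let ?K = "{g \<in> Ufix m. g ` W = W}"
    have pts: "pts ?F \<subseteq> (\<lambda>g. act X g x) ` ?K"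
    proof
      fix y assume "y \<in> pts ?F"
      then have y: "y \<in> pts X" "f y = W" by (auto simp: gset_fiber_restr)
      from actX[OF y(1)] obtain g where g: "g \<in> Ufix m" "y = act X g x" ..
      then have "g \<in> ?K" using f[OF g(1)] y(2) by simp
      with g(2) show "y \<in> (\<lambda>g. act X g x) ` ?K" by (rule image_eqI)
    qed
    have same: "act X g x = act X h x" if g: "g \<in> ?K" and h: "h \<in> ?K" and eq: "restrict g W = restrict h W" for g h
    proof -
      have hG: "h \<in> carrier GL_inf" and gU: "g \<in> Ufix m" and hU: "h \<in> Ufix m" using g h by (auto simp: pointwise_stab_iff)
      have hi: "ginv h \<in> Ufix m" using opsubD(5)[OF opsub_Ufix hU] .
      have r: "ginv h \<circ> g \<in> Ufix m" using opsubD(4)[OF opsub_Ufix hi gU] .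
      have "(ginv h \<circ> g) w = w" if "w \<in> W" for w
        using fun_cong[OF eq, of w] that hG by simp
      then have "ginv h \<circ> g \<in> pointwise_stab W" using r by (simp add: pointwise_stab_iff)
      then have "act X (ginv h \<circ> g) x = x" using WA by (auto simp: A_iff)
      then have "act X h (act X (ginv h \<circ> g) x) = act X h x" by simp
      moreover have "act X h (act X (ginv h \<circ> g) x) = act X (h \<circ> (ginv h \<circ> g)) x"
        using smoothD(4)[OF sX, of h "ginv h \<circ> g" x] hU r x X by simp
      moreover have "h \<circ> (ginv h \<circ> g) = g" using hG by (simp add: fun_eq_iff)
      ultimately show ?thesis by simp
    qed
    have "(\<lambda>g. restrict g W) ` ?K \<subseteq> W \<rightarrow>\<^sub>E W" by auto
    then have "finite ((\<lambda>g. restrict g W) ` ?K)" by (rule finite_subset) (simp add: finite_PiE finW)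
    moreover have "(\<lambda>g. act X g x) ` ?K \<subseteq> (\<lambda>r. act X (SOME g. g \<in> ?K \<and> restrict g W = r) x) ` (\<lambda>g. restrict g W) ` ?K"
    proof
      fix y assume "y \<in> (\<lambda>g. act X g x) ` ?K"
      then obtain g where g: "g \<in> ?K" "y = act X g x" by blast
      let ?h = "SOME h. h \<in> ?K \<and> restrict h W = restrict g W"
      have "?h \<in> ?K \<and> restrict ?h W = restrict g W"
        by (rule someI[of "\<lambda>h. h \<in> ?K \<and> restrict h W = restrict g W" g]) (use g in simp)
      then have "y = act X ?h x" using same[OF g(1), of ?h] g(2) by simp
      then show "y \<in> (\<lambda>r. act X (SOME g. g \<in> ?K \<and> restrict g W = r) x) ` (\<lambda>g. restrict g W) ` ?K"
        using g(1) by blast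
    qed
    ultimately have "finite ((\<lambda>g. act X g x) ` ?K)" by (rule finite_surj)
    then show "finite (pts ?F)" using pts finite_subset by blast
    show "symb (Omega m d) \<in> FC" by (intro free_cring_symb FinSets_Omega)
  qed
  finally show ?thesis by blast
qed

abbreviation Omega_comb :: "nat \<Rightarrow> nat \<Rightarrow> (nat \<Rightarrow> int) \<Rightarrow> ('f::{field,finite}, 'f fsv set) glset int_mpoly" where
  "Omega_comb m D c \<equiv> (\<Sum>d<D. of_int (c d) * symb (Omega m d))"

text \<open>The level \<open>m\<close> is the same for all summands, so that independence of the \<open>\<omega>\<^sub>m\<^sub>,\<^sub>d\<close> for fixed \<open>m\<close>
applies to the combination.\<close>

definition spanned :: "nat \<Rightarrow> ('f::{field,finite}, 'f fsv set) glset int_mpoly \<Rightarrow> bool" where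
  "spanned m x \<longleftrightarrow> (\<exists>D c. x \<approx> Omega_comb m D c)"

lemma spanned_cong: "x \<approx> y \<Longrightarrow> spanned m y \<Longrightarrow> spanned m x"
  unfolding spanned_def by (blast intro: theta_eq_trans)

lemma FC_Omega: "symb (Omega m d) \<in> FC"
  by (intro free_cring_symb FinSets_Omega)

lemma spanned_add:
  fixes x y :: "('f::{field,finite}, 'f fsv set) glset int_mpoly"
  assumes "spanned m x" "spanned m y" shows "spanned m (x + y)"
proof -
  obtain D c D' c' where x: "x \<approx> Omega_comb m D c"
    and y: "y \<approx> (\<Sum>d<D'. of_int (c' d) * symb (Omega m d))"
    using assms by (auto simp: spanned_def)
  have ext: "(\<Sum>d<E. of_int (b d) * symb (Omega m d :: ('f, 'f fsv set) glset)) =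
     (\<Sum>d<max E E'. of_int (if d < E then b d else 0) * symb (Omega m d))" for E E' :: nat and b
    by (intro sum.mono_neutral_cong_left) auto
  have "x + y \<approx> (\<Sum>d<max D D'. of_int (if d < D then c d else 0) * symb (Omega m d))
      + (\<Sum>d<max D D'. of_int (if d < D' then c' d else 0) * symb (Omega m d))"
    using theta_eq_add[OF x y] ext[of c D D'] ext[of c' D' D]
    by (simp add: max.commute)
  also have "\<dots> = (\<Sum>d<max D D'. of_int ((if d < D then c d else 0) + (if d < D' then c' d else 0)) * symb (Omega m d))"
    unfolding of_int_add distrib_right sum.distrib ..
  finally show ?thesis unfolding spanned_def by (intro exI)
qed

lemma spanned_scale:
  assumes "spanned m x" shows "spanned m (of_int k * x)"
proof -
  obtain D c where x: "x \<approx> Omega_comb m D c"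
    using assms by (auto simp: spanned_def)
  have "of_int k * x \<approx> of_int k * Omega_comb m D c"
    by (rule theta_eq_mult[OF theta_eq_refl[OF free_cring_of_int] x])
  also have "\<dots> = (\<Sum>d<D. of_int (k * c d) * symb (Omega m d))"
    by (simp add: sum_distrib_left mult.assoc)
  finally show ?thesis unfolding spanned_def by (intro exI)
qed

lemma spanned_Omega: "spanned m (symb (Omega m d))"
proof -
  have "symb (Omega m d) \<approx> symb (Omega m d)" by (rule theta_eq_refl[OF FC_Omega])
  then show ?thesis
    unfolding spanned_def by (intro exI[of _ "Suc d"] exI[of _ "\<lambda>e. if e = d then 1 else 0"]) simp
qed

lemma spanned_zero: "spanned m 0"
  using spanned_scale[OF spanned_Omega, of m 0 0] by simp

lemma spanned_sum: "(\<And>i. i \<in> A \<Longrightarrow> spanned m (f i)) \<Longrightarrow> spanned m (sum f A)"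
  by (induction A rule: infinite_finite_induct) (auto simp: spanned_zero intro: spanned_add)

lemma spanned_symb:
  assumes X: "X \<in> FinSets" and m: "Ufix m \<subseteq> defgrp X"
  shows "spanned m (symb X)"
proof (rule spanned_cong[OF theta_eq_orbits[OF X opsub_Ufix m] spanned_sum])
  fix P assume "P \<in> orb (act X) (Ufix m) ` pts X"
  from FinSets_orbit[OF X opsub_Ufix m this]
  obtain k d where "symb (restr (Ufix m) P X) \<approx> of_nat k * symb (Omega m d)"
    using theta_eq_transitive[of "restr (Ufix m) P X" m] by auto
  then show "spanned m (symb (restr (Ufix m) P X))"
    by (rule spanned_cong) (use spanned_scale[OF spanned_Omega, of m "int k" d] in simp)
qed

lemma spanned_of_int:
  "spanned m (of_int c :: ('f::{field,finite}, 'f fsv set) glset int_mpoly)"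
proof -
  have "is_singleton (pts (Omega m 0 :: ('f, 'f fsv set) glset))"
  proof -
    have "W = Vn m" if "W \<in> Omega_pts m 0" for W :: "'f fsv set"
      using that card_subset_eq[of W "Vn m"] by (auto simp: Omega_pts_iff card_Vn)
    moreover have "(Vn m :: 'f fsv set) \<in> Omega_pts m 0" by (simp add: Omega_pts_iff card_Vn)
    ultimately have "Omega_pts m 0 = {Vn m :: 'f fsv set}" by blast
    then show ?thesis by (simp add: is_singleton_def)
  qed
  then have "1 \<approx> symb (Omega m 0 :: ('f, 'f fsv set) glset)"
    by (rule theta_eq_sym[OF theta_eq_singleton[OF FinSets_Omega]])
  then have "spanned m (1 :: ('f, 'f fsv set) glset int_mpoly)" by (rule spanned_cong) (rule spanned_Omega)
  from spanned_scale[OF this, of c] show ?thesis by simp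
qed

text \<open>\<open>V\<close> is infinite, so the disjoint union of two copies of \<open>V\<close> injects into \<open>V\<close>, and pairs of subsets
of \<open>V\<close> become subsets of \<open>V\<close>.\<close>

lemma ex_pair_encoding: "\<exists>enc :: ('f::field fsv set \<times> 'f fsv set) \<Rightarrow> 'f fsv set. inj enc"
proof -
  have "inj (std :: nat \<Rightarrow> 'f fsv)" by (rule injI) (metis lookup_single_eq lookup_single_not_eq zero_neq_one)
  then have "infinite (UNIV :: 'f fsv set)" using finite_imageD infinite_UNIV_nat finite_subset subset_UNIV by blast
  then have "(card_of ((UNIV :: 'f fsv set) <+> (UNIV :: 'f fsv set)), card_of (UNIV :: 'f fsv set)) \<in> ordIso"
    by (rule card_of_Plus_infinite1) (rule card_of_refl[THEN ordIso_imp_ordLeq])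
  then obtain j :: "'f fsv + 'f fsv \<Rightarrow> 'f fsv" where "bij_betw j (UNIV <+> UNIV) UNIV"
    unfolding card_of_ordIso[symmetric] by blast
  then have j: "inj j" by (simp add: bij_betw_def)
  have "inj (\<lambda>p. j ` (fst p <+> snd p))"
  proof (rule injI)
    fix p p' :: "'f fsv set \<times> 'f fsv set" assume "j ` (fst p <+> snd p) = j ` (fst p' <+> snd p')"
    then have eq: "fst p <+> snd p = fst p' <+> snd p'" by (simp add: inj_image_eq_iff[OF j])
    have "x \<in> fst p \<longleftrightarrow> x \<in> fst p'" "x \<in> snd p \<longleftrightarrow> x \<in> snd p'" for x
      using set_eq_iff[THEN iffD1, OF eq, rule_format, of "Inl x"] set_eq_iff[THEN iffD1, OF eq, rule_format, of "Inr x"] by auto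
    then show "p = p'" by (auto simp: prod_eq_iff)
  qed
  then show ?thesis by blast
qed

lemma spanned_Omega_times:
  fixes m d d' :: nat
  shows "spanned m (symb (Omega m d) * symb (Omega m d' :: ('f::{field,finite}, 'f fsv set) glset))"
proof -
  obtain enc :: "'f fsv set \<times> 'f fsv set \<Rightarrow> 'f fsv set" where "inj enc" using ex_pair_encoding by blast
  then have "\<exists>\<P> Z. finite \<P> \<and> (\<forall>P \<in> \<P>. Z P \<in> FinSets \<and> defgrp (Z P) = Ufix m) \<and>
      symb (Omega m d) * symb (Omega m d' :: ('f, 'f fsv set) glset)
        \<approx> (\<Sum>P \<in> (\<P> :: 'f fsv set set set). symb (Z P))"
    by (rule theta_eq_times) (simp_all add: FinSets_Omega transitive_Omega)
  then obtain \<P> Z where Z: "\<forall>P \<in> \<P>. Z P \<in> FinSets \<and> defgrp (Z P) = Ufix m"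
    "symb (Omega m d) * symb (Omega m d' :: ('f, 'f fsv set) glset)
        \<approx> (\<Sum>P \<in> (\<P> :: 'f fsv set set set). symb (Z P))"
    by (elim exE conjE)
  show ?thesis by (rule spanned_cong[OF Z(2)], rule spanned_sum, rule spanned_symb) (use Z(1) in auto)
qed

lemma spanned_mult:
  assumes "spanned m x" "spanned m y" shows "spanned m (x * y)"
proof -
  obtain D c D' c' where x: "x \<approx> Omega_comb m D c"
    and y: "y \<approx> (\<Sum>d<D'. of_int (c' d) * symb (Omega m d))"
    using assms by (auto simp: spanned_def)
  have "x * y \<approx> Omega_comb m D c * (\<Sum>d<D'. of_int (c' d) * symb (Omega m d))"
    by (rule theta_eq_mult[OF x y])
  also have "\<dots> = (\<Sum>d<D. \<Sum>e<D'. of_int (c d * c' e) * (symb (Omega m d) * symb (Omega m e)))"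
    unfolding sum_product by (intro sum.cong refl) (simp add: mult_ac)
  finally show ?thesis
    by (rule spanned_cong) (intro spanned_sum spanned_scale spanned_Omega_times)
qed

text \<open>The elements that are spanned at level \<open>m\<close> form a ring, and it contains a symbol as soon as \<open>U\<^sub>m\<close>
lies in the group of definition.\<close>

theorem eventually_spanned:
  assumes "x \<in> FC" shows "\<forall>\<^sub>F m in sequentially. spanned m x"
  using assms
proof (induction x rule: free_cring_induct)
  case (symb X)
  have "\<forall>\<^sub>F m in sequentially. Ufix m \<subseteq> defgrp X" using opsubD(6) smoothD(1) FinSetsD symb by metis
  then show ?case by eventually_elim (rule spanned_symb[OF symb])
next
  case (add x y)
  then show ?case by eventually_elim (rule spanned_add)
next
  case (mult x y)
  then show ?case by eventually_elim (rule spanned_mult)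
qed (simp add: spanned_of_int)

section \<open>Polynomials integral at \<open>q\<close>-integers\<close>

lemma qint_0 [simp]: "qint q 0 = 0"
  by (simp add: qint_def)

lemma qint_Suc: "qint q (Suc n) = qint q n + of_nat q ^ n"
  by (simp add: qint_def)

lemma qint_add: "qint q (m + k) = qint q m + of_nat q ^ m * qint q k"
  by (induction k) (simp_all add: qint_Suc power_add algebra_simps)

lemma qint_Suc': "qint q (Suc n) = 1 + of_nat q * qint q n"
  using qint_add[of q 1 n] by (simp add: qint_Suc)

lemma qint_strict_mono: "q > 0 \<Longrightarrow> strict_mono (qint q)"
  unfolding strict_mono_Suc_iff by (simp add: qint_Suc)

lemma qint_inj: "q > 0 \<Longrightarrow> qint q m = qint q n \<longleftrightarrow> m = n"
  using strict_mono_eq[OF qint_strict_mono] by blast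

lemma qint_pos: "q > 0 \<Longrightarrow> n > 0 \<Longrightarrow> qint q n > 0"
  using strict_monoD[OF qint_strict_mono, of q 0 n] by simp

lemma qint_closed_form: "(of_nat q - 1) * qint q n = of_nat q ^ n - 1"
  by (induction n) (simp_all add: qint_Suc algebra_simps)

lemma poly_shift_q: "poly (shift_q q p) x = poly p (1 + of_nat q * x)"
  by (simp add: shift_q_def poly_pcompose mult.commute)

lemma poly_shift_q_qint: "poly (shift_q q p) (qint q n) = poly p (qint q (Suc n))"
  by (simp add: poly_shift_q qint_Suc')

lemma shift_q_add: "shift_q q (p + r) = shift_q q p + shift_q q r"
  and shift_q_smult: "shift_q q (smult c p) = smult c (shift_q q p)"
  by (simp_all add: shift_q_def pcompose_add pcompose_smult)

lemma bij_shift_q: assumes "q > 0" shows "bij (shift_q q)"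
proof (rule bij_betw_byWitness[where f' = "\<lambda>p. pcompose p [:- 1 / of_nat q, 1 / of_nat q:]"])
  show "\<forall>p \<in> UNIV. pcompose (shift_q q p) [:- 1 / of_nat q, 1 / of_nat q:] = p"
    using assms by (simp add: shift_q_def pcompose_assoc[symmetric] pcompose_pCons)
  show "\<forall>p \<in> UNIV. shift_q q (pcompose p [:- 1 / of_nat q, 1 / of_nat q:]) = p"
    using assms by (simp add: shift_q_def pcompose_assoc[symmetric] pcompose_pCons)
qed auto

lemma degree_shift_q: "q > 0 \<Longrightarrow> degree (shift_q q p) = degree p"
  by (simp add: shift_q_def degree_pcompose)

lemma omega_0 [simp]: "omega q 0 d = omega0 q d"
  by (simp add: omega_def)

lemma shift_q_omega: "q > 0 \<Longrightarrow> shift_q q (omega q (Suc m) d) = omega q m d"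
  by (simp add: omega_def surj_f_inv_f bij_is_surj[OF bij_shift_q])

lemma poly_omega_shift: "q > 0 \<Longrightarrow> poly (omega q m d) (qint q (m + n)) = poly (omega0 q d) (qint q n)"
proof (induction m)
  case (Suc m)
  then show ?case using poly_shift_q_qint[of q "omega q (Suc m) d" "m + n"] by (simp add: shift_q_omega)
qed simp

text \<open>The denominator of \<open>\<omega>\<^sub>0\<^sub>,\<^sub>d\<close>.  It is the value of the numerator at \<open>[d]\<^sub>q\<close>
(\<open>omega_denom_eq\<close>), so \<open>\<omega>\<^sub>0\<^sub>,\<^sub>d\<close> takes the value one there.\<close>

definition omega_denom :: "nat \<Rightarrow> nat \<Rightarrow> rat" where
  "omega_denom q d = of_nat q ^ (d choose 2) * qfact q d"

lemma omega_denom_Suc: "omega_denom q (Suc d) = omega_denom q d * (of_nat q ^ d * qint q (Suc d))"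
proof -
  have "Suc d choose 2 = d + (d choose 2)" using binomial_Suc_Suc[of d 1] unfolding Suc_1 choose_one .
  then show ?thesis by (simp add: omega_denom_def qfact_def power_add mult_ac)
qed

lemma omega_denom_pos: "q > 0 \<Longrightarrow> omega_denom q d > 0"
  unfolding omega_denom_def qfact_def by (intro mult_pos_pos prod_pos) (auto simp: qint_pos)

lemma poly_omega0: "poly (omega0 q d) x = (\<Prod>i<d. x - qint q i) / omega_denom q d"
  by (simp add: omega0_def omega_denom_def poly_prod)

lemma omega_denom_eq: "omega_denom q d = (\<Prod>i<d. qint q d - qint q i)"
proof (induction d)
  case 0
  then show ?case by (simp add: omega_denom_def qfact_def binomial_eq_0)
next
  case (Suc d)
  have "(\<Prod>i<Suc d. qint q (Suc d) - qint q i) = qint q (Suc d) * (\<Prod>i<d. qint q (Suc d) - qint q (Suc i))"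
    by (subst prod.lessThan_Suc_shift) simp
  also have "(\<Prod>i<d. qint q (Suc d) - qint q (Suc i)) = of_nat q ^ d * (\<Prod>i<d. qint q d - qint q i)"
    by (simp add: qint_Suc' right_diff_distrib[symmetric] prod.distrib)
  finally show ?case using Suc by (simp add: omega_denom_Suc)
qed

lemma poly_omega_diag: "q > 0 \<Longrightarrow> poly (omega q m d) (qint q (m + d)) = 1"
  using omega_denom_pos[of q d] by (simp add: poly_omega_shift poly_omega0 omega_denom_eq[symmetric])

lemma poly_omega_below: "q > 0 \<Longrightarrow> k < d \<Longrightarrow> poly (omega q m d) (qint q (m + k)) = 0"
  by (simp add: poly_omega_shift poly_omega0) (metis lessThan_iff finite_lessThan prod_zero right_minus_eq)

lemma degree_omega_le:
  assumes "q > 0" shows "degree (omega q m d) \<le> d"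
proof (induction m)
  case 0
  have "degree (\<Prod>i<d. [:- qint q i, 1:]) \<le> (\<Sum>i<d. degree [:- qint q i, 1:])"
    by (rule order.trans[OF degree_prod_sum_le]) (auto simp: o_def)
  then show ?case unfolding omega_0 omega0_def
    by (intro order.trans[OF degree_smult_le]) simp
next
  case (Suc m)
  then show ?case using degree_shift_q[OF assms, of "omega q (Suc m) d"] by (simp add: shift_q_omega assms)
qed

text \<open>The \<open>q\<close>-Pascal rule.  Shifting \<open>x\<close> to \<open>q x + 1\<close> turns the factors \<open>x - [i+1]\<^sub>q\<close> into multiples of
\<open>x - [i]\<^sub>q\<close>, and the remaining factor is \<open>q x + 1 = [d+1]\<^sub>q + q (x - [d]\<^sub>q)\<close>.\<close>

lemma shift_omega0_Suc:
  assumes "q > 0"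
  shows "shift_q q (omega0 q (Suc d)) = omega0 q d + smult (of_nat q ^ Suc d) (omega0 q (Suc d))"
proof (rule poly_eq_poly_eq_iff[THEN iffD1], rule ext)
  fix x
  let ?P = "\<Prod>i<d. x - qint q i"
  have "(\<Prod>i<d. 1 + of_nat q * x - qint q (Suc i)) = (\<Prod>i<d. of_nat q * (x - qint q i))"
    by (intro prod.cong refl) (simp add: qint_Suc' algebra_simps)
  then have "(\<Prod>i<Suc d. 1 + of_nat q * x - qint q i) = (1 + of_nat q * x) * (\<Prod>i<d. of_nat q * (x - qint q i))"
    by (subst prod.lessThan_Suc_shift) simp
  also have "(\<Prod>i<d. of_nat q * (x - qint q i)) = of_nat q ^ d * ?P"
    by (simp only: prod.distrib) simp
  finally have shifted: "(\<Prod>i<Suc d. 1 + of_nat q * x - qint q i)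
      = (qint q (Suc d) + of_nat q * (x - qint q d)) * (of_nat q ^ d * ?P)"
    by (simp add: qint_Suc' right_diff_distrib)
  have nz: "omega_denom q d \<noteq> 0" "qint q (Suc d) \<noteq> 0" "(of_nat q :: rat) \<noteq> 0"
    using omega_denom_pos[OF assms, of d] qint_pos[OF assms, of "Suc d"] assms by auto
  have "poly (shift_q q (omega0 q (Suc d))) x
      = (qint q (Suc d) + of_nat q * (x - qint q d)) * (of_nat q ^ d * ?P) / (omega_denom q d * (of_nat q ^ d * qint q (Suc d)))"
    by (simp only: poly_shift_q poly_omega0 shifted omega_denom_Suc)
  also have "\<dots> = ?P / omega_denom q d
      + of_nat q ^ Suc d * (?P * (x - qint q d) / (omega_denom q d * (of_nat q ^ d * qint q (Suc d))))"
    using nz by (simp add: field_simps)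
  finally show "poly (shift_q q (omega0 q (Suc d))) x
      = poly (omega0 q d + smult (of_nat q ^ Suc d) (omega0 q (Suc d))) x"
    by (simp add: poly_omega0 omega_denom_Suc)
qed

lemma omega_Pascal:
  assumes "q > 0"
  shows "omega q m (Suc d) = omega q (Suc m) d + smult (of_nat q ^ Suc d) (omega q (Suc m) (Suc d))"
proof -
  note inj = bij_is_inj[OF bij_shift_q[OF assms], THEN injD]
  show ?thesis
  proof (rule inj, induction m)
    case 0
    then show ?case using assms by (simp add: shift_omega0_Suc shift_q_add shift_q_smult shift_q_omega)
  next
    case (Suc m)
    then show ?case
      using inj[OF Suc] assms by (simp add: shift_q_add shift_q_smult shift_q_omega)
  qed
qed

lemma omega_d_0: "q > 0 \<Longrightarrow> omega q m 0 = 1"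
proof (induction m)
  case 0
  then show ?case by (simp add: omega0_def qfact_def binomial_eq_0)
next
  case (Suc m)
  have "shift_q q (omega q (Suc m) 0) = shift_q q 1"
    using Suc by (simp add: shift_q_omega) (simp add: shift_q_def pcompose_1)
  then show ?case using bij_is_inj[OF bij_shift_q[OF Suc.prems]] by (metis injD)
qed

text \<open>By the \<open>q\<close>-Pascal rule the value at \<open>[n+1]\<^sub>q\<close> is an integer combination of values at \<open>[n]\<^sub>q\<close>.\<close>

lemma omega0_Ints: "q > 0 \<Longrightarrow> poly (omega0 q d) (qint q n) \<in> \<int>"
proof (induction n arbitrary: d)
  case 0
  show ?case
  proof (cases d)
    case 0
    then show ?thesis using omega_d_0[OF \<open>q > 0\<close>, of 0] by simp
  next
    case (Suc d')
    then show ?thesis using poly_omega_below[OF \<open>q > 0\<close>, of 0 d 0] by simp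
  qed
next
  case (Suc n)
  show ?case
  proof (cases d)
    case 0
    then show ?thesis using omega_d_0[OF \<open>q > 0\<close>, of 0] by simp
  next
    case (Suc d')
    have "poly (omega0 q d) (qint q (Suc n)) = poly (omega0 q d') (qint q n) + of_nat q ^ d * poly (omega0 q d) (qint q n)"
      using poly_shift_q_qint[of q "omega0 q d" n, symmetric] shift_omega0_Suc[OF \<open>q > 0\<close>, of d'] by (simp add: Suc)
    then show ?thesis using Suc.IH[OF \<open>q > 0\<close>] by simp
  qed
qed

lemma omega_Ints: "q > 0 \<Longrightarrow> n \<ge> m \<Longrightarrow> poly (omega q m d) (qint q n) \<in> \<int>"
  using poly_omega_shift[of q m d "n - m"] omega0_Ints[of q d "n - m"] by simp

lemma Z_inv_int: "of_int a \<in> Z_inv q"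
  unfolding Z_inv_def by (intro CollectI exI[of _ a] exI[of _ 0]) simp

lemma Z_inv_diff:
  assumes "q > 0" "x \<in> Z_inv q" "y \<in> Z_inv q" shows "x - y \<in> Z_inv q"
proof -
  obtain a k b l where "x = of_int a / of_nat q ^ k" "y = of_int b / of_nat q ^ l"
    using assms by (auto simp: Z_inv_def)
  then have "x = of_int (a * int q ^ l) / of_nat q ^ (k + l)" "y = of_int (b * int q ^ k) / of_nat q ^ (k + l)"
    using assms(1) by (simp_all add: power_add)
  then have "x - y = of_int (a * int q ^ l - b * int q ^ k) / of_nat q ^ (k + l)"
    by (simp only: diff_divide_distrib of_int_diff)
  then show ?thesis unfolding Z_inv_def by blast
qed

lemma Z_inv_mult:
  assumes "x \<in> Z_inv q" "y \<in> Z_inv q" shows "x * y \<in> Z_inv q"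
proof -
  obtain a k b l where "x = of_int a / of_nat q ^ k" "y = of_int b / of_nat q ^ l"
    using assms by (auto simp: Z_inv_def)
  then have "x * y = of_int (a * b) / of_nat q ^ (k + l)" by (simp add: power_add)
  then show ?thesis unfolding Z_inv_def by blast
qed

lemma Z_inv_divide_power:
  assumes "x \<in> Z_inv q" shows "x / of_nat q ^ k \<in> Z_inv q"
proof -
  have "1 / of_nat q ^ k \<in> Z_inv q" unfolding Z_inv_def by (intro CollectI exI[of _ 1] exI[of _ k]) simp
  from Z_inv_mult[OF assms this] show ?thesis by simp
qed

text \<open>At \<open>[n]\<^sub>q\<close> with \<open>n < m\<close> the values need not be integers.  The \<open>q\<close>-Pascal rule, solved for the term
with the larger \<open>m\<close>, only divides by a power of \<open>q\<close>.\<close>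

lemma omega_R_q: assumes "q > 0" shows "omega q m d \<in> R_q q"
proof -
  have "poly (omega q m d) (qint q n) \<in> Z_inv q" for n
  proof (induction m arbitrary: d)
    case 0
    show ?case using omega0_Ints[OF assms, of d n] Z_inv_int by (auto elim!: Ints_cases)
  next
    case (Suc m)
    show ?case
    proof (induction d)
      case 0
      show ?case using omega_d_0[OF assms] Z_inv_int[of 1] by simp
    next
      case (Suc d)
      have "poly (omega q (Suc m) (Suc d)) (qint q n)
          = (poly (omega q m (Suc d)) (qint q n) - poly (omega q (Suc m) d) (qint q n)) / of_nat q ^ Suc d"
        using omega_Pascal[OF assms, of m d] assms by simp
      then show ?case
        using Z_inv_divide_power[OF Z_inv_diff[OF assms \<open>\<And>d. poly (omega q m d) (qint q n) \<in> Z_inv q\<close> Suc.IH], where k = "Suc d"] by simp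
    qed
  qed
  then show ?thesis by (simp add: R_q_def)
qed

lemma omega_R_q_large: "q > 0 \<Longrightarrow> omega q m d \<in> carrier (R_q_large q)"
  using omega_R_q[of q m d] omega_Ints[of q m _ d]
  by (auto simp: R_q_large_def eventually_sequentially intro: exI[of _ m])

lemma R_q_large_simps [simp]:
  "monoid.mult (R_q_large q) = (*)" "one (R_q_large q) = 1"
  "zero (R_q_large q) = 0" "add (R_q_large q) = (+)"
  by (simp_all add: R_q_large_def)

lemma R_q_large_closed:
  assumes "q > 0"
  shows "1 \<in> carrier (R_q_large q)"
    and "x \<in> carrier (R_q_large q) \<Longrightarrow> y \<in> carrier (R_q_large q) \<Longrightarrow> x - y \<in> carrier (R_q_large q)"
    and "x \<in> carrier (R_q_large q) \<Longrightarrow> y \<in> carrier (R_q_large q) \<Longrightarrow> x * y \<in> carrier (R_q_large q)"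
proof -
  show "1 \<in> carrier (R_q_large q)" using omega_R_q_large[OF assms, of 0 0] omega_d_0[OF assms, of 0] by simp
  show "x - y \<in> carrier (R_q_large q)" if x: "x \<in> carrier (R_q_large q)" and y: "y \<in> carrier (R_q_large q)"
  proof -
    have "\<forall>\<^sub>F n in sequentially. poly x (qint q n) \<in> \<int>" "\<forall>\<^sub>F n in sequentially. poly y (qint q n) \<in> \<int>"
      using x y by (auto simp: R_q_large_def)
    then have "\<forall>\<^sub>F n in sequentially. poly (x - y) (qint q n) \<in> \<int>" by eventually_elim simp
    then show ?thesis using x y Z_inv_diff[OF assms] by (simp add: R_q_large_def R_q_def)
  qed
  show "x * y \<in> carrier (R_q_large q)" if x: "x \<in> carrier (R_q_large q)" and y: "y \<in> carrier (R_q_large q)"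
  proof -
    have "\<forall>\<^sub>F n in sequentially. poly x (qint q n) \<in> \<int>" "\<forall>\<^sub>F n in sequentially. poly y (qint q n) \<in> \<int>"
      using x y by (auto simp: R_q_large_def)
    then have "\<forall>\<^sub>F n in sequentially. poly (x * y) (qint q n) \<in> \<int>" by eventually_elim simp
    then show ?thesis using x y Z_inv_mult by (simp add: R_q_large_def R_q_def)
  qed
qed

abbreviation omega_comb :: "nat \<Rightarrow> nat \<Rightarrow> nat \<Rightarrow> (nat \<Rightarrow> int) \<Rightarrow> rat poly" where
  "omega_comb q m D c \<equiv> (\<Sum>d<D. smult (of_int (c d)) (omega q m d))"

lemma R_q_large_comb:
  assumes q: "q > 0" shows "omega_comb q m D c \<in> carrier (R_q_large q)"
proof -
  have "\<forall>\<^sub>F n in sequentially. poly (omega_comb q m D c) (qint q n) \<in> \<int>"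
    using eventually_ge_at_top[of m]
    by eventually_elim (auto simp: poly_sum intro!: Ints_sum Ints_mult omega_Ints[OF q])
  moreover have "poly (omega_comb q m D c) (qint q n) \<in> Z_inv q" for n
  proof (induction D)
    case 0
    then show ?case using Z_inv_int[of 0] by simp
  next
    case (Suc D)
    have "of_int (- c D) * poly (omega q m D) (qint q n) \<in> Z_inv q"
      using omega_R_q[OF q] by (intro Z_inv_mult Z_inv_int) (simp add: R_q_def)
    from Z_inv_diff[OF q Suc this] show ?case by simp
  qed
  ultimately show ?thesis by (simp add: R_q_large_def R_q_def)
qed

lemma cring_R_q_large: assumes "q > 0" shows "cring (R_q_large q)"
proof -
  have "R_q_large q = ring_on (carrier (R_q_large q))" by (simp add: R_q_large_def)
  moreover have "cring (ring_on (carrier (R_q_large q)))"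
    by (rule cring_ring_on[OF R_q_large_closed[OF assms]])
  ultimately show ?thesis by (rule ssubst)
qed

text \<open>So a polynomial is determined by the germ at infinity of its values at \<open>q\<close>-integers.\<close>

lemma poly_eq_if_eventually_eq:
  assumes "q > 0" and ev: "\<forall>\<^sub>F n in sequentially. poly p (qint q n) = poly r (qint q n)"
  shows "p = r"
proof (rule ccontr)
  assume "p \<noteq> r"
  then have "finite {x. poly (p - r) x = 0}" by (intro poly_roots_finite) simp
  moreover obtain N where N: "\<And>n. n \<ge> N \<Longrightarrow> poly p (qint q n) = poly r (qint q n)"
    using ev by (auto simp: eventually_sequentially)
  have "qint q ` {N..} \<subseteq> {x. poly (p - r) x = 0}" using N by auto
  moreover have "infinite (qint q ` {N..})"
    using finite_imageD[of "qint q" "{N..}"] infinite_Ici[of N] qint_inj[OF assms(1)] by (auto simp: inj_on_def)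
  ultimately show False using finite_subset by blast
qed

text \<open>The value of \<open>\<omega>\<^sub>m\<^sub>,\<^sub>d\<close> at \<open>[m+i]\<^sub>q\<close> is zero for \<open>i < d\<close>, one for \<open>i = d\<close> and an integer otherwise,
so the coefficients are found one at a time and are integers.\<close>

lemma omega_basis_interpolation:
  assumes q: "q > 0" and int: "\<And>n. n \<ge> m \<Longrightarrow> poly p (qint q n) \<in> \<int>"
  shows "\<exists>c :: nat \<Rightarrow> int. \<forall>i<k. poly (p - (\<Sum>d<k. smult (of_int (c d)) (omega q m d))) (qint q (m + i)) = 0"
proof (induction k)
  case (Suc k)
  then obtain c :: "nat \<Rightarrow> int"
    where c: "\<And>i. i < k \<Longrightarrow> poly (p - (\<Sum>d<k. smult (of_int (c d)) (omega q m d))) (qint q (m + i)) = 0" by blast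
  let ?r = "p - (\<Sum>d<k. smult (of_int (c d)) (omega q m d))"
  have "poly ?r (qint q (m + k)) \<in> \<int>"
    using int[of "m + k"] omega_Ints[OF q] by (auto simp: poly_sum intro!: Ints_diff Ints_sum Ints_mult)
  then obtain a where a: "poly ?r (qint q (m + k)) = of_int a" by (auto elim: Ints_cases)
  have eq: "p - (\<Sum>d<Suc k. smult (of_int ((c(k := a)) d)) (omega q m d)) = ?r - smult (of_int a) (omega q m k)"
    by (simp add: algebra_simps)
  have zero: "poly (?r - smult (of_int a) (omega q m k)) (qint q (m + i)) = 0" if "i < Suc k" for i
  proof (cases "i = k")
    case True
    then show ?thesis using a poly_omega_diag[OF q, of m k] by simp
  next
    case False
    then have "i < k" using that by simp
    then show ?thesis using c[of i] poly_omega_below[OF q, of i k m] by simp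
  qed
  show ?case by (intro exI[of _ "c(k := a)"] allI impI) (simp only: eq zero)
qed simp

text \<open>Interpolation at one point more than the degree determines the polynomial.\<close>

lemma R_q_large_spanned:
  assumes q: "q > 0" and p: "p \<in> carrier (R_q_large q)"
  obtains m and D :: nat and c :: "nat \<Rightarrow> int" where "p = omega_comb q m D c"
proof -
  obtain m where m: "\<And>n. n \<ge> m \<Longrightarrow> poly p (qint q n) \<in> \<int>"
    using p by (auto simp: R_q_large_def eventually_sequentially)
  define D where "D = Suc (degree p)"
  obtain c :: "nat \<Rightarrow> int"
    where c: "\<And>i. i < D \<Longrightarrow> poly (p - omega_comb q m D c) (qint q (m + i)) = 0"
    using omega_basis_interpolation[where m = m and p = p and k = D, OF q m] by blast
  let ?r = "p - omega_comb q m D c"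
  have "degree (smult (of_int (c d)) (omega q m d)) \<le> degree p" if "d < D" for d
    using that degree_omega_le[OF q, of m d] by (intro order.trans[OF degree_smult_le]) (simp add: D_def)
  then have deg: "degree ?r \<le> degree p" by (intro degree_diff_le degree_sum_le) auto
  have "?r = 0"
  proof (rule ccontr)
    assume nz: "?r \<noteq> 0"
    have "qint q ` (\<lambda>i. m + i) ` {..<D} \<subseteq> {x. poly ?r x = 0}" using c by auto
    then have "card (qint q ` (\<lambda>i. m + i) ` {..<D}) \<le> card {x. poly ?r x = 0}"
      using nz by (intro card_mono poly_roots_finite)
    also have "\<dots> \<le> degree ?r" by (rule card_poly_roots_bound[OF nz])
    finally have "card (qint q ` (\<lambda>i. m + i) ` {..<D}) < D" using deg by (simp add: D_def)
    moreover have "card (qint q ` (\<lambda>i. m + i) ` {..<D}) = D"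
      using qint_inj[OF q] by (simp add: card_image inj_on_def image_image)
    ultimately show False by simp
  qed
  then show thesis using that[of c m D] by simp
qed

lemma omega_independent:
  fixes c :: "nat \<Rightarrow> int"
  assumes q: "q > 0" and zero: "omega_comb q m D c = 0" and "d < D"
  shows "c d = 0"
  using \<open>d < D\<close>
proof (induction d rule: less_induct)
  case (less k)
  have "0 = poly (omega_comb q m D c) (qint q (m + k))" using zero by simp
  also have "\<dots> = (\<Sum>d<D. if d = k then of_int (c k) else 0)"
    unfolding poly_sum
  proof (rule sum.cong)
    fix d assume d: "d \<in> {..<D}"
    consider "d < k" | "d = k" | "k < d" by linarith
    then show "poly (smult (of_int (c d)) (omega q m d)) (qint q (m + k)) = (if d = k then of_int (c k) else 0)"
    proof cases
      case 1
      then show ?thesis using less.IH[of d] d by simp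
    next
      case 2
      then show ?thesis using poly_omega_diag[OF q, of m k] by simp
    next
      case 3
      then show ?thesis using poly_omega_below[OF q 3, of m] by simp
    qed
  qed simp
  also have "\<dots> = of_int (c k)" using less.prems by simp
  finally show ?case by simp
qed

section \<open>Evaluating integer polynomials\<close>

definition monom_eval :: "('i \<Rightarrow> int) \<Rightarrow> ('i \<Rightarrow>\<^sub>0 nat) \<Rightarrow> int" where
  "monom_eval c m = (\<Prod>i\<in>Poly_Mapping.keys m. c i ^ Poly_Mapping.lookup m i)"

definition mpoly_eval :: "('i \<Rightarrow> int) \<Rightarrow> 'i int_mpoly \<Rightarrow> int" where
  "mpoly_eval c p = (\<Sum>m\<in>Poly_Mapping.keys p. Poly_Mapping.lookup p m * monom_eval c m)"

lemma monom_eval_superset: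
  "finite A \<Longrightarrow> Poly_Mapping.keys m \<subseteq> A \<Longrightarrow> monom_eval c m = (\<Prod>i\<in>A. c i ^ Poly_Mapping.lookup m i)"
  unfolding monom_eval_def by (intro prod.mono_neutral_left) (auto simp: in_keys_iff)

lemma mpoly_eval_superset:
  "finite A \<Longrightarrow> Poly_Mapping.keys p \<subseteq> A \<Longrightarrow> mpoly_eval c p = (\<Sum>m\<in>A. Poly_Mapping.lookup p m * monom_eval c m)"
  unfolding mpoly_eval_def by (intro sum.mono_neutral_left) (auto simp: in_keys_iff)

lemma monom_eval_add: "monom_eval c (m + n) = monom_eval c m * monom_eval c n"
proof -
  let ?A = "Poly_Mapping.keys m \<union> Poly_Mapping.keys n"
  have "monom_eval c (m + n) = (\<Prod>i\<in>?A. c i ^ Poly_Mapping.lookup (m + n) i)"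
    using Poly_Mapping.keys_add[of m n] by (intro monom_eval_superset) auto
  also have "\<dots> = (\<Prod>i\<in>?A. c i ^ Poly_Mapping.lookup m i) * (\<Prod>i\<in>?A. c i ^ Poly_Mapping.lookup n i)"
    by (simp add: lookup_add power_add prod.distrib)
  finally show ?thesis by (simp add: monom_eval_superset[of ?A])
qed

lemma mpoly_eval_add: "mpoly_eval c (p + r) = mpoly_eval c p + mpoly_eval c r"
proof -
  let ?A = "Poly_Mapping.keys p \<union> Poly_Mapping.keys r"
  have "mpoly_eval c (p + r) = (\<Sum>m\<in>?A. Poly_Mapping.lookup (p + r) m * monom_eval c m)"
    using Poly_Mapping.keys_add[of p r] by (intro mpoly_eval_superset) auto
  also have "\<dots> = (\<Sum>m\<in>?A. Poly_Mapping.lookup p m * monom_eval c m) + (\<Sum>m\<in>?A. Poly_Mapping.lookup r m * monom_eval c m)"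
    by (simp add: lookup_add distrib_right sum.distrib)
  finally show ?thesis by (simp add: mpoly_eval_superset[of ?A])
qed

lemma mpoly_eval_0 [simp]: "mpoly_eval c 0 = 0"
  by (simp add: mpoly_eval_def)

lemma mpoly_eval_uminus: "mpoly_eval c (- p) = - mpoly_eval c p"
  using mpoly_eval_add[of c p "- p"] by simp

lemma mpoly_eval_diff: "mpoly_eval c (p - r) = mpoly_eval c p - mpoly_eval c r"
  using mpoly_eval_add[of c p "- r"] by (simp add: mpoly_eval_uminus)

lemma mpoly_eval_sum: "mpoly_eval c (sum f A) = (\<Sum>a\<in>A. mpoly_eval c (f a))"
  by (induction A rule: infinite_finite_induct) (auto simp: mpoly_eval_add)

lemma mpoly_eval_single: "mpoly_eval c (Poly_Mapping.single m a) = a * monom_eval c m"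
  by (simp add: mpoly_eval_def)

lemma mpoly_eval_mult: "mpoly_eval c (p * r) = mpoly_eval c p * mpoly_eval c r"
proof -
  let ?s = "\<lambda>p m. Poly_Mapping.single m (Poly_Mapping.lookup p m)"
  have "p * r = (\<Sum>m\<in>Poly_Mapping.keys p. ?s p m) * (\<Sum>n\<in>Poly_Mapping.keys r. ?s r n)"
    by (simp add: poly_mapping_sum_single[symmetric])
  also have "\<dots> = (\<Sum>m\<in>Poly_Mapping.keys p. \<Sum>n\<in>Poly_Mapping.keys r.
      Poly_Mapping.single (m + n) (Poly_Mapping.lookup p m * Poly_Mapping.lookup r n))"
    by (simp add: sum_product mult_single)
  finally have "mpoly_eval c (p * r) = (\<Sum>m\<in>Poly_Mapping.keys p. \<Sum>n\<in>Poly_Mapping.keys r.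
      (Poly_Mapping.lookup p m * monom_eval c m) * (Poly_Mapping.lookup r n * monom_eval c n))"
    by (simp add: mpoly_eval_sum mpoly_eval_single monom_eval_add mult_ac)
  then show ?thesis by (simp add: mpoly_eval_def sum_product)
qed

lemma mpoly_eval_of_int [simp]: "mpoly_eval c (of_int k) = k"
  using mpoly_eval_single[of c 0 k] by (simp add: single_0_int monom_eval_def)

lemma mpoly_eval_1 [simp]: "mpoly_eval c 1 = 1"
  using mpoly_eval_of_int[of c 1] by simp

lemma mpoly_eval_symb [simp]: "mpoly_eval c (symb i) = c i"
  by (simp add: symb_def mpoly_eval_single monom_eval_def)

section \<open>Counting fixed points\<close>

definition fixedpts :: "nat \<Rightarrow> ('f::field, 'x) glset \<Rightarrow> 'x set" where
  "fixedpts n X = {x \<in> pts X. \<forall>u \<in> Ufix n. act X u x = x}"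

text \<open>Meaningful once \<open>U\<^sub>n\<close> lies in the group of definition of \<open>X\<close>; only the germ at infinity in \<open>n\<close> is
used.\<close>

definition fixcount :: "nat \<Rightarrow> ('f::field, 'x) glset \<Rightarrow> int" where
  "fixcount n X = int (card (fixedpts n X))"

lemma GLn_m_inv: "h \<in> GLn n \<Longrightarrow> ginv h \<in> GLn n"
proof -
  assume h: "h \<in> GLn n"
  then have hG: "h \<in> carrier GL_inf" by (rule GLn_carrier)
  have "ginv h = inv_into UNIV h"
    using GL_bij[OF hG] GL_inv_apply(1)[OF hG]
    by (intro ext) (metis bij_inv_eq_iff)
  then show ?thesis using GLn_inv[OF h] by simp
qed

text \<open>Let \<open>W\<close> be the least support of the stabilizer of a point \<open>x0\<close>.  If \<open>u x0\<close> is fixed by \<open>U\<^sub>n\<close>, then \<open>u W\<close> is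
contained in \<open>V\<^sub>n\<close>.  So \<open>u\<close> can be replaced by an element of \<open>GL\<^sub>n\<close> that agrees with it on \<open>W\<close>, and
this does not change \<open>u x0\<close>.\<close>

lemma fixedpts_transitive:
  fixes X :: "('f::{field,finite}, 'x) glset"
  assumes X: "X \<in> FinSets" and tr: "transitive_gset GL_inf X"
  shows "\<forall>\<^sub>F n in sequentially. \<forall>x \<in> fixedpts n X. \<forall>y \<in> fixedpts n X. \<exists>h \<in> GLn n \<inter> defgrp X. act X h x = y"
proof -
  note sX = FinSetsD[OF X]
  note oX = opsubD[OF smoothD(1)[OF sX]]
  obtain x0 where x0: "x0 \<in> pts X" using tr by (auto simp: transitive_gset_def)
  define A where "A = stabilizer (GL_inf\<lparr>carrier := defgrp X\<rparr>) (act X) x0"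
  have A: "opsub A" unfolding A_def by (rule opsub_stabilizer[OF sX x0])
  have A_iff: "g \<in> A \<longleftrightarrow> g \<in> defgrp X \<and> act X g x0 = x0" for g by (simp add: A_def stabilizer_iff)
  have subA: "subgroup A GL_inf" using opsubD[OF A] by blast
  obtain k where "Ufix k \<subseteq> A" using opsubD(6)[OF A] by (auto dest: eventually_happens)
  then obtain W where W: "supports W A" by (rule least_support_exists[OF subA])
  have finW: "finsub W" and WA: "pointwise_stab W \<subseteq> A" using W by (auto simp: supports_def)
  have "\<forall>\<^sub>F n in sequentially. W \<subseteq> Vn n" using finW by (intro finite_subset_Vn) auto
  with oX(6) show ?thesis
  proof eventually_elim
    case (elim n)
    have *: "\<exists>h \<in> GLn n \<inter> defgrp X. act X h x0 = x" if x: "x \<in> fixedpts n X" for x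
    proof -
      have "\<exists>u \<in> defgrp X. act X u x0 = x"
        using tr x0 x unfolding transitive_gset_iff[OF sX] fixedpts_def by blast
      then obtain u where u: "u \<in> defgrp X" "act X u x0 = x" by blast
      have uG: "u \<in> carrier GL_inf" using u oX by blast
      have "u ` W \<subseteq> Vn n"
      proof (rule supports_translate[OF W uG])
        fix v :: "'f vmap" assume v: "v \<in> Ufix n"
        then have vD: "v \<in> defgrp X" using elim by blast
        have c: "ginv u \<circ> v \<in> defgrp X" using oX(4)[OF oX(5)[OF u(1)] vD] .
        have "act X (ginv u \<circ> v \<circ> u) x0 = act X (ginv u) (act X v (act X u x0))"
          using smoothD(4)[OF sX c u(1) x0] smoothD(4)[OF sX oX(5)[OF u(1)] vD smoothD(2)[OF sX u(1) x0]] by simp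
        also have "act X v (act X u x0) = act X u x0" using x v u(2) by (simp add: fixedpts_def)
        also have "act X (ginv u) (act X u x0) = x0" by (rule act_inv(1)[OF sX u(1) x0])
        finally show "ginv u \<circ> v \<circ> u \<in> A" using oX(4)[OF c u(1)] A_iff by blast
      qed simp
      obtain h where h: "h \<in> GLn n" "\<forall>e \<in> W. h e = u e"
      proof (rule GLn_extend[OF GL_linear[OF uG], of W "{0}" n])
        have inj: "inj u" using GL_bij[OF uG] by (rule bij_is_inj)
        then show "inj_on u W" by (rule inj_on_subset) simp
        show "u e = e" if "e \<in> {0} \<or> u e \<in> {0}" for e
          using that injD[OF inj, of e 0] VV.linear_0[OF GL_linear[OF uG]] by auto
      qed (use finW elim \<open>u ` W \<subseteq> Vn n\<close> V.subspace_single_0 in auto)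
      have hG: "h \<in> carrier GL_inf" using h(1) by (rule GLn_carrier)
      let ?a = "ginv u \<circ> h"
      have "?a \<in> carrier GL_inf" using GL.m_closed[OF GL.inv_closed[OF uG] hG] by simp
      then have "?a \<in> pointwise_stab W" using h(2) uG by (simp add: pointwise_stab_iff)
      then have a: "?a \<in> defgrp X" "act X ?a x0 = x0" using WA by (auto simp: A_iff)
      have hu: "h = u \<circ> ?a" using uG by (simp add: fun_eq_iff)
      have "h \<in> defgrp X" by (subst hu) (rule oX(4)[OF u(1) a(1)])
      moreover have "act X h x0 = x" by (subst hu) (simp add: smoothD(4)[OF sX u(1) a(1) x0] a(2) u(2))
      ultimately show ?thesis using h(1) by blast
    qed
    show ?case
    proof (intro ballI)
      fix x y assume xy: "x \<in> fixedpts n X" "y \<in> fixedpts n X"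
      obtain h where h: "h \<in> GLn n" "h \<in> defgrp X" "act X h x0 = x" using *[OF xy(1)] by blast
      obtain k where k: "k \<in> GLn n" "k \<in> defgrp X" "act X k x0 = y" using *[OF xy(2)] by blast
      have "act X (k \<circ> ginv h) x = y"
        using smoothD(4)[OF sX k(2) oX(5)[OF h(2)], of x] act_inv(1)[OF sX h(2) x0] smoothD(2)[OF sX h(2) x0] h k by simp
      moreover have "k \<circ> ginv h \<in> GLn n \<inter> defgrp X"
        using GLn_comp[OF k(1) GLn_m_inv[OF h(1)]] oX(4)[OF k(2) oX(5)[OF h(2)]] by simp
      ultimately show "\<exists>h \<in> GLn n \<inter> defgrp X. act X h x = y" by blast
    qed
  qed
qed

lemma finite_fixedpts_transitive:
  fixes X :: "('f::{field,finite}, 'x) glset"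
  assumes X: "X \<in> FinSets" and tr: "transitive_gset GL_inf X"
  shows "\<forall>\<^sub>F n in sequentially. finite (fixedpts n X)"
  using fixedpts_transitive[OF X tr]
proof eventually_elim
  case (elim n)
  show ?case
  proof (cases "fixedpts n X = {}")
    case False
    then obtain x where x: "x \<in> fixedpts n X" by blast
    have "fixedpts n X \<subseteq> (\<lambda>h. act X h x) ` GLn n"
    proof
      fix y assume "y \<in> fixedpts n X"
      with elim x obtain h where "h \<in> GLn n" "act X h x = y" by blast
      then show "y \<in> (\<lambda>h. act X h x) ` GLn n" by blast
    qed
    then show ?thesis by (rule finite_surj[OF finite_GLn])
  qed simp
qed

lemma finite_fixedpts:
  fixes X :: "('f::{field,finite}, 'x) glset"
  assumes X: "X \<in> FinSets"
  shows "\<forall>\<^sub>F n in sequentially. finite (fixedpts n X)"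
proof -
  note sX = FinSetsD[OF X]
  note D = smoothD(1)[OF sX]
  let ?P = "orb (act X) (defgrp X) ` pts X"
  have "\<forall>P \<in> ?P. \<forall>\<^sub>F n in sequentially. finite (fixedpts n (restr (defgrp X) P X))"
    using finite_fixedpts_transitive FinSets_orbit[OF X D order_refl] by blast
  then have "\<forall>\<^sub>F n in sequentially. \<forall>P \<in> ?P. finite (fixedpts n (restr (defgrp X) P X))"
    using finite_orbits[OF X D order_refl] by (intro eventually_ball_finite)
  then show ?thesis
  proof eventually_elim
    case (elim n)
    have "fixedpts n X \<subseteq> (\<Union>P\<in>?P. fixedpts n (restr (defgrp X) P X))"
      using orb_self[OF sX D] by (auto simp: fixedpts_def)
    moreover have "finite (\<Union>P\<in>?P. fixedpts n (restr (defgrp X) P X))"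
      using finite_orbits[OF X D order_refl] elim by blast
    ultimately show ?case by (rule finite_subset)
  qed
qed

subsection \<open>Compatibility with the relations\<close>

lemma fixcount_iso:
  fixes X :: "('f::{field,finite}, 'x) glset" and Y :: "('f, 'y) glset"
  assumes X: "smooth X" and iso: "ghat_iso GL_inf GL_inf_top X Y"
  shows "\<forall>\<^sub>F n in sequentially. fixcount n X = fixcount n Y"
proof -
  obtain f U where U: "opsub U" "U \<subseteq> defgrp X" "U \<subseteq> defgrp Y" and eq: "equivariant_map U X Y f"
    and bij: "bij_betw f (pts X) (pts Y)"
    using iso by (auto simp: ghat_iso_def ghat_map_def)
  show ?thesis using opsubD(6)[OF U(1)]
  proof eventually_elim
    case (elim n)
    have fixed: "f x \<in> fixedpts n Y \<longleftrightarrow> x \<in> fixedpts n X" if x: "x \<in> pts X" for x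
    proof -
      have fx: "f x \<in> pts Y" using bij x by (auto simp: bij_betw_def)
      have "act Y u (f x) = f x \<longleftrightarrow> act X u x = x" if u: "u \<in> Ufix n" for u
      proof -
        have "u \<in> U" using u elim by blast
        then have "act Y u (f x) = f (act X u x)" "act X u x \<in> pts X"
          using eq x U(2) smoothD(2)[OF X, of u x] by (auto simp: equivariant_map_def)
        then show ?thesis using bij x by (auto simp: bij_betw_def dest: inj_onD)
      qed
      then show ?thesis using fx x by (auto simp: fixedpts_def)
    qed
    have "f ` fixedpts n X = fixedpts n Y"
    proof (intro equalityI subsetI)
      fix y assume "y \<in> f ` fixedpts n X"
      then show "y \<in> fixedpts n Y" using fixed by (auto simp: fixedpts_def)
    next
      fix y assume y: "y \<in> fixedpts n Y"
      then obtain x where "x \<in> pts X" "y = f x" using bij by (auto simp: bij_betw_def fixedpts_def)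
      then show "y \<in> f ` fixedpts n X" using fixed[of x] y by blast
    qed
    moreover have "inj_on f (fixedpts n X)"
      using bij by (auto simp: bij_betw_def fixedpts_def intro: inj_on_subset)
    ultimately show ?case unfolding fixcount_def using card_image by metis
  qed
qed

lemma fixcount_coprod:
  fixes X :: "('f::{field,finite}, 'x) glset" and Y :: "('f, 'y) glset"
  assumes X: "X \<in> FinSets" and Y: "Y \<in> FinSets"
  shows "\<forall>\<^sub>F n in sequentially. fixcount n (gset_coprod X Y) = fixcount n X + fixcount n Y"
  using finite_fixedpts[OF X] finite_fixedpts[OF Y]
proof eventually_elim
  case (elim n)
  have "fixedpts n (gset_coprod X Y) = fixedpts n X <+> fixedpts n Y"
    by (auto simp: fixedpts_def gset_coprod_def)
  then show ?case using elim by (simp add: fixcount_def card_Plus)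
qed

lemma fixcount_singleton:
  assumes X: "smooth X" and s: "is_singleton (pts X)"
  shows "\<forall>\<^sub>F n in sequentially. fixcount n X = 1"
  using opsubD(6)[OF smoothD(1)[OF X]]
proof eventually_elim
  case (elim n)
  obtain x where x: "pts X = {x}" using s by (auto simp: is_singleton_def)
  then have "fixedpts n X = {x}"
    using smoothD(2)[OF X, of _ x] elim by (auto simp: fixedpts_def)
  then show ?case by (simp add: fixcount_def)
qed

text \<open>For large \<open>n\<close> the element \<open>g\<close> preserves \<open>V\<^sub>n\<close> and normalizes \<open>U\<^sub>n\<close>.\<close>

lemma fixcount_conj:
  fixes X :: "('f::{field,finite}, 'x) glset"
  assumes g: "g \<in> carrier GL_inf"
  shows "\<forall>\<^sub>F n in sequentially. fixcount n (gset_conj GL_inf X g) = fixcount n X"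
proof -
  obtain k where k: "g \<in> GLn k" using g by (auto simp: GL_inf_def)
  show ?thesis using eventually_ge_at_top[of k]
  proof eventually_elim
    case (elim n)
    have "(\<forall>u \<in> Ufix n. act X (ginv g \<circ> u \<circ> g) x = x) \<longleftrightarrow> (\<forall>u \<in> Ufix n. act X u x = x)" for x
    proof
      assume a: "\<forall>u \<in> Ufix n. act X (ginv g \<circ> u \<circ> g) x = x"
      show "\<forall>u \<in> Ufix n. act X u x = x"
      proof
        fix u :: "'f vmap" assume "u \<in> Ufix n"
        then have "act X (ginv g \<circ> (g \<circ> u \<circ> ginv g) \<circ> g) x = x"
          using a conj_Ufix(1)[OF k elim] by blast
        moreover have "ginv g \<circ> (g \<circ> u \<circ> ginv g) \<circ> g = u" using g by (simp add: fun_eq_iff)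
        ultimately show "act X u x = x" by simp
      qed
    qed (use conj_Ufix(2)[OF k elim] in blast)
    then have "fixedpts n (gset_conj GL_inf X g) = fixedpts n X"
      unfolding fixedpts_def gset_conj_def by simp
    then show ?case by (simp add: fixcount_def)
  qed
qed

text \<open>An element of \<open>GL\<^sub>n\<close> that moves one fixed point of \<open>Y\<close> to another normalizes \<open>U\<^sub>n\<close>, so it maps the
fixed points in one fiber bijectively to those in the other.\<close>

lemma fixcount_fiber:
  fixes X Y :: "('f::{field,finite}, 'x) glset"
  assumes X: "X \<in> FinSets" and Y: "Y \<in> FinSets" and XY: "defgrp X = defgrp Y"
    and trY: "transitive_gset GL_inf Y" and f: "equivariant_map (defgrp Y) X Y f" and y: "y \<in> pts Y"
  shows "\<forall>\<^sub>F n in sequentially. fixcount n X = fixcount n (gset_fiber GL_inf X Y f y) * fixcount n Y"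
proof -
  note sX = FinSetsD[OF X] and sY = FinSetsD[OF Y]
  have fpts: "\<And>x. x \<in> pts X \<Longrightarrow> f x \<in> pts Y"
    and feq: "\<And>g x. g \<in> defgrp Y \<Longrightarrow> x \<in> pts X \<Longrightarrow> f (act X g x) = act Y g (f x)"
    using f by (auto simp: equivariant_map_def)
  show ?thesis
    using finite_fixedpts[OF X] finite_fixedpts[OF Y] fixedpts_transitive[OF Y trY]
      opsubD(6)[OF smoothD(1)[OF sY]] smoothD(5)[OF sY y]
  proof eventually_elim
    case (elim n)
    define Fib where "Fib y' = {x \<in> fixedpts n X. f x = y'}" for y'
    have yfix: "y \<in> fixedpts n Y" using elim y by (simp add: fixedpts_def)
    have fibF: "fixedpts n (gset_fiber GL_inf X Y f y) = Fib y"
      by (auto simp: Fib_def fixedpts_def gset_fiber_def)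
    have im: "f ` fixedpts n X \<subseteq> fixedpts n Y"
      using fpts feq elim(4) by (force simp: fixedpts_def)
    have le: "card (Fib y1) \<le> card (Fib y2)" if y12: "y1 \<in> fixedpts n Y" "y2 \<in> fixedpts n Y" for y1 y2
    proof -
      obtain h where h: "h \<in> GLn n" "h \<in> defgrp Y" "act Y h y1 = y2" using elim(3) y12 by blast
      have hX: "h \<in> defgrp X" using h XY by simp
      have "act X h x \<in> Fib y2" if x: "x \<in> Fib y1" for x
      proof -
        have xX: "x \<in> pts X" "f x = y1" using x by (auto simp: Fib_def fixedpts_def)
        have hx: "act X h x \<in> pts X" by (rule smoothD(2)[OF sX hX xX(1)])
        have "act X u (act X h x) = act X h x" if u: "u \<in> Ufix n" for u
        proof -
          have v: "ginv h \<circ> u \<circ> h \<in> Ufix n" by (rule conj_Ufix(2)[OF h(1) order_refl u])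
          have uX: "u \<in> defgrp X" and vX: "ginv h \<circ> u \<circ> h \<in> defgrp X" using u v elim(4) XY by auto
          have "act X u (act X h x) = act X (u \<circ> h) x" using smoothD(4)[OF sX uX hX xX(1)] by simp
          also have "u \<circ> h = h \<circ> (ginv h \<circ> u \<circ> h)" using GLn_carrier[OF h(1)] by (simp add: fun_eq_iff)
          also have "act X \<dots> x = act X h (act X (ginv h \<circ> u \<circ> h) x)" by (rule smoothD(4)[OF sX hX vX xX(1)])
          also have "act X (ginv h \<circ> u \<circ> h) x = x" using x v by (simp add: Fib_def fixedpts_def)
          finally show ?thesis .
        qed
        moreover have "f (act X h x) = y2" using feq[OF h(2) xX(1)] h(3) xX(2) by simp
        ultimately show ?thesis using hx by (simp add: Fib_def fixedpts_def)
      qed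
      moreover have "inj_on (act X h) (Fib y1)"
      proof (rule inj_onI)
        fix a b assume ab: "a \<in> Fib y1" "b \<in> Fib y1" "act X h a = act X h b"
        have "a = act X (ginv h) (act X h a)"
          by (rule act_inv(1)[OF sX hX, symmetric]) (use ab in \<open>simp add: Fib_def fixedpts_def\<close>)
        also have "\<dots> = act X (ginv h) (act X h b)" by (simp only: ab(3))
        also have "\<dots> = b"
          by (rule act_inv(1)[OF sX hX]) (use ab in \<open>simp add: Fib_def fixedpts_def\<close>)
        finally show "a = b" .
      qed
      moreover have "finite (Fib y2)" using elim(1) by (simp add: Fib_def)
      ultimately show ?thesis by (intro card_inj_on_le[of "act X h"]) auto
    qed
    have "card (fixedpts n X) = (\<Sum>y'\<in>fixedpts n Y. card (Fib y'))"
      using sum.group[OF elim(1) elim(2) im, of "\<lambda>_. 1::nat"] by (simp add: Fib_def)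
    also have "\<dots> = (\<Sum>y'\<in>fixedpts n Y. card (Fib y))"
      using le yfix by (intro sum.cong refl) (simp add: le_antisym)
    finally show ?case by (simp add: fixcount_def fibF)
  qed
qed

definition fixval :: "nat \<Rightarrow> ('f::field, 'x) glset int_mpoly \<Rightarrow> int" where
  "fixval n = mpoly_eval (fixcount n)"

text \<open>Elements with eventually vanishing count form an ideal, and the lemmas above say that it contains
the generators of the ideal of relations.\<close>

theorem fixval_theta_ideal:
  fixes x :: "('f::{field,finite}, 'x) glset int_mpoly"
  assumes "x \<in> ThetaI"
  shows "\<forall>\<^sub>F n in sequentially. fixval n x = 0"
proof -
  define J where "J = {x \<in> FC. \<forall>\<^sub>F n in sequentially. fixval n (x :: ('f, 'x) glset int_mpoly) = 0}"
  let ?R = "free_cring (FinSets :: ('f, 'x) glset set)"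
  interpret R: cring ?R by (rule cring_free_cring)
  have mult: "a * x \<in> J" if "x \<in> J" "a \<in> FC" for a x
  proof -
    have "\<forall>\<^sub>F n in sequentially. fixval n x = 0" using that by (simp add: J_def)
    then have "\<forall>\<^sub>F n in sequentially. fixval n (a * x) = 0"
      by eventually_elim (simp add: fixval_def mpoly_eval_mult)
    then show ?thesis using that by (simp add: J_def free_cring_mult)
  qed
  have add: "x + y \<in> J" if "x \<in> J" "y \<in> J" for x y
  proof -
    have "\<forall>\<^sub>F n in sequentially. fixval n x = 0" "\<forall>\<^sub>F n in sequentially. fixval n y = 0"
      using that by (simp_all add: J_def)
    then have "\<forall>\<^sub>F n in sequentially. fixval n (x + y) = 0"
      by eventually_elim (simp add: fixval_def mpoly_eval_add)
    then show ?thesis using that by (simp add: J_def free_cring_add)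
  qed
  have zero: "0 \<in> J" by (simp add: J_def free_cring_zero fixval_def)
  have neg: "- x \<in> J" if "x \<in> J" for x using mult[OF that free_cring_of_int[of "-1"]] by simp
  have JF: "J \<subseteq> FC" by (auto simp: J_def)
  have "ideal J ?R"
  proof (rule idealI[OF R.ring_axioms])
    show "subgroup J (add_monoid ?R)"
    proof (rule R.add.subgroupI)
      show "J \<subseteq> carrier ?R" "J \<noteq> {}" using JF zero by auto
      fix a b assume a: "a \<in> J" and b: "b \<in> J"
      show "a \<oplus>\<^bsub>?R\<^esub> b \<in> J" using add[OF a b] by simp
      have "a \<in> carrier ?R" "- a \<in> carrier ?R" using a JF free_cring_uminus by auto
      then have "\<ominus>\<^bsub>?R\<^esub> a = - a" by (intro R.minus_equality) simp_all
      then show "\<ominus>\<^bsub>?R\<^esub> a \<in> J" using neg[OF a] by simp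
    qed
    fix a x assume "a \<in> J" "x \<in> carrier ?R"
    then show "x \<otimes>\<^bsub>?R\<^esub> a \<in> J" "a \<otimes>\<^bsub>?R\<^esub> x \<in> J" using mult[of a x] by (simp_all add: mult.commute)
  qed
  moreover have "ThetaR \<subseteq> J"
  proof
    fix r :: "('f, 'x) glset int_mpoly" assume r: "r \<in> ThetaR"
    have "\<forall>\<^sub>F n in sequentially. fixval n r = 0"
      using r unfolding theta_rels_def Let_def
    proof (elim UnE CollectE exE conjE)
      fix X Y :: "('f, 'x) glset"
      assume "r = symb X - symb Y" "X \<in> FinSets" "ghat_iso GL_inf GL_inf_top X Y"
      then show ?thesis using fixcount_iso[OF FinSetsD, of X Y] by (simp add: fixval_def mpoly_eval_diff)
    next
      fix X :: "('f, 'x) glset"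
      assume "r = symb X - 1" "X \<in> FinSets" "is_singleton (pts X)"
      then show ?thesis using fixcount_singleton[OF FinSetsD, of X] by (simp add: fixval_def mpoly_eval_diff)
    next
      fix X Y Z :: "('f, 'x) glset"
      assume r: "r = symb Z - (symb X + symb Y)" and XYZ: "X \<in> FinSets" "Y \<in> FinSets" "Z \<in> FinSets"
        and "ghat_iso GL_inf GL_inf_top Z (gset_coprod X Y)"
      then have "\<forall>\<^sub>F n in sequentially. fixcount n Z = fixcount n (gset_coprod X Y)"
        by (intro fixcount_iso[OF FinSetsD])
      with fixcount_coprod[OF XYZ(1,2)] show ?thesis
        by eventually_elim (simp add: r fixval_def mpoly_eval_diff mpoly_eval_add)
    next
      fix X :: "('f, 'x) glset" and g
      assume r: "r = symb X - symb (gset_conj GL_inf X g)" and "g \<in> carrier GL_inf"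
      from fixcount_conj[OF this(2), of X] show ?thesis
        by eventually_elim (simp add: r fixval_def mpoly_eval_diff)
    next
      fix X Y :: "('f, 'x) glset" and f y
      assume r: "r = symb X - symb (gset_fiber GL_inf X Y f y) * symb Y" and XY: "X \<in> FinSets" "Y \<in> FinSets"
        "defgrp X = defgrp Y" "transitive_gset GL_inf Y" "equivariant_map (defgrp Y) X Y f" "y \<in> pts Y"
      from fixcount_fiber[OF XY] show ?thesis
        by eventually_elim (simp add: r fixval_def mpoly_eval_diff mpoly_eval_mult)
    qed
    then show "r \<in> J" using theta_rels_FC r by (auto simp: J_def)
  qed
  ultimately have "ThetaI \<subseteq> J"
    unfolding theta_ideal_def by (rule R.genideal_minimal)
  then show ?thesis using assms by (auto simp: J_def)
qed

section \<open>The number of fixed points on \<open>\<Omega>\<^sub>m\<^sub>,\<^sub>d\<close>\<close>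

fun indep_over :: "'f::field fsv set \<Rightarrow> 'f fsv list \<Rightarrow> bool" where
  "indep_over C [] \<longleftrightarrow> True"
| "indep_over C (v # vs) \<longleftrightarrow> v \<notin> V.span (C \<union> set vs) \<and> indep_over C vs"

text \<open>Sequences in \<open>E\<close> that are linearly independent modulo \<open>C\<close>.  Counting them in two ways gives the
number of subspaces of a given dimension between \<open>C\<close> and \<open>E\<close>.\<close>

definition frames :: "'f::field fsv set \<Rightarrow> 'f fsv set \<Rightarrow> nat \<Rightarrow> 'f fsv list set" where
  "frames C E d = {vs. length vs = d \<and> set vs \<subseteq> E \<and> indep_over C vs}"

lemma card_span_indep_over:
  fixes C :: "'f::{field,finite} fsv set"
  assumes C: "finsub C"
  shows "indep_over C vs \<Longrightarrow> finite (V.span (C \<union> set vs)) \<and>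
    card (V.span (C \<union> set vs)) = card C * card (UNIV :: 'f set) ^ length vs"
proof (induction vs)
  case Nil
  have "V.span C = C" using C by (simp only: V.span_eq_iff[of C, THEN iffD2])
  with C show ?case by (simp del: V.span_eq_iff)
next
  case (Cons v vs)
  then have "v \<notin> V.span (C \<union> set vs)" "finite (V.span (C \<union> set vs))" by auto
  from card_span_insert[OF this] show ?case using Cons by simp
qed

lemma card_frames:
  fixes C E :: "'f::{field,finite} fsv set"
  assumes C: "finsub C" and E: "finsub E" and CE: "C \<subseteq> E"
  shows "finite (frames C E d) \<and>
    card (frames C E d) = (\<Prod>i<d. card E - card C * card (UNIV :: 'f set) ^ i)"
proof (induction d)
  case 0
  have "frames C E 0 = {[]}" by (auto simp: frames_def)
  then show ?case by simp
next
  case (Suc d)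
  let ?S = "SIGMA vs:frames C E d. E - V.span (C \<union> set vs)"
  have eq: "frames C E (Suc d) = (\<lambda>(vs, v). v # vs) ` ?S"
  proof (intro equalityI subsetI)
    fix ws assume ws: "ws \<in> frames C E (Suc d)"
    then obtain v vs where v: "ws = v # vs" by (cases ws) (auto simp: frames_def)
    show "ws \<in> (\<lambda>(vs, v). v # vs) ` ?S"
      by (rule image_eqI[of _ _ "(vs, v)"]) (use ws v in \<open>auto simp: frames_def\<close>)
  qed (auto simp: frames_def)
  have c: "card (E - V.span (C \<union> set vs)) = card E - card C * card (UNIV :: 'f set) ^ d"
    if "vs \<in> frames C E d" for vs
  proof -
    have sub: "V.span (C \<union> set vs) \<subseteq> E"
      using that CE E by (intro V.span_minimal) (auto simp: frames_def)
    then show ?thesis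
      using card_span_indep_over[OF C, of vs] that E by (simp add: card_Diff_subset frames_def)
  qed
  have "card (frames C E (Suc d)) = card ?S"
    unfolding eq by (rule card_image) (auto simp: inj_on_def)
  also have "\<dots> = (\<Sum>vs\<in>frames C E d. card (E - V.span (C \<union> set vs)))"
    using Suc E by (intro card_SigmaI) auto
  also have "\<dots> = card (frames C E d) * (card E - card C * card (UNIV :: 'f set) ^ d)"
    using c by simp
  finally have "card (frames C E (Suc d)) = \<dots>" .
  moreover have "finite (frames C E (Suc d))"
    unfolding eq using Suc E by (intro finite_imageI finite_SigmaI) auto
  ultimately show ?case using Suc by simp
qed

text \<open>Together with \<open>C\<close>, a sequence spans exactly one subspace \<open>W\<close>, and it is a basis of \<open>W\<close> modulo \<open>C\<close>.\<close>

lemma card_frames_by_span: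
  fixes C E :: "'f::{field,finite} fsv set" and d :: nat
  assumes C: "finsub C" and E: "finsub E" and CE: "C \<subseteq> E"
  defines "N \<equiv> {W. finsub W \<and> C \<subseteq> W \<and> W \<subseteq> E \<and> card W = card C * card (UNIV :: 'f set) ^ d}"
  shows "card (frames C E d) = card N * (\<Prod>i<d. card C * card (UNIV :: 'f set) ^ d - card C * card (UNIV :: 'f set) ^ i)"
proof -
  have finN: "finite N"
    by (rule finite_subset[of _ "Pow E"]) (use E in \<open>auto simp: N_def\<close>)
  have sp: "V.span (C \<union> set vs) = W" if W: "W \<in> N" and vs: "vs \<in> frames C W d" for W vs
  proof (rule card_subset_eq)
    show "finite W" using W by (simp add: N_def)
    show "V.span (C \<union> set vs) \<subseteq> W"
      by (intro V.span_minimal) (use W vs in \<open>auto simp: N_def frames_def\<close>)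
    show "card (V.span (C \<union> set vs)) = card W"
      using card_span_indep_over[OF C, of vs] W vs by (simp add: N_def frames_def)
  qed
  have eq: "frames C E d = (\<Union>W\<in>N. frames C W d)"
  proof (intro equalityI subsetI)
    fix vs assume vs: "vs \<in> frames C E d"
    let ?W = "V.span (C \<union> set vs)"
    have "?W \<subseteq> E" using vs CE E by (intro V.span_minimal) (auto simp: frames_def)
    then have "?W \<in> N"
      using card_span_indep_over[OF C, of vs] vs V.span_superset[of "C \<union> set vs"]
      by (auto simp: N_def frames_def)
    moreover have "vs \<in> frames C ?W d" using vs V.span_superset[of "C \<union> set vs"] by (auto simp: frames_def)
    ultimately show "vs \<in> (\<Union>W\<in>N. frames C W d)" by blast
  next
    fix vs assume "vs \<in> (\<Union>W\<in>N. frames C W d)"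
    then show "vs \<in> frames C E d" by (auto simp: frames_def N_def)
  qed
  have "card (frames C E d) = (\<Sum>W\<in>N. card (frames C W d))"
    unfolding eq
  proof (rule card_UN_disjoint[OF finN])
    show "\<forall>W\<in>N. finite (frames C W d)" using card_frames[OF C] by (auto simp: N_def)
    show "\<forall>W\<in>N. \<forall>W'\<in>N. W \<noteq> W' \<longrightarrow> frames C W d \<inter> frames C W' d = {}" using sp by blast
  qed
  also have "\<dots> = (\<Sum>W\<in>N. \<Prod>i<d. card C * card (UNIV :: 'f set) ^ d - card C * card (UNIV :: 'f set) ^ i)"
  proof (rule sum.cong[OF refl])
    fix W assume "W \<in> N"
    then show "card (frames C W d) = (\<Prod>i<d. card C * card (UNIV :: 'f set) ^ d - card C * card (UNIV :: 'f set) ^ i)"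
      using card_frames[OF C, of W d] by (simp add: N_def)
  qed
  finally show ?thesis by simp
qed

text \<open>A finite set of vectors that is stable under \<open>U\<^sub>n\<close> lies in \<open>V\<^sub>n\<close>, because a generic element of
\<open>U\<^sub>n\<close> moves it away from itself outside of \<open>V\<^sub>n\<close>.\<close>

lemma fixedpts_Omega:
  fixes m n d :: nat
  shows "fixedpts n (Omega m d) = {W \<in> Omega_pts m d. W \<subseteq> (Vn n :: 'f::{field,finite} fsv set)}"
proof (intro equalityI subsetI)
  fix W :: "'f fsv set" assume W: "W \<in> fixedpts n (Omega m d)"
  then have WO: "W \<in> Omega_pts m d" by (simp add: fixedpts_def)
  then have "finite W" by (simp add: Omega_pts_iff)
  then obtain k where k: "k \<in> Ufix n" "k ` W \<inter> W \<subseteq> Vn n"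
    using generic_translate[of "Vn n" W W] by auto
  moreover have "k ` W = W" using W WO k(1) by (simp add: fixedpts_def)
  ultimately show "W \<in> {W \<in> Omega_pts m d. W \<subseteq> Vn n}" using WO by simp
next
  fix W :: "'f fsv set" assume W: "W \<in> {W \<in> Omega_pts m d. W \<subseteq> Vn n}"
  have "u ` W = W" if "u \<in> Ufix n" for u
  proof -
    have "u ` W = id ` W" using that W by (intro image_cong) (auto simp: pointwise_stab_iff)
    then show ?thesis by simp
  qed
  then show "W \<in> fixedpts n (Omega m d)" using W by (simp add: fixedpts_def)
qed

lemma fixcount_Omega:
  fixes m d n :: nat
  defines "q \<equiv> card (UNIV :: 'f::{field,finite} set)"
  assumes n: "n \<ge> m + d"
  shows "of_int (fixcount n (Omega m d :: ('f, 'f fsv set) glset)) = poly (omega q m d) (qint q n)"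
proof -
  have q: "q > 1" unfolding q_def by (rule card_field_gt_1)
  let ?C = "Vn m :: 'f fsv set" and ?E = "Vn n :: 'f fsv set"
  let ?N = "{W. finsub W \<and> ?C \<subseteq> W \<and> W \<subseteq> ?E \<and> card W = card ?C * card (UNIV :: 'f set) ^ d}"
  have CE: "?C \<subseteq> ?E" using n by (intro Vn_mono) simp
  have "fixedpts n (Omega m d) = ?N"
    unfolding fixedpts_Omega by (auto simp: Omega_pts_iff card_Vn power_add mult.commute)
  then have N: "of_int (fixcount n (Omega m d :: ('f, 'f fsv set) glset)) = (of_nat (card ?N) :: rat)"
    by (simp add: fixcount_def)
  define K :: rat where "K = of_nat q ^ m * (of_nat q - 1)"
  have K: "K \<noteq> 0" using q by (simp add: K_def)
  \<comment> \<open>The factor \<open>K\<close> is common to all terms of both products and cancels, leaving the quotient that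
defines \<open>\<omega>\<^sub>0\<^sub>,\<^sub>d\<close>.\<close>
  have diff: "(of_nat (q ^ m * q ^ k - q ^ m * q ^ i) :: rat) = K * (qint q k - qint q i)" if "i \<le> k" for i k
  proof -
    have "q ^ m * q ^ i \<le> q ^ m * q ^ k" using that q by (intro mult_le_mono2 power_increasing) auto
    then have "(of_nat (q ^ m * q ^ k - q ^ m * q ^ i) :: rat) = of_nat q ^ m * (of_nat q ^ k - of_nat q ^ i)"
      by (simp add: of_nat_diff right_diff_distrib)
    also have "of_nat q ^ k - of_nat q ^ i = (of_nat q - 1) * qint q k - (of_nat q - 1) * qint q i"
      by (simp add: qint_closed_form)
    also have "\<dots> = (of_nat q - 1) * (qint q k - qint q i)" by (simp only: right_diff_distrib)
    finally show ?thesis by (simp only: K_def mult.assoc)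
  qed
  have E: "card ?E = q ^ m * q ^ (n - m)" using n by (simp add: card_Vn q_def flip: power_add)
  have "card ?N * (\<Prod>i<d. q ^ m * q ^ d - q ^ m * q ^ i) = (\<Prod>i<d. q ^ m * q ^ (n - m) - q ^ m * q ^ i)"
    using card_frames_by_span[of ?C ?E d] card_frames[of ?C ?E d] CE by (simp add: E) (simp add: card_Vn q_def)
  from arg_cong[OF this, of "of_nat :: nat \<Rightarrow> rat"]
  have "of_nat (card ?N) * (\<Prod>i<d. of_nat (q ^ m * q ^ d - q ^ m * q ^ i)) = (\<Prod>i<d. (of_nat (q ^ m * q ^ (n - m) - q ^ m * q ^ i) :: rat))"
    by (simp only: of_nat_mult of_nat_prod)
  also have "(\<Prod>i<d. (of_nat (q ^ m * q ^ d - q ^ m * q ^ i) :: rat)) = (\<Prod>i<d. K * (qint q d - qint q i))"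
    by (intro prod.cong refl diff) auto
  also have "(\<Prod>i<d. (of_nat (q ^ m * q ^ (n - m) - q ^ m * q ^ i) :: rat)) = (\<Prod>i<d. K * (qint q (n - m) - qint q i))"
    using n by (intro prod.cong refl diff) auto
  finally have "of_nat (card ?N) * (K ^ d * omega_denom q d) = K ^ d * (\<Prod>i<d. qint q (n - m) - qint q i)"
    by (simp add: prod.distrib omega_denom_eq)
  then have "of_nat (card ?N) * omega_denom q d = (\<Prod>i<d. qint q (n - m) - qint q i)"
    using K by simp
  then have "of_nat (card ?N) = poly (omega0 q d) (qint q (n - m))"
    using omega_denom_pos[of q d] q by (simp add: poly_omega0 field_simps)
  then show ?thesis using poly_omega_shift[of q m d "n - m"] q n N by simp
qed

section \<open>The isomorphism\<close>

lemma fixval_comb: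
  fixes c :: "nat \<Rightarrow> int"
  defines "q \<equiv> card (UNIV :: 'f::{field,finite} set)"
  shows "\<forall>\<^sub>F n in sequentially.
    of_int (fixval n (Omega_comb m D c :: ('f, 'f fsv set) glset int_mpoly))
      = poly (omega_comb q m D c) (qint q n)"
  using eventually_ge_at_top[of "m + D"]
proof eventually_elim
  case (elim n)
  have "of_int (fixcount n (Omega m d :: ('f, 'f fsv set) glset)) = poly (omega q m d) (qint q n)" if "d < D" for d
    unfolding q_def by (rule fixcount_Omega) (use that elim in simp)
  then show ?case
    by (simp add: fixval_def mpoly_eval_sum mpoly_eval_mult poly_sum)
qed

lemma comb_FC: "Omega_comb m D c \<in> FC"
  by (intro free_cring_sum free_cring_mult free_cring_of_int FC_Omega)

lemma fixval_cong:
  assumes "x \<approx> y" shows "\<forall>\<^sub>F n in sequentially. fixval n x = fixval n y"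
proof -
  have "\<forall>\<^sub>F n in sequentially. fixval n (x - y) = 0" using assms by (intro fixval_theta_ideal) (simp add: theta_eq_def)
  then show ?thesis by eventually_elim (simp add: fixval_def mpoly_eval_diff)
qed

text \<open>Modulo the relations \<open>x\<close> is a combination of the \<open>\<Omega>\<^sub>m\<^sub>,\<^sub>d\<close> for a single \<open>m\<close>.  Its count is the
corresponding combination of the \<open>\<omega>\<^sub>m\<^sub>,\<^sub>d\<close>, which are linearly independent.\<close>

theorem theta_ideal_eq:
  fixes x :: "('f::{field,finite}, 'f fsv set) glset int_mpoly"
  assumes x: "x \<in> FC" and zero: "\<forall>\<^sub>F n in sequentially. fixval n x = 0"
  shows "x \<in> ThetaI"
proof -
  let ?q = "card (UNIV :: 'f set)"
  have q: "?q > 0" using card_field_gt_1[where 'f = 'f] by simp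
  obtain m where "spanned m x" using eventually_spanned[OF x] by (auto dest: eventually_happens)
  then obtain D and c :: "nat \<Rightarrow> int" where xy: "x \<approx> Omega_comb m D c"
    by (auto simp: spanned_def)
  have "\<forall>\<^sub>F n in sequentially. poly (omega_comb ?q m D c) (qint ?q n) = poly 0 (qint ?q n)"
    using zero fixval_cong[OF xy] fixval_comb[where 'f = 'f and D = D and c = c and m = m]
    by eventually_elim simp
  then have "omega_comb ?q m D c = 0" by (rule poly_eq_if_eventually_eq[OF q])
  then have "c d = 0" if "d < D" for d using omega_independent[OF q _ that] by blast
  then have "(Omega_comb m D c :: ('f, 'f fsv set) glset int_mpoly) = 0" by simp
  with xy show ?thesis by (simp add: theta_eq_def)
qed

text \<open>The value of the isomorphism at \<open>p\<close>.\<close>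

definition germ_class :: "rat poly \<Rightarrow> ('f::{field,finite}, 'f fsv set) glset int_mpoly set" where
  "germ_class p = {x \<in> FC. \<forall>\<^sub>F n in sequentially.
     of_int (fixval n x) = poly p (qint (card (UNIV :: 'f set)) n)}"

lemma germ_class_coset:
  fixes x :: "('f::{field,finite}, 'f fsv set) glset int_mpoly"
  assumes x: "x \<in> germ_class p"
  shows "germ_class p = ThetaI +>\<^bsub>free_cring FinSets\<^esub> x"
proof -
  let ?I = "ThetaI :: ('f, 'f fsv set) glset int_mpoly set"
  have xF: "x \<in> FC" and xp: "\<forall>\<^sub>F n in sequentially. of_int (fixval n x) = poly p (qint (card (UNIV :: 'f set)) n)"
    using x by (auto simp: germ_class_def)
  have IF: "?I \<subseteq> FC" using additive_subgroup.a_subset[OF ideal.axioms(1)[OF theta_ideal_ideal]] by blast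
  have coset: "?I +>\<^bsub>free_cring FinSets\<^esub> x = {i + x | i. i \<in> ?I}"
    by (auto simp: a_r_coset_def')
  show ?thesis unfolding coset
  proof (intro equalityI subsetI)
    fix y :: "('f, 'f fsv set) glset int_mpoly" assume "y \<in> germ_class p"
    then have y: "y \<in> FC" "\<forall>\<^sub>F n in sequentially. of_int (fixval n y) = poly p (qint (card (UNIV :: 'f set)) n)"
      by (auto simp: germ_class_def)
    have "\<forall>\<^sub>F n in sequentially. fixval n (y - x) = 0"
      using xp y(2)
    proof eventually_elim
      case (elim n)
      then have "(of_int (fixval n y) :: rat) = of_int (fixval n x)" by simp
      then show ?case by (simp add: fixval_def mpoly_eval_diff)
    qed
    then have "y - x \<in> ?I" using y(1) xF by (intro theta_ideal_eq free_cring_diff)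
    then show "y \<in> {i + x | i. i \<in> ?I}" by (intro CollectI exI[of _ "y - x"]) simp
  next
    fix y :: "('f, 'f fsv set) glset int_mpoly" assume "y \<in> {i + x | i. i \<in> ?I}"
    then obtain i where i: "i \<in> ?I" "y = i + x" by blast
    have "\<forall>\<^sub>F n in sequentially. of_int (fixval n y) = poly p (qint (card (UNIV :: 'f set)) n)"
      using xp fixval_theta_ideal[OF i(1)] by eventually_elim (simp add: i(2) fixval_def mpoly_eval_add)
    then show "y \<in> germ_class p" using i IF xF by (auto simp: germ_class_def intro: free_cring_add)
  qed
qed

lemma germ_class_add: "x \<in> germ_class p \<Longrightarrow> y \<in> germ_class r \<Longrightarrow> x + y \<in> germ_class (p + r)"
  and germ_class_mult: "x \<in> germ_class p \<Longrightarrow> y \<in> germ_class r \<Longrightarrow> x * y \<in> germ_class (p * r)"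
proof -
  assume x: "x \<in> germ_class p" and y: "y \<in> germ_class r"
  then have ev: "\<forall>\<^sub>F n in sequentially. of_int (fixval n x) = poly p (qint (card (UNIV :: 'a set)) n)"
    "\<forall>\<^sub>F n in sequentially. of_int (fixval n y) = poly r (qint (card (UNIV :: 'a set)) n)"
    by (auto simp: germ_class_def)
  have "\<forall>\<^sub>F n in sequentially. of_int (fixval n (x + y)) = poly (p + r) (qint (card (UNIV :: 'a set)) n)"
    using ev by eventually_elim (simp add: fixval_def mpoly_eval_add)
  then show "x + y \<in> germ_class (p + r)" using x y by (auto simp: germ_class_def intro: free_cring_add)
  have "\<forall>\<^sub>F n in sequentially. of_int (fixval n (x * y)) = poly (p * r) (qint (card (UNIV :: 'a set)) n)"
    using ev by eventually_elim (simp add: fixval_def mpoly_eval_mult)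
  then show "x * y \<in> germ_class (p * r)" using x y by (auto simp: germ_class_def intro: free_cring_mult)
qed

lemma germ_class_comb:
  "Omega_comb m D c \<in>
    (germ_class (omega_comb (card (UNIV :: 'f::{field,finite} set)) m D c)
      :: ('f, 'f fsv set) glset int_mpoly set)"
  using fixval_comb[where 'f = 'f] comb_FC by (simp add: germ_class_def)

lemma germ_class_omega:
  "symb (Omega m d) \<in> (germ_class (omega (card (UNIV :: 'f::{field,finite} set)) m d)
      :: ('f, 'f fsv set) glset int_mpoly set)"
  using eventually_mono[OF eventually_ge_at_top[of "m + d"] fixcount_Omega[where 'f = 'f]] FC_Omega
  by (simp add: germ_class_def fixval_def)

lemma germ_class_nonempty:
  assumes "p \<in> carrier (R_q_large (card (UNIV :: 'f::{field,finite} set)))"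
  obtains x where "x \<in> (germ_class p :: ('f, 'f fsv set) glset int_mpoly set)"
proof -
  have q: "card (UNIV :: 'f set) > 0" using card_field_gt_1[where 'f = 'f] by simp
  obtain m and D :: nat and c :: "nat \<Rightarrow> int"
    where p: "p = (omega_comb (card (UNIV :: 'f set)) m D c)"
    by (rule R_q_large_spanned[OF q assms])
  show thesis by (rule that) (unfold p, rule germ_class_comb)
qed

lemma ring_iso_germ_class:
  "(\<lambda>p \<in> carrier (R_q_large (card (UNIV :: 'f::{field,finite} set))). germ_class p)
    \<in> ring_iso (R_q_large (card (UNIV :: 'f set)))
        (Theta GL_inf GL_inf_top :: ('f, 'f fsv set) glset int_mpoly set ring)"
proof -
  let ?q = "card (UNIV :: 'f set)"
  have q: "?q > 0" using card_field_gt_1[where 'f = 'f] by simp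
  let ?I = "ThetaI :: ('f, 'f fsv set) glset int_mpoly set"
  let ?R = "free_cring (FinSets :: ('f, 'f fsv set) glset set)"
  let ?T = "Theta GL_inf GL_inf_top :: ('f, 'f fsv set) glset int_mpoly set ring"
  let ?A = "carrier (R_q_large ?q)"
  let ?g = "germ_class :: rat poly \<Rightarrow> ('f, 'f fsv set) glset int_mpoly set"
  interpret R: cring "R_q_large ?q" by (rule cring_R_q_large[OF q])
  interpret I: ideal ?I ?R by (rule theta_ideal_ideal)
  have gF: "x \<in> FC" if "x \<in> ?g p" for x p using that by (simp add: germ_class_def)
  have T: "?T = ?R Quot ?I" by (simp add: Theta_def)
  have carr: "carrier ?T = {?I +>\<^bsub>?R\<^esub> x | x. x \<in> FC}"
    unfolding T FactRing_def A_RCOSETS_def' by auto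
  show ?thesis
  proof (rule ring_iso_memI)
    fix p assume p: "p \<in> ?A"
    obtain x where x: "x \<in> ?g p" by (rule germ_class_nonempty[OF p])
    show "(\<lambda>p \<in> ?A. ?g p) p \<in> carrier ?T"
      using p germ_class_coset[OF x] gF[OF x] unfolding carr by auto
    fix r assume r: "r \<in> ?A"
    obtain y where y: "y \<in> ?g r" by (rule germ_class_nonempty[OF r])
    have pr: "p * r \<in> ?A" "p + r \<in> ?A" using R.m_closed[OF p r] R.a_closed[OF p r] by simp_all
    have "?g (p * r) = ?I +>\<^bsub>?R\<^esub> (x * y)" by (rule germ_class_coset[OF germ_class_mult[OF x y]])
    also have "\<dots> = (?I +>\<^bsub>?R\<^esub> x) \<otimes>\<^bsub>?T\<^esub> (?I +>\<^bsub>?R\<^esub> y)"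
      using I.rcoset_mult_add[OF gF[OF x] gF[OF y]] by (simp add: T FactRing_def)
    finally show "(\<lambda>p \<in> ?A. ?g p) (p \<otimes>\<^bsub>R_q_large ?q\<^esub> r) = (\<lambda>p \<in> ?A. ?g p) p \<otimes>\<^bsub>?T\<^esub> (\<lambda>p \<in> ?A. ?g p) r"
      using p r pr germ_class_coset[OF x] germ_class_coset[OF y] by simp
    have "?g (p + r) = ?I +>\<^bsub>?R\<^esub> (x + y)" by (rule germ_class_coset[OF germ_class_add[OF x y]])
    also have "\<dots> = (?I +>\<^bsub>?R\<^esub> x) \<oplus>\<^bsub>?T\<^esub> (?I +>\<^bsub>?R\<^esub> y)"
      using I.a_rcos_sum[OF gF[OF x] gF[OF y]] by (simp add: T FactRing_def)
    finally show "(\<lambda>p \<in> ?A. ?g p) (p \<oplus>\<^bsub>R_q_large ?q\<^esub> r) = (\<lambda>p \<in> ?A. ?g p) p \<oplus>\<^bsub>?T\<^esub> (\<lambda>p \<in> ?A. ?g p) r"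
      using p r pr germ_class_coset[OF x] germ_class_coset[OF y] by simp
  next
    have "1 \<in> ?g 1" by (simp add: germ_class_def fixval_def free_cring_one)
    then show "(\<lambda>p \<in> ?A. ?g p) \<one>\<^bsub>R_q_large ?q\<^esub> = \<one>\<^bsub>?T\<^esub>"
      using germ_class_coset[of 1 1] R.one_closed by (simp add: T FactRing_def)
  next
    have "inj_on (\<lambda>p \<in> ?A. ?g p) ?A"
    proof (rule inj_onI)
      fix p r assume p: "p \<in> ?A" and r: "r \<in> ?A" and "(\<lambda>p \<in> ?A. ?g p) p = (\<lambda>p \<in> ?A. ?g p) r"
      then have eq: "?g p = ?g r" by simp
      obtain x where x: "x \<in> ?g p" by (rule germ_class_nonempty[OF p])
      have "\<forall>\<^sub>F n in sequentially. of_int (fixval n x) = poly p (qint ?q n)"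
        "\<forall>\<^sub>F n in sequentially. of_int (fixval n x) = poly r (qint ?q n)"
        using x x[unfolded eq] by (auto simp: germ_class_def)
      then have "\<forall>\<^sub>F n in sequentially. poly p (qint ?q n) = poly r (qint ?q n)" by eventually_elim simp
      then show "p = r" by (rule poly_eq_if_eventually_eq[OF q])
    qed
    moreover have "carrier ?T \<subseteq> (\<lambda>p \<in> ?A. ?g p) ` ?A"
    proof
      fix Z assume "Z \<in> carrier ?T"
      then obtain x where x: "x \<in> FC" "Z = ?I +>\<^bsub>?R\<^esub> x" unfolding carr by blast
      obtain m where "spanned m x" using eventually_spanned[OF x(1)] by (auto dest: eventually_happens)
      then obtain D and c :: "nat \<Rightarrow> int" where xy: "x \<approx> Omega_comb m D c"
        by (auto simp: spanned_def)
      let ?p = "\<Sum>d<D. smult (of_int (c d)) (omega ?q m d)"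
      have "\<forall>\<^sub>F n in sequentially. of_int (fixval n x) = poly ?p (qint ?q n)"
        using fixval_cong[OF xy] fixval_comb[where 'f = 'f and D = D and c = c and m = m]
        by eventually_elim simp
      then have "x \<in> ?g ?p" using x(1) by (simp add: germ_class_def)
      then have "Z = ?g ?p" using germ_class_coset[of x ?p] x(2) by simp
      moreover have "?p \<in> ?A"
        by (rule R_q_large_comb[OF q])
      ultimately show "Z \<in> (\<lambda>p \<in> ?A. ?g p) ` ?A" by auto
    qed
    moreover have "(\<lambda>p \<in> ?A. ?g p) ` ?A \<subseteq> carrier ?T"
    proof clarsimp
      fix p assume p: "p \<in> ?A"
      obtain x where x: "x \<in> ?g p" by (rule germ_class_nonempty[OF p])
      show "?g p \<in> carrier ?T"
        using germ_class_coset[OF x] gF[OF x] unfolding carr by auto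
    qed
    ultimately show "bij_betw (\<lambda>p \<in> ?A. ?g p) ?A (carrier ?T)"
      unfolding bij_betw_def by blast
  qed
qed

text \<open>The set where two ring homomorphisms agree is an additive group, and the \<open>\<omega>\<^sub>m\<^sub>,\<^sub>d\<close> generate the
additive group of the ring.\<close>

lemma ring_hom_R_q_large_unique:
  assumes q: "q > 0" and T: "ring T" and \<phi>: "\<phi> \<in> ring_hom (R_q_large q) T" and \<psi>: "\<psi> \<in> ring_hom (R_q_large q) T"
    and eq: "\<And>m d. \<phi> (omega q m d) = \<psi> (omega q m d)" and p: "p \<in> carrier (R_q_large q)"
  shows "\<phi> p = \<psi> p"
proof -
  interpret R: cring "R_q_large q" by (rule cring_R_q_large[OF q])
  interpret \<phi>: ring_hom_ring "R_q_large q" T \<phi> by (rule ring_hom_ringI2[OF R.ring_axioms T \<phi>])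
  interpret \<psi>: ring_hom_ring "R_q_large q" T \<psi> by (rule ring_hom_ringI2[OF R.ring_axioms T \<psi>])
  define A where "A = {p \<in> carrier (R_q_large q). \<phi> p = \<psi> p}"
  have add: "x + y \<in> A" if "x \<in> A" "y \<in> A" for x y
    using that \<phi>.hom_add[of x y] \<psi>.hom_add[of x y] R.a_closed[of x y] by (simp add: A_def)
  have zero: "0 \<in> A" using \<phi>.hom_zero \<psi>.hom_zero R.zero_closed by (simp add: A_def)
  have uminus: "- x \<in> A" if "x \<in> A" for x
  proof -
    have x: "x \<in> carrier (R_q_large q)" using that by (simp add: A_def)
    have mx: "- x \<in> carrier (R_q_large q)" using R_q_large_closed(2)[OF q R.zero_closed x] by simp
    have "\<ominus>\<^bsub>R_q_large q\<^esub> x = - x" by (rule R.minus_equality) (use x mx in simp_all)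
    then show ?thesis using \<phi>.hom_a_inv[OF x] \<psi>.hom_a_inv[OF x] that mx by (simp add: A_def)
  qed
  have nat: "smult (of_nat k) x \<in> A" if "x \<in> A" for k x
    by (induction k) (use zero add that in \<open>auto simp: smult_add_left\<close>)
  have int: "smult (of_int k) x \<in> A" if "x \<in> A" for k x
  proof (cases k)
    case (nonneg n)
    then show ?thesis using nat[OF that, of n] by simp
  next
    case (neg n)
    have "smult (of_int k) x = - smult (of_nat (Suc n)) x"
      by (simp only: neg of_int_minus of_int_of_nat_eq smult_minus_left)
    then show ?thesis using uminus[OF nat[OF that, of "Suc n"]] by (simp only:)
  qed
  obtain m and D :: nat and c :: "nat \<Rightarrow> int" where pc: "p = omega_comb q m D c"
    by (rule R_q_large_spanned[OF q p])
  have omega: "omega q m d \<in> A" for m d using omega_R_q_large[OF q] eq by (simp add: A_def)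
  have "omega_comb q m D c \<in> A"
    by (induction D) (use zero add int[OF omega] in auto)
  then show ?thesis using pc by (simp add: A_def)
qed

theorem theorem15p7:
  fixes q :: nat
  assumes "q = card (UNIV :: 'f::{field,finite} set)"
  shows "\<exists>!\<phi>. \<phi> \<in> extensional (carrier (R_q_large q)) \<and>
    \<phi> \<in> ring_iso (R_q_large q)
          (Theta (GL_inf :: ('f fsv \<Rightarrow> 'f fsv) monoid) GL_inf_top
            :: ('f fsv \<Rightarrow> 'f fsv, 'f fsv set) gset int_mpoly set ring) \<and>
    (\<forall>m d. \<phi> (omega q m d) = theta_class GL_inf GL_inf_top (Omega m d))"
proof -
  have q: "q > 0" using card_field_gt_1[where 'f = 'f] assms by simp
  let ?T = "Theta GL_inf GL_inf_top :: ('f fsv \<Rightarrow> 'f fsv, 'f fsv set) gset int_mpoly set ring"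
  let ?\<phi> = "\<lambda>p \<in> carrier (R_q_large q). germ_class p :: ('f fsv \<Rightarrow> 'f fsv, 'f fsv set) gset int_mpoly set"
  have ringT: "ring ?T"
    unfolding Theta_def by (rule ideal.quotient_is_ring[OF theta_ideal_ideal])
  have iso: "?\<phi> \<in> ring_iso (R_q_large q) ?T"
    unfolding assms by (rule ring_iso_germ_class)
  have omega: "?\<phi> (omega q m d) = theta_class GL_inf GL_inf_top (Omega m d)" for m d
    using germ_class_coset[OF germ_class_omega[where 'f = 'f, of m d]] omega_R_q_large[OF q, of m d]
    by (simp add: theta_class_def assms)
  show ?thesis
  proof (rule ex1I[of _ ?\<phi>])
    show "?\<phi> \<in> extensional (carrier (R_q_large q)) \<and> ?\<phi> \<in> ring_iso (R_q_large q) ?T \<and>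
        (\<forall>m d. ?\<phi> (omega q m d) = theta_class GL_inf GL_inf_top (Omega m d))"
      using iso omega by blast
    fix \<psi> assume \<psi>: "\<psi> \<in> extensional (carrier (R_q_large q)) \<and> \<psi> \<in> ring_iso (R_q_large q) ?T \<and>
        (\<forall>m d. \<psi> (omega q m d) = theta_class GL_inf GL_inf_top (Omega m d))"
    then have ext: "\<psi> \<in> extensional (carrier (R_q_large q))" and hom: "\<psi> \<in> ring_hom (R_q_large q) ?T"
      and eq: "\<And>m d. \<psi> (omega q m d) = theta_class GL_inf GL_inf_top (Omega m d)"
      by (simp_all add: ring_iso_def)
    have hom': "?\<phi> \<in> ring_hom (R_q_large q) ?T" using iso by (simp add: ring_iso_def)
    have eq': "\<psi> (omega q m d) = ?\<phi> (omega q m d)" for m d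
      by (rule trans[OF eq omega[symmetric]])
    show "\<psi> = ?\<phi>"
      by (rule extensionalityI[OF ext restrict_extensional])
        (rule ring_hom_R_q_large_unique[OF q ringT hom hom' eq'])
  qed
qed

end
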